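(* For every $n\in\mathbb N$ let $\Theta^{(n)}$ be a random vector uniformly distributed on the unit sphere $\mathbb{S}^{n-1}$. Then the sequence of random probability measures $(\mu_{\Theta^{(n)}})_{n\in \mathbb N}$ satisfies a (full) large deviation principle on $\mathcal M_1(\mathbb R)$ at speed $n$ and with a good rate function $I: \mathcal M_1(\mathbb R)\to [0,+\infty]$ given by $$ I(\nu(\alpha)) = - \frac{1}{2} \log \left( 1 - \|\alpha\|_2^2 \right) $$ whenever $\nu(\alpha)$ is equal to the law of the random variable $$ \sqrt{1 - \|\alpha\|_2^2 }\, \frac{ Z}{ \sqrt{3}} + \sum_{ k =1}^\infty \alpha_k U_k, $$ where $\alpha_1\geq \alpha_2\geq \ldots \geq 0$ is a non-increasing sequence of non-negative reals satisfying $\|\alpha\|_2^2 := \sum_{ k = 1}^\infty \alpha_k^2 < 1$, $Z$ is a standard Gaussian random variable, $U_1,U_2,\ldots$ are uniform random variables on $[-1,1]$, and $Z,U_1,U_2,\ldots$ are independent. Whenever $\nu\in\mathcal M_1(\mathbb R)$ is not of this form, $I(\nu) = + \infty$.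
   Context: $\mathbb S^{n-1}=\{x\in\mathbb R^n: \|x\|_2=1\}$ is the Euclidean unit sphere. $\mathcal M_1(\mathbb R)$ is the set of Borel probability measures on $\mathbb R$ endowed with the weak topology (topology of weak convergence of probability measures, which is metrizable). For a deterministic $\theta=(\theta_1,\ldots,\theta_n)\in\mathbb S^{n-1}$, $\mu_{\theta}$ is the probability measure on $\mathbb R$ given by $\mu_{\theta}(A):=\mathbb P[\langle U^{(n)},\theta\rangle\in A]=\frac1{2^n}\int_{[-1,1]^n}\mathbb 1\{\langle u,\theta\rangle\in A\}\,du$ for Borel $A\subset\mathbb R$, where $U^{(n)}=(U_1,\ldots,U_n)$ is uniformly distributed on the cube $[-1,1]^n$; that is, $\mu_\theta$ is the law of $\theta_1U_1+\ldots+\theta_nU_n$. When $\theta$ is replaced by the random vector $\Theta^{(n)}$, $\mu_{\Theta^{(n)}}$ is a random element of $\mathcal M_1(\mathbb R)$. Large deviation principle: let $(\xi_n)_{n\in\mathbb N}$ be random elements of a metric space $M$, $(s_n)$ positive reals with $s_n\uparrow\infty$, and $\mathcal I:M\to[0,+\infty]$ lower semicontinuous. $(\xi_n)$ satisfies a (full) LDP with speed $s_n$ and rate function $\mathcal I$ if for all Borel sets $A\subset M$ $$-\inf_{x\in A^\circ}\mathcal I(x)\le\liminf_{n\to\infty}\frac1{s_n}\log\mathbb P[\xi_n\in A]\le\limsup_{n\to\infty}\frac1{s_n}\log\mathbb P[\xi_n\in A]\le-\inf_{x\in\overline A}\mathcal I(x),$$ where $A^\circ$ and $\overline A$ are the interior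 and closure of $A$. The rate function is good if $\{x\in M:\mathcal I(x)\le c\}$ is compact for every finite $c\ge0$. *)

theory Defs
  imports "HOL-Probability.Probability"
begin

text \<open>Vectors in \<open>\<real>\<^sup>n\<close> are elements of \<open>space (\<Pi>\<^sub>M i\<in>{..<n}. borel)\<close>; coordinates are numbered
  from \<open>0\<close>. Likewise, sequences start at index \<open>0\<close>.\<close>

abbreviation euclidean_borel :: "nat \<Rightarrow> (nat \<Rightarrow> real) measure" where
  "euclidean_borel n \<equiv> (\<Pi>\<^sub>M i\<in>{..<n}. borel)"

abbreviation euclidean_lborel :: "nat \<Rightarrow> (nat \<Rightarrow> real) measure" where
  "euclidean_lborel n \<equiv> (\<Pi>\<^sub>M i\<in>{..<n}. lborel)"


subsection \<open>The uniform distributions on the ball, the sphere and the cube\<close>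

definition unit_ball :: "nat \<Rightarrow> (nat \<Rightarrow> real) set" where
  "unit_ball n = {x \<in> ({..<n} \<rightarrow>\<^sub>E UNIV). L2_set x {..<n} \<le> 1}"

definition unit_sphere :: "nat \<Rightarrow> (nat \<Rightarrow> real) set" where
  "unit_sphere n = {x \<in> ({..<n} \<rightarrow>\<^sub>E UNIV). L2_set x {..<n} = 1}"

text \<open>The normalised surface measure of the Euclidean sphere, given in polar coordinates: the mass
  of a Borel set \<open>A\<close> of the sphere is the proportion of the volume of the unit ball that is
  occupied by the cone \<open>{r x | r \<in> (0, 1], x \<in> A}\<close>. It is only meaningful for \<open>n \<ge> 1\<close>.\<close>

definition sphere_uniform :: "nat \<Rightarrow> (nat \<Rightarrow> real) measure" where
  "sphere_uniform n =
     distr (uniform_measure (euclidean_lborel n) (unit_ball n)) (euclidean_borel n)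
       (\<lambda>x. \<lambda>i\<in>{..<n}. x i / L2_set x {..<n})"

definition cube_uniform :: "nat \<Rightarrow> (nat \<Rightarrow> real) measure" where
  "cube_uniform n = uniform_measure (euclidean_lborel n) ({..<n} \<rightarrow>\<^sub>E {-1..1})"

definition cube_projection :: "nat \<Rightarrow> (nat \<Rightarrow> real) \<Rightarrow> real measure" where
  "cube_projection n \<theta> = distr (cube_uniform n) borel (\<lambda>u. \<Sum>i<n. u i * \<theta> i)"


subsection \<open>The space of probability measures on the line\<close>

text \<open>The topology of weak convergence: the coarsest topology on the Borel probability measures
  for which all integrals of bounded continuous functions are continuous.\<close>

definition weak_topology :: "real measure topology" where
  "weak_topology = topology_generated_by
     {{\<mu>. real_distribution \<mu> \<and> (\<integral>x. f x \<partial>\<mu>) \<in> U} | (f :: real \<Rightarrow> real) (U :: real set).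
        continuous_on UNIV f \<and> bounded (range f) \<and> open U}"

definition borel_algebra :: "'b topology \<Rightarrow> 'b measure" where
  "borel_algebra X = sigma (topspace X) {U. openin X U}"


subsection \<open>Large deviation principles\<close>

text \<open>Logarithm of a probability, with \<open>log 0 = -\<infinity>\<close> (whereas \<open>ln 0 = 0\<close>).\<close>

definition log_prob :: "real \<Rightarrow> ereal" where
  "log_prob p = (if p = 0 then -\<infinity> else ereal (ln p))"

definition rate_function :: "'b topology \<Rightarrow> ('b \<Rightarrow> ereal) \<Rightarrow> bool" where
  "rate_function X I \<longleftrightarrow>
     (\<forall>x\<in>topspace X. 0 \<le> I x) \<and>
     (\<forall>c::real. closedin X {x \<in> topspace X. I x \<le> ereal c})"

definition good_rate_function :: "'b topology \<Rightarrow> ('b \<Rightarrow> ereal) \<Rightarrow> bool" where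
  "good_rate_function X I \<longleftrightarrow>
     rate_function X I \<and> (\<forall>c\<ge>0. compactin X {x \<in> topspace X. I x \<le> ereal c})"

text \<open>The random elements \<open>\<xi> n\<close> are indexed by \<open>n \<ge> 1\<close>, and each may live on its own probability
  space \<open>M n\<close>.\<close>

definition satisfies_LDP ::
  "'b topology \<Rightarrow> (nat \<Rightarrow> 'a measure) \<Rightarrow> (nat \<Rightarrow> 'a \<Rightarrow> 'b) \<Rightarrow> (nat \<Rightarrow> real) \<Rightarrow> ('b \<Rightarrow> ereal) \<Rightarrow> bool"
where
  "satisfies_LDP X M \<xi> s I \<longleftrightarrow>
     (\<forall>n\<ge>1. prob_space (M n) \<and> \<xi> n \<in> M n \<rightarrow>\<^sub>M borel_algebra X) \<and>
     (\<forall>n\<ge>1. 0 < s n \<and> s n \<le> s (Suc n)) \<and> filterlim s at_top sequentially \<and>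
     rate_function X I \<and>
     (\<forall>A\<in>sets (borel_algebra X).
        - (INF x\<in>X interior_of A. I x)
          \<le> liminf (\<lambda>n. log_prob (measure (M n) {\<omega> \<in> space (M n). \<xi> n \<omega> \<in> A}) / ereal (s n)) \<and>
        limsup (\<lambda>n. log_prob (measure (M n) {\<omega> \<in> space (M n). \<xi> n \<omega> \<in> A}) / ereal (s n))
          \<le> - (INF x\<in>X closure_of A. I x))"


subsection \<open>The limit laws\<close>

definition admissible :: "(nat \<Rightarrow> real) set" where
  "admissible = {\<alpha>. decseq \<alpha> \<and> (\<forall>k. 0 \<le> \<alpha> k) \<and>
                    summable (\<lambda>k. (\<alpha> k)\<^sup>2) \<and> (\<Sum>k. (\<alpha> k)\<^sup>2) < 1}"

text \<open>The law of \<open>\<surd>(1 - \<parallel>\<alpha>\<parallel>\<^sup>2) Z / \<surd>3 + \<Sum>\<^sub>k \<alpha>\<^sub>k U\<^sub>k\<close>, for independent \<open>Z, U\<^sub>0, U\<^sub>1, \<dots>\<close> realised on a product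
  space. For square-summable \<open>\<alpha>\<close> the random series converges almost surely, in general not
  absolutely; the value of \<open>suminf\<close> on the exceptional null set is immaterial.\<close>

definition limit_law :: "(nat \<Rightarrow> real) \<Rightarrow> real measure" where
  "limit_law \<alpha> =
     distr (std_normal_distribution \<Otimes>\<^sub>M (\<Pi>\<^sub>M k\<in>UNIV. uniform_measure lborel {-1..1})) borel
       (\<lambda>(z, u). sqrt (1 - (\<Sum>k. (\<alpha> k)\<^sup>2)) * (z / sqrt 3) + (\<Sum>k. \<alpha> k * u k))"


subsection \<open>Well-definedness\<close>

lemma topspace_weak_topology: "topspace weak_topology = {\<mu>. real_distribution \<mu>}"
proof -
  have "\<Union>{{\<mu>. real_distribution \<mu> \<and> (\<integral>x. f x \<partial>\<mu>) \<in> U} | (f :: real \<Rightarrow> real) (U :: real set).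
        continuous_on UNIV f \<and> bounded (range f) \<and> open U} = {\<mu>. real_distribution \<mu>}"
    by (auto intro!: exI[of _ "\<lambda>_. 0::real"] exI[of _ "UNIV :: real set"]
        exI[of _ "{\<mu>. real_distribution \<mu>}"])
  then show ?thesis
    by (simp add: weak_topology_def)
qed

lemma unit_ball_sets: "unit_ball n \<in> sets (euclidean_lborel n)"
proof -
  have "{x \<in> space (euclidean_lborel n). L2_set x {..<n} \<le> 1} \<in> sets (euclidean_lborel n)"
    unfolding L2_set_def by measurable
  then show ?thesis
    by (simp add: unit_ball_def space_PiM)
qed

lemma emeasure_box:
  fixes a :: real
  assumes "0 \<le> a"
  shows "emeasure (euclidean_lborel n) ({..<n} \<rightarrow>\<^sub>E {-a..a}) = ennreal ((2 * a) ^ n)"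
proof -
  interpret product_sigma_finite "\<lambda>_. lborel :: real measure" ..
  have "emeasure (euclidean_lborel n) ({..<n} \<rightarrow>\<^sub>E {-a..a}) =
          (\<Prod>i<n. emeasure lborel {-a..a})"
    by (rule emeasure_PiM) auto
  also have "\<dots> = ennreal ((2 * a) ^ n)"
    using assms by (simp add: ennreal_power)
  finally show ?thesis .
qed

lemma unit_ball_subset_cube: "unit_ball n \<subseteq> ({..<n} \<rightarrow>\<^sub>E {-1..1})"
proof
  fix x assume x: "x \<in> unit_ball n"
  have "\<bar>x i\<bar> \<le> 1" if "i < n" for i
  proof -
    have "(x i)\<^sup>2 \<le> (\<Sum>j<n. (x j)\<^sup>2)"
      using that by (intro member_le_sum) auto
    also have "\<dots> \<le> 1"
      using x by (simp add: unit_ball_def L2_set_def)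
    finally show ?thesis
      by (simp add: abs_square_le_1)
  qed
  with x show "x \<in> ({..<n} \<rightarrow>\<^sub>E {-1..1})"
    by (auto simp: unit_ball_def PiE_iff abs_le_iff minus_le_iff)
qed

lemma cube_subset_unit_ball:
  assumes "1 \<le> n"
  shows "({..<n} \<rightarrow>\<^sub>E {-(1 / real n)..1 / real n}) \<subseteq> unit_ball n"
proof
  fix x assume x: "x \<in> ({..<n} \<rightarrow>\<^sub>E {-(1 / real n)..1 / real n})"
  have "L2_set x {..<n} \<le> (\<Sum>i<n. \<bar>x i\<bar>)"
    by (rule L2_set_le_sum_abs)
  also have "\<dots> \<le> (\<Sum>i<n. 1 / real n)"
    using x by (intro sum_mono) (auto simp: PiE_iff abs_le_iff minus_le_iff)
  also have "\<dots> = 1"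
    using assms by simp
  finally show "x \<in> unit_ball n"
    using x by (auto simp: unit_ball_def PiE_iff)
qed

lemma prob_space_sphere_uniform:
  assumes "1 \<le> n"
  shows "prob_space (sphere_uniform n)"
proof -
  have "emeasure (euclidean_lborel n) (unit_ball n) \<noteq> 0"
  proof -
    have "0 < ennreal ((2 * (1 / real n)) ^ n)"
      using assms by simp
    also have "\<dots> = emeasure (euclidean_lborel n) ({..<n} \<rightarrow>\<^sub>E {-(1 / real n)..1 / real n})"
      by (rule emeasure_box[symmetric]) simp
    also have "\<dots> \<le> emeasure (euclidean_lborel n) (unit_ball n)"
      by (intro emeasure_mono cube_subset_unit_ball assms unit_ball_sets)
    finally show ?thesis by simp
  qed
  moreover have "emeasure (euclidean_lborel n) (unit_ball n) \<noteq> \<infinity>"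
  proof -
    have "emeasure (euclidean_lborel n) (unit_ball n)
            \<le> emeasure (euclidean_lborel n) ({..<n} \<rightarrow>\<^sub>E {-1..1})"
      by (intro emeasure_mono unit_ball_subset_cube sets_PiM_I_finite) auto
    also have "\<dots> < \<infinity>"
      using emeasure_box[of 1 n] by (simp add: ennreal_less_top)
    finally show ?thesis by simp
  qed
  ultimately interpret prob_space "uniform_measure (euclidean_lborel n) (unit_ball n)"
    by (rule prob_space_uniform_measure)
  show ?thesis
    unfolding sphere_uniform_def L2_set_def by (rule prob_space_distr) measurable
qed

lemma AE_sphere_uniform:
  assumes "1 \<le> n"
  shows "AE x in sphere_uniform n. x \<in> unit_sphere n"
proof -
  have null: "{\<lambda>i\<in>{..<n}. 0} \<in> null_sets (euclidean_lborel n)"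
  proof -
    have "({..<n} \<rightarrow>\<^sub>E {0::real}) = {\<lambda>i\<in>{..<n}. 0}"
      by (auto simp: PiE_iff extensional_def fun_eq_iff)
    moreover have "emeasure (euclidean_lborel n) ({..<n} \<rightarrow>\<^sub>E {0}) = 0"
      using emeasure_box[of 0 n] assms by simp
    moreover have "({..<n} \<rightarrow>\<^sub>E {0::real}) \<in> sets (euclidean_lborel n)"
      by (intro sets_PiM_I_finite) auto
    ultimately show ?thesis
      using assms by (auto simp: null_sets_def)
  qed
  have sphere: "(\<lambda>i\<in>{..<n}. x i / L2_set x {..<n}) \<in> unit_sphere n"
    if x: "x \<in> space (euclidean_lborel n)" "x \<noteq> (\<lambda>i\<in>{..<n}. 0)" for x
  proof -
    have "L2_set x {..<n} \<noteq> 0"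
      using x by (auto simp: space_PiM PiE_iff extensional_def fun_eq_iff L2_set_eq_0_iff
          split: if_split_asm)
    moreover have "L2_set (\<lambda>i\<in>{..<n}. x i / L2_set x {..<n}) {..<n}
        = L2_set (\<lambda>i. (1 / L2_set x {..<n}) * x i) {..<n}"
      by (intro L2_set_cong) auto
    moreover have "\<dots> = (1 / L2_set x {..<n}) * L2_set x {..<n}"
      by (intro L2_set_right_distrib[symmetric]) (simp add: L2_set_nonneg)
    ultimately show ?thesis
      by (simp add: unit_sphere_def)
  qed
  have meas: "{x \<in> space (euclidean_borel n). x \<in> unit_sphere n} \<in> sets (euclidean_borel n)"
  proof -
    have "{x \<in> space (euclidean_borel n). L2_set x {..<n} = 1} \<in> sets (euclidean_borel n)"
      unfolding L2_set_def by measurable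
    then show ?thesis
      by (simp add: unit_sphere_def space_PiM)
  qed
  have "AE x in euclidean_lborel n. (\<lambda>i\<in>{..<n}. x i / L2_set x {..<n}) \<in> unit_sphere n"
    by (rule AE_I'[OF null]) (use sphere in auto)
  then have "AE x in uniform_measure (euclidean_lborel n) (unit_ball n).
      (\<lambda>i\<in>{..<n}. x i / L2_set x {..<n}) \<in> unit_sphere n"
    by (intro AE_uniform_measureI unit_ball_sets) auto
  moreover have "(\<lambda>x. \<lambda>i\<in>{..<n}. x i / L2_set x {..<n})
      \<in> uniform_measure (euclidean_lborel n) (unit_ball n) \<rightarrow>\<^sub>M euclidean_borel n"
    unfolding L2_set_def by measurable
  ultimately show ?thesis
    unfolding sphere_uniform_def using AE_distr_iff[OF _ meas] by blast
qed

lemma real_distribution_cube_projection: "real_distribution (cube_projection n \<theta>)"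
proof -
  interpret prob_space "cube_uniform n"
    unfolding cube_uniform_def
    by (rule prob_space_uniform_measure) (use emeasure_box[of 1 n] in auto)
  show ?thesis
    unfolding cube_projection_def
    by (rule real_distribution_distr) (simp add: cube_uniform_def)
qed

lemma real_distribution_limit_law: "real_distribution (limit_law \<alpha>)"
proof -
  interpret N: prob_space std_normal_distribution
    using real_dist_normal_dist by (simp add: real_distribution_def)
  interpret U: prob_space "uniform_measure lborel {-1..1::real}"
    by (rule prob_space_uniform_measure) auto
  interpret P: product_prob_space "\<lambda>_::nat. uniform_measure lborel {-1..1::real}" UNIV ..
  interpret Q: pair_prob_space std_normal_distribution
    "\<Pi>\<^sub>M k\<in>(UNIV :: nat set). uniform_measure lborel {-1..1::real}" ..
  show ?thesis
    unfolding limit_law_def by (rule Q.real_distribution_distr) measurable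
qed

end

theory Submission
  imports Defs
begin

text \<open>The laws of the theorem, together with those of norm one, are a continuous image of the compact
  space of non-increasing sequences in the unit ball of \<open>\<ell>\<^sup>2\<close> with coordinatewise convergence: since
  \<open>(\<alpha> k)\<^sup>2 \<le> 1 / (k + 1)\<close>, replacing the tail of the uniform series by a Gaussian variable changes
  the characteristic function by an amount that is small uniformly in \<open>\<alpha>\<close>. The random measure
  \<open>\<mu>\<^sub>\<Theta>\<close> is the image of the decreasing rearrangement of \<open>|\<Theta>|\<close>, so the large deviations are those of
  this rearrangement. There, asking that \<open>m\<close> coordinates carry squared mass \<open>r\<close> confines the other
  \<open>n - m\<close> coordinates to a ball of radius \<open>\<surd>(1 - r)\<close>, at the cost \<open>(1 - r)\<^bsup>n/2\<^esup>\<close> in volume; conversely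
  almost all of that smaller ball has only small coordinates. The rate is well defined because the zeros
  of the characteristic function determine \<open>\<alpha>\<close>.\<close>

subsection \<open>Series of independent uniform variables\<close>

text \<open>Every realisation of the random measure has a parameter of norm one and hence no
  Gaussian part; parameters of smaller norm arise only as limits, when squared mass spreads over
  many small coordinates. The norm is merely lower semicontinuous for coordinatewise convergence,
  but lost mass reappears as Gaussian variance: U_k and Z / sqrt 3 both have variance 1/3, so the
  total variance is 1/3 on the whole parameter space. This is why the laws depend continuously on
  the parameter although the Gaussian coefficient does not, and why the rate sees only the mass that
  stays in fixed coordinates. Compactness of the parameter space takes the place of exponential
  tightness. Choosing which coordinates are large, and comparing ball volumes in dimensions n and n
  - m, costs powers of n whose exponents depend on m only; these vanish at speed n.\<close>

abbreviation unif :: "real measure" where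
  "unif \<equiv> uniform_measure lborel {-1..1}"

abbreviation unif_seq :: "(nat \<Rightarrow> real) measure" where
  "unif_seq \<equiv> \<Pi>\<^sub>M k\<in>UNIV. unif"

lemma prob_space_unif: "prob_space unif"
  by (rule prob_space_uniform_measure) auto

interpretation unif: sequence_space unif
proof -
  interpret prob_space unif by (rule prob_space_unif)
  show "sequence_space unif" ..
qed

lemma unif_eq_density: "unif = density lborel (\<lambda>x. ennreal (indicator {-1..1} x / 2))"
  unfolding uniform_measure_def
  by (intro density_cong) (auto simp: indicator_def divide_ennreal simp flip: ennreal_1 ennreal_numeral)

lemma integral_unif_FTC:
  fixes f F :: "real \<Rightarrow> 'a::euclidean_space"
  assumes F: "\<And>x. (F has_vector_derivative f x) (at x)" and f: "continuous_on UNIV f"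
  shows "(\<integral>x. f x \<partial>unif) = (F 1 - F (-1)) /\<^sub>R 2"
proof -
  have "f \<in> borel_measurable borel"
    using f by (rule borel_measurable_continuous_onI)
  then have "(\<integral>x. f x \<partial>unif) = (\<integral>x. (indicator {-1..1} x / 2) *\<^sub>R f x \<partial>lborel)"
    unfolding unif_eq_density by (subst integral_density) auto
  also have "\<dots> = (\<integral>x. indicator {-1..1} x *\<^sub>R f x \<partial>lborel) /\<^sub>R 2"
    by (subst integral_scaleR_right[symmetric], rule Bochner_Integration.integral_cong)
       (auto simp: indicator_def)
  also have "(\<integral>x. indicator {-1..1} x *\<^sub>R f x \<partial>lborel) = F 1 - F (-1)"
    by (rule integral_FTC_atLeastAtMost)
       (auto intro!: has_vector_derivative_at_within F continuous_on_subset[OF f])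
  finally show ?thesis .
qed

lemma char_unif: "char unif t = complex_of_real (sinc t)"
proof (cases "t = 0")
  case True
  then show ?thesis
    using unif.M.prob_space by (simp add: char_def)
next
  case False
  have "char unif t = (iexp (t * 1) / (\<i> * t) - iexp (t * (-1)) / (\<i> * t)) /\<^sub>R 2"
    unfolding char_def
  proof (rule integral_unif_FTC)
    fix x :: real
    have "((\<lambda>z. exp (\<i> * (t * z)) / (\<i> * t)) has_field_derivative exp (\<i> * (t * complex_of_real x))) (at (complex_of_real x))"
      using False by (auto intro!: derivative_eq_intros simp: complex_eq_iff)
    then show "((\<lambda>x. iexp (t * x) / (\<i> * t)) has_vector_derivative iexp (t * x)) (at x)"
      by (auto dest: has_vector_derivative_real_field)
  qed (auto intro!: continuous_intros)
  also have "\<dots> = complex_of_real (sinc t)"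
  proof -
    have "iexp t - iexp (- t) = 2 * \<i> * complex_of_real (sin t)"
      by (simp add: complex_eq_iff Re_exp Im_exp)
    then have "iexp (t * 1) / (\<i> * t) - iexp (t * (-1)) / (\<i> * t) = 2 * \<i> * sin t / (\<i> * t)"
      by (simp flip: diff_divide_distrib)
    then show ?thesis
      using False by (simp add: scaleR_conv_of_real)
  qed
  finally show ?thesis .
qed

text \<open>One conditioning step for the maximal inequality: the cross term averages out and u^2
  has mean 1/3. \<open>V\<close> will hold the variance of the remaining summands and
  \<open>c\<close> the factor 1 / \<epsilon>^2.\<close>

lemma nn_integral_unif_square:
  assumes "0 \<le> c" "0 \<le> V"
  shows "(\<integral>\<^sup>+u. ennreal (((x + b * u)\<^sup>2 + V) * c) \<partial>unif) = ennreal ((x\<^sup>2 + (b\<^sup>2 / 3 + V)) * c)"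
proof -
  let ?f = "\<lambda>u. ((x + b * u)\<^sup>2 + V) * c"
  have "integrable unif ?f"
  proof (rule unif.M.integrable_const_bound)
    show "AE u in unif. norm (?f u) \<le> ((\<bar>x\<bar> + \<bar>b\<bar>)\<^sup>2 + V) * c"
    proof (intro AE_uniform_measureI AE_I2 impI)
      fix u :: real assume u: "u \<in> {-1..1}"
      have "\<bar>x + b * u\<bar> \<le> \<bar>x\<bar> + \<bar>b\<bar> * \<bar>u\<bar>"
        using abs_triangle_ineq[of x "b * u"] by (simp add: abs_mult)
      also have "\<dots> \<le> \<bar>x\<bar> + \<bar>b\<bar> * 1"
        using u by (intro add_left_mono mult_left_mono) auto
      finally have "(x + b * u)\<^sup>2 \<le> (\<bar>x\<bar> + \<bar>b\<bar>)\<^sup>2"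
        by (simp add: abs_le_square_iff[symmetric])
      then show "norm (?f u) \<le> ((\<bar>x\<bar> + \<bar>b\<bar>)\<^sup>2 + V) * c"
        using assms by (simp add: mult_right_mono)
    qed auto
  qed auto
  moreover have "(\<integral>u. ?f u \<partial>unif)
      = ((x\<^sup>2 + x * b + b\<^sup>2 / 3 + V) * c - (- (x\<^sup>2) + x * b - b\<^sup>2 / 3 - V) * c) /\<^sub>R 2"
  proof (subst integral_unif_FTC[where F="\<lambda>u. (x\<^sup>2 * u + x * b * u\<^sup>2 + b\<^sup>2 * u ^ 3 / 3 + V * u) * c"])
    fix u :: real
    have "((\<lambda>u. (x\<^sup>2 * u + x * b * u\<^sup>2 + b\<^sup>2 * u ^ 3 / 3 + V * u) * c) has_real_derivative
        (x\<^sup>2 + x * b * (2 * u) + b\<^sup>2 * (3 * u\<^sup>2) / 3 + V) * c) (at u)"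
      by (auto intro!: derivative_eq_intros)
    also have "(x\<^sup>2 + x * b * (2 * u) + b\<^sup>2 * (3 * u\<^sup>2) / 3 + V) * c = ?f u"
      by (simp add: power2_eq_square algebra_simps)
    finally show "((\<lambda>u. (x\<^sup>2 * u + x * b * u\<^sup>2 + b\<^sup>2 * u ^ 3 / 3 + V * u) * c) has_vector_derivative ?f u) (at u)"
      by (simp add: has_real_derivative_iff_has_vector_derivative)
  qed (auto intro!: continuous_intros)
  ultimately show ?thesis
    using assms by (subst nn_integral_eq_integral) (auto simp: algebra_simps)
qed

section \<open>Maximal inequality and almost sure convergence of the uniform series\<close>

lemma distr_case_nat_unif_seq:
  "distr (unif \<Otimes>\<^sub>M unif_seq) unif_seq (\<lambda>(s, \<omega>). case_nat s \<omega>) = unif_seq"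
  by (rule unif.PiM_iter)

lemma sum_case_nat:
  fixes a :: "nat \<Rightarrow> real"
  shows "(\<Sum>i<Suc n. a i * case_nat s \<omega> i) = a 0 * s + (\<Sum>i<n. a (Suc i) * \<omega> i)"
  by (subst sum.lessThan_Suc_shift) simp

text \<open>The arbitrary starting point \<open>x\<close> makes Kolmogorov's maximal inequality provable by induction on
  the number of summands, conditioning on the first one.\<close>

lemma kolmogorov_unif_seq:
  fixes a :: "nat \<Rightarrow> real"
  assumes \<epsilon>: "0 < \<epsilon>"
  shows "emeasure unif_seq {\<omega>. \<exists>k\<le>n. \<epsilon> \<le> \<bar>x + (\<Sum>i<k. a i * \<omega> i)\<bar>}
    \<le> ennreal ((x\<^sup>2 + (\<Sum>i<n. (a i)\<^sup>2 / 3)) / \<epsilon>\<^sup>2)"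
proof (induction n arbitrary: a x)
  case 0
  show ?case
  proof (cases "\<epsilon> \<le> \<bar>x\<bar>")
    case True
    then have "1 \<le> x\<^sup>2 / \<epsilon>\<^sup>2"
      using \<epsilon> by (simp add: abs_le_square_iff[symmetric])
    then show ?thesis
      using True unif.P.emeasure_space_1 by (simp add: space_PiM ennreal_le_iff2 flip: ennreal_1)
  qed simp
next
  case (Suc n)
  let ?E = "{\<omega>. \<exists>k\<le>Suc n. \<epsilon> \<le> \<bar>x + (\<Sum>i<k. a i * \<omega> i)\<bar>}"
  let ?F = "\<lambda>s. {\<omega>. \<exists>k\<le>n. \<epsilon> \<le> \<bar>(x + a 0 * s) + (\<Sum>i<k. a (Suc i) * \<omega> i)\<bar>}"
  have space: "space unif_seq = UNIV"
    by (simp add: space_PiM)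
  show ?case
  proof (cases "\<epsilon> \<le> \<bar>x\<bar>")
    case True
    then have "\<epsilon>\<^sup>2 \<le> x\<^sup>2"
      using \<epsilon> by (simp add: abs_le_square_iff[symmetric])
    also have "\<dots> \<le> x\<^sup>2 + (\<Sum>i<Suc n. (a i)\<^sup>2 / 3)"
      by (auto intro!: sum_nonneg simp del: sum.lessThan_Suc)
    finally have le: "ennreal 1 \<le> ennreal ((x\<^sup>2 + (\<Sum>i<Suc n. (a i)\<^sup>2 / 3)) / \<epsilon>\<^sup>2)"
      using \<epsilon> by (intro ennreal_leI) simp
    have "emeasure unif_seq ?E \<le> ennreal 1"
      using unif.P.emeasure_le_1 by simp
    then show ?thesis
      using le by (rule order_trans)
  next
    case False
    have E: "{\<omega> \<in> space unif_seq. \<exists>k\<le>Suc n. \<epsilon> \<le> \<bar>x + (\<Sum>i<k. a i * \<omega> i)\<bar>} \<in> sets unif_seq"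
      by measurable
    \<comment> \<open>Prepending an independent uniform coordinate reproduces
      \<open>unif_seq\<close>, so the event can be integrated over its first coordinate, which
      leaves a shifted coefficient sequence for the induction hypothesis.\<close>
    have "emeasure unif_seq ?E = emeasure (distr (unif \<Otimes>\<^sub>M unif_seq) unif_seq (\<lambda>(s, \<omega>). case_nat s \<omega>)) ?E"
      by (simp only: distr_case_nat_unif_seq)
    also have "\<dots> = emeasure (unif \<Otimes>\<^sub>M unif_seq)
        ((\<lambda>(s, \<omega>). case_nat s \<omega>) -` ?E \<inter> space (unif \<Otimes>\<^sub>M unif_seq))"
      using E by (intro emeasure_distr) (auto simp: space)
    also have "\<dots> = (\<integral>\<^sup>+s. emeasure unif_seq
        (Pair s -` ((\<lambda>(s, \<omega>). case_nat s \<omega>) -` ?E \<inter> space (unif \<Otimes>\<^sub>M unif_seq))) \<partial>unif)"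
    proof (rule unif.P.emeasure_pair_measure_alt)
      have "?E \<in> sets unif_seq"
        using E by (simp add: space)
      then show "(\<lambda>(s, \<omega>). case_nat s \<omega>) -` ?E \<inter> space (unif \<Otimes>\<^sub>M unif_seq) \<in> sets (unif \<Otimes>\<^sub>M unif_seq)"
        by (rule measurable_sets[rotated]) measurable
    qed
    also have "\<dots> \<le> (\<integral>\<^sup>+s. ennreal (((x + a 0 * s)\<^sup>2 + (\<Sum>i<n. (a (Suc i))\<^sup>2 / 3)) * (1 / \<epsilon>\<^sup>2)) \<partial>unif)"
    proof (rule nn_integral_mono)
      fix s
      \<comment> \<open>Since |x| < \<epsilon>, the level is not reached at \<open>k = 0\<close>;
        any other \<open>k\<close> is a successor, which makes the section exactly the event with
        starting point \<open>x + a 0 * s\<close>.\<close>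
      have "Pair s -` ((\<lambda>(s, \<omega>). case_nat s \<omega>) -` ?E \<inter> space (unif \<Otimes>\<^sub>M unif_seq)) = ?F s"
      proof (intro set_eqI iffI)
        fix \<omega> assume "\<omega> \<in> Pair s -` ((\<lambda>(s, \<omega>). case_nat s \<omega>) -` ?E \<inter> space (unif \<Otimes>\<^sub>M unif_seq))"
        then obtain k where k: "k \<le> Suc n" "\<epsilon> \<le> \<bar>x + (\<Sum>i<k. a i * case_nat s \<omega> i)\<bar>"
          by auto
        with False obtain j where "k = Suc j"
          by (cases k) auto
        with k show "\<omega> \<in> ?F s"
          using sum_case_nat[of a s \<omega> j] by (auto simp: add.assoc)
      next
        fix \<omega> assume "\<omega> \<in> ?F s"
        then obtain k where "k \<le> n" "\<epsilon> \<le> \<bar>(x + a 0 * s) + (\<Sum>i<k. a (Suc i) * \<omega> i)\<bar>"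
          by auto
        then have "\<epsilon> \<le> \<bar>x + (\<Sum>i<Suc k. a i * case_nat s \<omega> i)\<bar>" "Suc k \<le> Suc n"
          unfolding sum_case_nat by (auto simp: add.assoc)
        then have "case_nat s \<omega> \<in> ?E"
          by blast
        then show "\<omega> \<in> Pair s -` ((\<lambda>(s, \<omega>). case_nat s \<omega>) -` ?E \<inter> space (unif \<Otimes>\<^sub>M unif_seq))"
          by (simp add: space_pair_measure space)
      qed
      then show "emeasure unif_seq (Pair s -` ((\<lambda>(s, \<omega>). case_nat s \<omega>) -` ?E \<inter> space (unif \<Otimes>\<^sub>M unif_seq)))
          \<le> ennreal (((x + a 0 * s)\<^sup>2 + (\<Sum>i<n. (a (Suc i))\<^sup>2 / 3)) * (1 / \<epsilon>\<^sup>2))"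
        using Suc.IH[of "x + a 0 * s" "\<lambda>i. a (Suc i)"] by simp
    qed
    also have "\<dots> = ennreal ((x\<^sup>2 + ((a 0)\<^sup>2 / 3 + (\<Sum>i<n. (a (Suc i))\<^sup>2 / 3))) * (1 / \<epsilon>\<^sup>2))"
      by (intro nn_integral_unif_square sum_nonneg) auto
    also have "(a 0)\<^sup>2 / 3 + (\<Sum>i<n. (a (Suc i))\<^sup>2 / 3) = (\<Sum>i<Suc n. (a i)\<^sup>2 / 3)"
      by (subst sum.lessThan_Suc_shift) simp
    finally show ?thesis
      by simp
  qed
qed

text \<open>The maximal inequality for the coefficients from \<open>N\<close> on bounds the
  probability of \<open>B e N\<close> by r N / e^2, which tends to 0, so almost surely some tail
  never reaches \<open>e\<close>. Zeroing the first \<open>N\<close> coefficients instead of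
  shifting makes every block beyond \<open>N\<close> a difference of two partial sums of one series,
  whence \<open>e / 2\<close> below.\<close>

lemma AE_summable_unif_seq:
  fixes a :: "nat \<Rightarrow> real"
  assumes a: "summable (\<lambda>k. (a k)\<^sup>2)"
  shows "AE \<omega> in unif_seq. summable (\<lambda>k. a k * \<omega> k)"
proof -
  define tail where "tail N k = (if k < N then 0 else a k)" for N k
  define r where "r N = (\<Sum>k. (a (k + N))\<^sup>2)" for N
  define B where "B e N = {\<omega> \<in> space unif_seq. \<exists>k. e \<le> \<bar>\<Sum>i<k. tail N i * \<omega> i\<bar>}" for e N
  have B_sets[measurable]: "B e N \<in> sets unif_seq" for e N
    unfolding B_def by measurable
  have space: "space unif_seq = UNIV"
    by (simp add: space_PiM)
  have tail_sum: "(\<Sum>i<n. (tail N i)\<^sup>2 / 3) \<le> r N" for N n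
  proof -
    have "(\<Sum>i<n. (tail N i)\<^sup>2 / 3) \<le> (\<Sum>i<n. (tail N i)\<^sup>2)"
      by (intro sum_mono) auto
    also have "\<dots> \<le> (\<Sum>i<n+N. (tail N i)\<^sup>2)"
      by (intro sum_mono2) auto
    also have "\<dots> = (\<Sum>i\<in>{0+N..<n+N}. (tail N i)\<^sup>2)"
      by (intro sum.mono_neutral_right) (auto simp: tail_def)
    also have "\<dots> = (\<Sum>i<n. (tail N (i+N))\<^sup>2)"
      by (subst sum.shift_bounds_nat_ivl) (simp add: atLeast0LessThan)
    also have "\<dots> = (\<Sum>i<n. (a (i+N))\<^sup>2)"
      by (simp add: tail_def)
    also have "\<dots> \<le> r N"
      unfolding r_def using a by (intro sum_le_suminf) (auto simp: summable_iff_shift[of "\<lambda>i. (a i)\<^sup>2"])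
    finally show ?thesis .
  qed
  have le: "emeasure unif_seq (B e N) \<le> ennreal (r N / e\<^sup>2)" if e: "0 < e" for e N
  proof -
    let ?E = "\<lambda>n. {\<omega> \<in> space unif_seq. \<exists>k\<le>n. e \<le> \<bar>\<Sum>i<k. tail N i * \<omega> i\<bar>}"
    have "emeasure unif_seq (?E n) \<le> ennreal (r N / e\<^sup>2)" for n
    proof -
      have "emeasure unif_seq (?E n) \<le> ennreal ((0\<^sup>2 + (\<Sum>i<n. (tail N i)\<^sup>2 / 3)) / e\<^sup>2)"
        using kolmogorov_unif_seq[OF e, of n 0 "tail N"] by (simp add: space)
      also have "\<dots> \<le> ennreal (r N / e\<^sup>2)"
        using tail_sum[of N] by (intro ennreal_leI divide_right_mono) auto
      finally show ?thesis .
    qed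
    \<comment> \<open>The maximal inequality has a finite horizon; continuity from below removes
      it.\<close>
    moreover have "emeasure unif_seq (\<Union>n. ?E n) = (SUP n. emeasure unif_seq (?E n))"
      by (rule SUP_emeasure_incseq[symmetric]) (auto simp: incseq_def intro: order_trans)
    moreover have "B e N = (\<Union>n. ?E n)"
      by (auto simp: B_def)
    ultimately show ?thesis
      by (simp add: SUP_le_iff)
  qed
  have r: "r \<longlonglongrightarrow> 0"
    unfolding r_def using suminf_exist_split2[OF a] by simp
  have "AE \<omega> in unif_seq. \<exists>N. \<omega> \<notin> B e N" if e: "0 < e" for e
  proof -
    have "emeasure unif_seq (\<Inter>N. B e N) \<le> ennreal (r N / e\<^sup>2)" for N
      by (rule order_trans[OF emeasure_mono le[OF e]]) auto
    moreover have "(\<lambda>N. ennreal (r N / e\<^sup>2)) \<longlonglongrightarrow> ennreal (0 / e\<^sup>2)"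
      using e by (intro tendsto_ennrealI tendsto_divide r) auto
    ultimately have "emeasure unif_seq (\<Inter>N. B e N) \<le> ennreal (0 / e\<^sup>2)"
      by (intro LIMSEQ_le_const) auto
    then have "(\<Inter>N. B e N) \<in> null_sets unif_seq"
      by (intro null_setsI) auto
    then have "AE \<omega> in unif_seq. \<omega> \<notin> (\<Inter>N. B e N)"
      by (rule AE_not_in)
    then show ?thesis
      by eventually_elim auto
  qed
  then have "AE \<omega> in unif_seq. \<forall>j. \<exists>N. \<omega> \<notin> B (1 / real (Suc j)) N"
    by (simp add: AE_all_countable)
  then show ?thesis
  proof eventually_elim
    case (elim \<omega>)
    show ?case
      unfolding summable_Cauchy
    proof (intro allI impI)
      fix e :: real assume "0 < e"
      then obtain j where j: "1 / real (Suc j) < e / 2"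
        using nat_approx_posE[of "e / 2"] by auto
      obtain N where N: "\<omega> \<notin> B (1 / real (Suc j)) N"
        using elim by blast
      have S: "\<bar>\<Sum>i<k. tail N i * \<omega> i\<bar> < e / 2" for k
      proof -
        have "\<not> 1 / real (Suc j) \<le> \<bar>\<Sum>i<k. tail N i * \<omega> i\<bar>"
          using N unfolding B_def space by blast
        then show ?thesis
          using j by linarith
      qed
      show "\<exists>N. \<forall>m\<ge>N. \<forall>n. norm (\<Sum>k = m..<n. a k * \<omega> k) < e"
      proof (intro exI[of _ N] allI impI)
        fix m n assume m: "N \<le> m"
        show "norm (\<Sum>k = m..<n. a k * \<omega> k) < e"
        proof (cases "m \<le> n")
          case True
          have "(\<Sum>k = m..<n. a k * \<omega> k) = (\<Sum>k = m..<n. tail N k * \<omega> k)"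
            using m by (intro sum.cong) (auto simp: tail_def)
          also have "\<dots> = (\<Sum>k<n. tail N k * \<omega> k) - (\<Sum>k<m. tail N k * \<omega> k)"
            using sum_diff_nat_ivl[of 0 m n "\<lambda>k. tail N k * \<omega> k"] True
            by (simp add: atLeast0LessThan)
          finally show ?thesis
            using S[of n] S[of m] by auto
        qed (use \<open>0 < e\<close> in simp)
      qed
    qed
  qed
qed

section \<open>Characteristic functions of the Gaussian-plus-uniform laws\<close>

lemma integral_pair_mult:
  fixes f :: "'a \<Rightarrow> complex" and g :: "'b \<Rightarrow> complex"
  assumes "prob_space M1" "prob_space M2"
    and [measurable]: "f \<in> borel_measurable M1" "g \<in> borel_measurable M2"
    and bounds: "\<And>x. norm (f x) \<le> 1" "\<And>y. norm (g y) \<le> 1"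
  shows "(\<integral>p. f (fst p) * g (snd p) \<partial>(M1 \<Otimes>\<^sub>M M2)) = (\<integral>x. f x \<partial>M1) * (\<integral>y. g y \<partial>M2)"
proof -
  interpret M1: prob_space M1 by fact
  interpret M2: prob_space M2 by fact
  interpret pair_prob_space M1 M2 ..
  have "integrable (M1 \<Otimes>\<^sub>M M2) (\<lambda>p. f (fst p) * g (snd p))"
    by (rule integrable_const_bound[of _ 1]) (auto simp: norm_mult bounds intro!: AE_I2 mult_le_one)
  from integral_fst'[OF this] show ?thesis
    by simp
qed

lemma integral_iexp_partial_sum:
  "(\<integral>\<omega>. iexp (t * (\<Sum>i<n. a i * \<omega> i)) \<partial>unif_seq) = complex_of_real (\<Prod>i<n. sinc (t * a i))"
proof (induction n arbitrary: a)
  case 0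
  then show ?case
    using unif.P.prob_space by simp
next
  case (Suc n)
  let ?f = "\<lambda>s. iexp (t * a 0 * s)" and ?g = "\<lambda>\<omega>. iexp (t * (\<Sum>i<n. a (Suc i) * \<omega> i))"
  have "(\<integral>\<omega>. iexp (t * (\<Sum>i<Suc n. a i * \<omega> i)) \<partial>unif_seq)
      = (\<integral>\<omega>. iexp (t * (\<Sum>i<Suc n. a i * \<omega> i)) \<partial>distr (unif \<Otimes>\<^sub>M unif_seq) unif_seq (\<lambda>(s, \<omega>). case_nat s \<omega>))"
    by (simp only: distr_case_nat_unif_seq)
  also have "\<dots> = (\<integral>p. iexp (t * (\<Sum>i<Suc n. a i * case_nat (fst p) (snd p) i)) \<partial>(unif \<Otimes>\<^sub>M unif_seq))"
    by (subst integral_distr) (measurable, auto simp: case_prod_beta)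
  also have "\<dots> = (\<integral>p. ?f (fst p) * ?g (snd p) \<partial>(unif \<Otimes>\<^sub>M unif_seq))"
    unfolding sum_case_nat
    by (intro Bochner_Integration.integral_cong refl) (simp add: exp_add[symmetric] algebra_simps)
  also have "\<dots> = char unif (t * a 0) * (\<integral>\<omega>. ?g \<omega> \<partial>unif_seq)"
    unfolding char_def by (rule integral_pair_mult[OF prob_space_unif unif.P.prob_space_axioms]) auto
  also have "\<dots> = complex_of_real (\<Prod>i<Suc n. sinc (t * a i))"
    unfolding Suc.IH char_unif by (subst prod.lessThan_Suc_shift) simp
  finally show ?case .
qed

text \<open>The Gaussian coefficient is a free parameter, not tied to the norm of \<open>a\<close>:
  deleting a coefficient of the series must leave the Gaussian part unchanged.\<close>

definition gauss_series_law :: "real \<Rightarrow> (nat \<Rightarrow> real) \<Rightarrow> real measure" where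
  "gauss_series_law \<sigma> a = distr (std_normal_distribution \<Otimes>\<^sub>M unif_seq) borel
     (\<lambda>(z, u). \<sigma> * (z / sqrt 3) + (\<Sum>k. a k * u k))"

lemma real_distribution_gauss_series_law: "real_distribution (gauss_series_law \<sigma> a)"
proof -
  interpret N: prob_space std_normal_distribution
    using real_dist_normal_dist by (simp add: real_distribution_def)
  interpret Q: pair_prob_space std_normal_distribution unif_seq ..
  show ?thesis
    unfolding gauss_series_law_def by (rule Q.real_distribution_distr) measurable
qed

text \<open>Almost sure convergence of the partial sums and dominated convergence yield the limit of
  the finite products; the exponential is the Gaussian factor for variance \<sigma>^2 / 3.\<close>

lemma char_gauss_series_law:
  assumes a: "summable (\<lambda>k. (a k)\<^sup>2)"
  shows "(\<lambda>n. complex_of_real (exp (- (\<sigma> * t)\<^sup>2 / 6) * (\<Prod>i<n. sinc (t * a i))))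
    \<longlonglongrightarrow> char (gauss_series_law \<sigma> a) t"
proof -
  have N: "prob_space std_normal_distribution"
    using real_dist_normal_dist by (simp add: real_distribution_def)
  have "(\<lambda>n. \<integral>\<omega>. iexp (t * (\<Sum>i<n. a i * \<omega> i)) \<partial>unif_seq)
      \<longlonglongrightarrow> (\<integral>\<omega>. iexp (t * (\<Sum>k. a k * \<omega> k)) \<partial>unif_seq)"
  proof (rule integral_dominated_convergence[where w="\<lambda>_. 1"])
    show "AE \<omega> in unif_seq. (\<lambda>n. iexp (t * (\<Sum>i<n. a i * \<omega> i))) \<longlonglongrightarrow> iexp (t * (\<Sum>k. a k * \<omega> k))"
      using AE_summable_unif_seq[OF a]
      by eventually_elim (intro tendsto_intros summable_LIMSEQ)
  qed (auto simp del: of_real_mult of_real_sum)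
  then have lim: "(\<lambda>n. complex_of_real (\<Prod>i<n. sinc (t * a i)))
      \<longlonglongrightarrow> (\<integral>\<omega>. iexp (t * (\<Sum>k. a k * \<omega> k)) \<partial>unif_seq)"
    unfolding integral_iexp_partial_sum .
  have "char (gauss_series_law \<sigma> a) t
      = (\<integral>p. iexp (t * (\<sigma> * (fst p / sqrt 3) + (\<Sum>k. a k * snd p k))) \<partial>(std_normal_distribution \<Otimes>\<^sub>M unif_seq))"
    unfolding char_def gauss_series_law_def
    by (subst integral_distr) (measurable, auto simp: case_prod_beta)
  also have "\<dots> = (\<integral>p. iexp (t * \<sigma> / sqrt 3 * fst p) * iexp (t * (\<Sum>k. a k * snd p k)) \<partial>(std_normal_distribution \<Otimes>\<^sub>M unif_seq))"
    by (intro Bochner_Integration.integral_cong refl) (simp add: exp_add[symmetric] algebra_simps)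
  also have "\<dots> = char std_normal_distribution (t * \<sigma> / sqrt 3) * (\<integral>\<omega>. iexp (t * (\<Sum>k. a k * \<omega> k)) \<partial>unif_seq)"
    unfolding char_def by (rule integral_pair_mult[OF N unif.P.prob_space_axioms]) auto
  also have "char std_normal_distribution (t * \<sigma> / sqrt 3) = complex_of_real (exp (- (\<sigma> * t)\<^sup>2 / 6))"
    by (simp add: char_std_normal_distribution power_divide power_mult_distrib mult.commute)
  finally show ?thesis
    using lim by (auto intro!: tendsto_mult)
qed

lemma char_gauss_series_law_Suc:
  assumes a: "summable (\<lambda>k. (a k)\<^sup>2)"
  shows "char (gauss_series_law \<sigma> a) t = sinc (t * a 0) * char (gauss_series_law \<sigma> (\<lambda>k. a (Suc k))) t"
proof (rule LIMSEQ_unique)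
  show "(\<lambda>n. complex_of_real (exp (- (\<sigma> * t)\<^sup>2 / 6) * (\<Prod>i<Suc n. sinc (t * a i))))
      \<longlonglongrightarrow> char (gauss_series_law \<sigma> a) t"
    using LIMSEQ_Suc[OF char_gauss_series_law[OF a]] .
  have "summable (\<lambda>k. (a (Suc k))\<^sup>2)"
    using a by (simp add: summable_Suc_iff[of "\<lambda>k. (a k)\<^sup>2"])
  from tendsto_mult_left[OF char_gauss_series_law[OF this, of \<sigma> t], of "complex_of_real (sinc (t * a 0))"]
  show "(\<lambda>n. complex_of_real (exp (- (\<sigma> * t)\<^sup>2 / 6) * (\<Prod>i<Suc n. sinc (t * a i))))
      \<longlonglongrightarrow> sinc (t * a 0) * char (gauss_series_law \<sigma> (\<lambda>k. a (Suc k))) t"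
    unfolding prod.lessThan_Suc_shift o_def of_real_mult by (simp only: mult.left_commute)
qed

subsection \<open>The limit laws as a continuous image of a compact set\<close>

text \<open>Order two is enough to make the deviations from 1 summable along square-summable
  coefficients, as needed for a nonvanishing infinite product.\<close>

lemma abs_sinc_minus_one_le: "\<bar>sinc x - 1\<bar> \<le> x\<^sup>2" for x :: real
proof (cases "x = 0")
  case False
  have "\<bar>sin x - x\<bar> \<le> inverse 6 * \<bar>x\<bar> ^ 3"
    using Maclaurin_sin_bound[of x 3] by (simp add: numeral_eq_Suc sin_coeff_def)
  also have "\<dots> \<le> \<bar>x\<bar> ^ 3"
    by (simp add: mult_le_cancel_right1)
  finally have "\<bar>sin x - x\<bar> / \<bar>x\<bar> \<le> \<bar>x\<bar> ^ 3 / \<bar>x\<bar>"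
    by (rule divide_right_mono) simp
  moreover have "\<bar>sinc x - 1\<bar> = \<bar>sin x - x\<bar> / \<bar>x\<bar>"
    using False by (simp add: diff_divide_distrib flip: abs_divide)
  ultimately show ?thesis
    using False by (simp add: numeral_eq_Suc)
qed simp

text \<open>Both functions equal 1 - x^2 / 6 up to fourth order, being the characteristic functions
  of a uniform and a Gaussian variable of variance 1/3. Order four matters later: one square
  supplies smallness, the other summability.\<close>

lemma abs_sinc_minus_exp_le: "\<bar>sinc x - exp (- x\<^sup>2 / 6)\<bar> \<le> x ^ 4" for x :: real
proof -
  have "\<bar>sinc x - (1 - x\<^sup>2 / 6)\<bar> \<le> x ^ 4 / 2"
  proof (cases "x = 0")
    case False
    have "(\<Sum>m<5. sin_coeff m * x ^ m) = x - x ^ 3 / 6"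
      by (simp add: lessThan_nat_numeral sin_coeff_def fact_numeral)
    then have "\<bar>sin x - (x - x ^ 3 / 6)\<bar> \<le> inverse 120 * \<bar>x\<bar> ^ 5"
      using Maclaurin_sin_bound[of x 5] by (simp add: fact_numeral)
    also have "\<dots> \<le> \<bar>x\<bar> ^ 5 / 2"
      by simp
    finally have "\<bar>sin x - (x - x ^ 3 / 6)\<bar> / \<bar>x\<bar> \<le> (\<bar>x\<bar> ^ 5 / 2) / \<bar>x\<bar>"
      by (rule divide_right_mono) simp
    moreover have "sinc x - (1 - x\<^sup>2 / 6) = (sin x - (x - x ^ 3 / 6)) / x"
      using False by (simp add: field_simps power2_eq_square power3_eq_cube)
    moreover have "(\<bar>x\<bar> ^ 5 / 2) / \<bar>x\<bar> = x ^ 4 / 2"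
      using False power_even_abs[of 4 x] by (simp add: power_Suc[of "\<bar>x\<bar>" 4, simplified])
    ultimately show ?thesis
      by (simp only: abs_divide)
  qed simp
  moreover have "\<bar>exp (- y) - (1 - y)\<bar> \<le> y\<^sup>2" if y: "0 \<le> y" for y :: real
  proof -
    have "1 - y \<le> exp (- y)"
      using exp_ge_add_one_self[of "- y"] by simp
    moreover have "exp (- y) \<le> 1 - y + y\<^sup>2"
    proof -
      \<comment> \<open>Multiplying by 1 + y and using 1 + y <= exp y reduces the upper bound for
        exp (- y) to 1 <= 1 + y^3.\<close>
      have "(1 - y + y\<^sup>2) * (1 + y) = 1 + y ^ 3"
        by (simp add: algebra_simps power2_eq_square power3_eq_cube)
      then have "1 \<le> (1 - y + y\<^sup>2) * (1 + y)"
        using y by simp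
      also have "\<dots> \<le> (1 - y + y\<^sup>2) * exp y"
      proof (rule mult_left_mono)
        have "0 \<le> (1 - y)\<^sup>2 + y"
          using y by simp
        then show "0 \<le> 1 - y + y\<^sup>2"
          by (simp add: power2_diff)
      qed (use exp_ge_add_one_self[of y] in simp)
      finally show ?thesis
        by (simp add: exp_minus field_simps)
    qed
    ultimately show ?thesis
      by simp
  qed
  from this[of "x\<^sup>2 / 6"] have "\<bar>exp (- x\<^sup>2 / 6) - (1 - x\<^sup>2 / 6)\<bar> \<le> x ^ 4 / 36"
    by (simp add: power_divide)
  moreover have "0 \<le> x ^ 4"
    by simp
  ultimately show ?thesis
    by linarith
qed

lemma abs_sinc_le_1: "\<bar>sinc x\<bar> \<le> 1" for x :: real
  using abs_sin_x_le_abs_x[of x] by (auto simp: abs_divide divide_le_eq_1)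

text \<open>Including the sequences of norm one, whose limit law has no Gaussian part, makes the parameter
  space compact for coordinatewise convergence.\<close>

definition ordered_ball :: "(nat \<Rightarrow> real) set" where
  "ordered_ball = {\<alpha>. decseq \<alpha> \<and> (\<forall>k. 0 \<le> \<alpha> k) \<and> (\<forall>m. (\<Sum>k<m. (\<alpha> k)\<^sup>2) \<le> 1)}"

lemma ordered_ballD:
  assumes "\<alpha> \<in> ordered_ball"
  shows "decseq \<alpha>" "0 \<le> \<alpha> k" "(\<Sum>k<m. (\<alpha> k)\<^sup>2) \<le> 1" "summable (\<lambda>k. (\<alpha> k)\<^sup>2)" "(\<Sum>k. (\<alpha> k)\<^sup>2) \<le> 1"
proof -
  show "decseq \<alpha>" "0 \<le> \<alpha> k" and le: "\<And>m. (\<Sum>k<m. (\<alpha> k)\<^sup>2) \<le> 1"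
    using assms by (auto simp: ordered_ball_def)
  show "summable (\<lambda>k. (\<alpha> k)\<^sup>2)"
    by (rule summableI_nonneg_bounded[OF _ le]) simp
  then show "(\<Sum>k. (\<alpha> k)\<^sup>2) \<le> 1"
    by (rule suminf_le_const[OF _ le])
qed

lemma admissible_iff: "\<alpha> \<in> admissible \<longleftrightarrow> \<alpha> \<in> ordered_ball \<and> (\<Sum>k. (\<alpha> k)\<^sup>2) < 1"
proof
  assume \<alpha>: "\<alpha> \<in> admissible"
  then have "(\<Sum>k<m. (\<alpha> k)\<^sup>2) \<le> (\<Sum>k. (\<alpha> k)\<^sup>2)" for m
    by (intro sum_le_suminf) (auto simp: admissible_def)
  moreover have "(\<Sum>k. (\<alpha> k)\<^sup>2) < 1"
    using \<alpha> by (simp add: admissible_def)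
  ultimately have "(\<Sum>k<m. (\<alpha> k)\<^sup>2) \<le> 1" for m
    by (meson less_imp_le order_trans)
  then show "\<alpha> \<in> ordered_ball \<and> (\<Sum>k. (\<alpha> k)\<^sup>2) < 1"
    using \<alpha> by (auto simp: admissible_def ordered_ball_def)
qed (use ordered_ballD in \<open>auto simp: admissible_def\<close>)

text \<open>The first m + 1 squares are each at least (\<alpha> m)^2 and add up to at most 1; the
  decay is therefore uniform over the parameter space.\<close>

lemma ordered_ball_square_le:
  assumes "\<alpha> \<in> ordered_ball"
  shows "(\<alpha> m)\<^sup>2 \<le> 1 / real (Suc m)"
proof -
  have "real (Suc m) * (\<alpha> m)\<^sup>2 = (\<Sum>k<Suc m. (\<alpha> m)\<^sup>2)"
    by simp
  also have "\<dots> \<le> (\<Sum>k<Suc m. (\<alpha> k)\<^sup>2)"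
    using ordered_ballD[OF assms] by (intro sum_mono power_mono) (auto simp: decseq_def)
  also have "\<dots> \<le> 1"
    by (rule ordered_ballD[OF assms])
  finally show ?thesis
    by (simp add: field_simps)
qed

text \<open>The norm constraint is stated through partial sums, each depending continuously on
  finitely many coordinates; the norm itself is not continuous for coordinatewise
  convergence.\<close>

lemma closed_ordered_ball: "closed ordered_ball"
proof -
  have "ordered_ball = (\<Inter>n. {\<alpha>. \<alpha> (Suc n) \<le> \<alpha> n}) \<inter> (\<Inter>k. {\<alpha>. 0 \<le> \<alpha> k})
      \<inter> (\<Inter>m. {\<alpha>. (\<Sum>k<m. (\<alpha> k)\<^sup>2) \<le> 1})"
    by (auto simp: ordered_ball_def decseq_Suc_iff)
  also have "closed \<dots>"
    by (intro closed_Int closed_INT ballI closed_Collect_le continuous_intros continuous_on_product_coordinates)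
  finally show ?thesis .
qed

lemma compact_ordered_ball: "compact ordered_ball"
proof -
  have "compactin (product_topology (\<lambda>_::nat. euclidean) UNIV) (PiE UNIV (\<lambda>_. {0..1::real}))"
    unfolding compactin_PiE by simp
  then have "compact (PiE UNIV (\<lambda>_::nat. {0..1::real}))"
    by (simp add: euclidean_product_topology)
  moreover have "ordered_ball \<subseteq> PiE UNIV (\<lambda>_. {0..1})"
  proof (intro subsetI PiE_I)
    fix \<alpha> :: "nat \<Rightarrow> real" and k assume \<alpha>: "\<alpha> \<in> ordered_ball"
    have "(\<alpha> k)\<^sup>2 \<le> 1 / real (Suc k)"
      using \<alpha> by (rule ordered_ball_square_le)
    also have "\<dots> \<le> 1"
      by simp
    finally show "\<alpha> k \<in> {0..1}"
      using ordered_ballD(2)[OF \<alpha>] by (simp add: power_le_one_iff abs_square_le_1)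
  qed simp
  ultimately show ?thesis
    using closed_ordered_ball by (metis compact_Int_closed inf.absorb2)
qed

lemma limit_law_eq: "limit_law \<alpha> = gauss_series_law (sqrt (1 - (\<Sum>k. (\<alpha> k)\<^sup>2))) \<alpha>"
  by (simp add: limit_law_def gauss_series_law_def)

text \<open>The characteristic function obtained by keeping the first \<open>m\<close> uniform
  variables and giving all remaining variance to the Gaussian variable. It involves only
  \<open>m\<close> coordinates of \<alpha>, hence is continuous for coordinatewise
  convergence.\<close>

definition char_trunc :: "nat \<Rightarrow> (nat \<Rightarrow> real) \<Rightarrow> real \<Rightarrow> real" where
  "char_trunc m \<alpha> t = exp (- (1 - (\<Sum>k<m. (\<alpha> k)\<^sup>2)) * t\<^sup>2 / 6) * (\<Prod>k<m. sinc (t * \<alpha> k))"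

text \<open>By monotonicity \<open>(\<alpha> k)\<^sup>2 \<le> 1 / (m + 1)\<close> for \<open>k \<ge> m\<close>, so replacing the uniform variables from index
  \<open>m\<close> on by Gaussian ones of the same variance costs little, uniformly in \<open>\<alpha>\<close>.\<close>

lemma char_limit_law_approx:
  assumes \<alpha>: "\<alpha> \<in> ordered_ball"
  shows "norm (char (limit_law \<alpha>) t - complex_of_real (char_trunc m \<alpha> t)) \<le> t ^ 4 / real (Suc m)"
proof -
  note K = ordered_ballD[OF \<alpha>]
  define s where "s = 1 - (\<Sum>k. (\<alpha> k)\<^sup>2)"
  have s: "0 \<le> s"
    using K by (simp add: s_def)
  \<comment> \<open>Intermediate factors: uniform below \<open>m\<close>, Gaussian of the same
    variance from \<open>m\<close> on.\<close>
  define w where "w i = (if i < m then sinc (t * \<alpha> i) else exp (- (t * \<alpha> i)\<^sup>2 / 6))" for i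
  define E where "E = exp (- s * t\<^sup>2 / 6)"
  have E: "0 \<le> E" "E \<le> 1"
    using s by (auto simp: E_def)
  have lim: "(\<lambda>n. complex_of_real (E * (\<Prod>i<n. sinc (t * \<alpha> i)))) \<longlonglongrightarrow> char (limit_law \<alpha>) t"
    using char_gauss_series_law[OF K(4), of "sqrt s" t] s
    unfolding limit_law_eq s_def[symmetric] E_def by (simp add: power_mult_distrib)
  have w: "\<bar>w i\<bar> \<le> 1" for i
  proof (cases "i < m")
    case True
    then show ?thesis
      using abs_sinc_le_1[of "t * \<alpha> i"] by (simp only: w_def if_True)
  qed (simp add: w_def)
  have diff: "\<bar>E * (\<Prod>i<n. sinc (t * \<alpha> i)) - E * (\<Prod>i<n. w i)\<bar> \<le> t ^ 4 / real (Suc m)" for n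
  proof -
    \<comment> \<open>All factors have modulus at most 1, so the difference of the products
      telescopes into a sum of factorwise differences.\<close>
    have "\<bar>(\<Prod>i<n. sinc (t * \<alpha> i)) - (\<Prod>i<n. w i)\<bar> \<le> (\<Sum>i<n. \<bar>sinc (t * \<alpha> i) - w i\<bar>)"
      using norm_prod_diff[of "{..<n}" "\<lambda>i. sinc (t * \<alpha> i)" w] w abs_sinc_le_1
      by (simp only: real_norm_def)
    also have "\<dots> \<le> (\<Sum>i<n. t ^ 4 / real (Suc m) * (\<alpha> i)\<^sup>2)"
    proof (rule sum_mono)
      fix i
      show "\<bar>sinc (t * \<alpha> i) - w i\<bar> \<le> t ^ 4 / real (Suc m) * (\<alpha> i)\<^sup>2"
      proof (cases "i < m")
        case False
        have "\<bar>sinc (t * \<alpha> i) - w i\<bar> \<le> (t * \<alpha> i) ^ 4"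
          using abs_sinc_minus_exp_le[of "t * \<alpha> i"] False by (simp only: w_def if_False)
        also have "\<dots> = t ^ 4 * ((\<alpha> i)\<^sup>2 * (\<alpha> i)\<^sup>2)"
          by (simp add: power_mult_distrib flip: power_add)
        \<comment> \<open>One of the two squares is bounded by 1 / (m + 1); the other is kept and
          will be summed to at most 1.\<close>
        also have "\<dots> \<le> t ^ 4 * (1 / real (Suc m) * (\<alpha> i)\<^sup>2)"
        proof (intro mult_left_mono mult_right_mono)
          show "(\<alpha> i)\<^sup>2 \<le> 1 / real (Suc m)"
            using ordered_ball_square_le[OF \<alpha>, of i] False
            by (elim order_trans) (simp add: frac_le)
        qed auto
        finally show ?thesis
          by (simp only: mult.assoc times_divide_eq_left times_divide_eq_right mult_1)
      qed (simp add: w_def)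
    qed
    also have "\<dots> \<le> t ^ 4 / real (Suc m) * 1"
      unfolding sum_distrib_left[symmetric] by (intro mult_left_mono K) simp
    finally have "E * \<bar>(\<Prod>i<n. sinc (t * \<alpha> i)) - (\<Prod>i<n. w i)\<bar> \<le> 1 * (t ^ 4 / real (Suc m) * 1)"
      using E by (intro mult_mono) auto
    then show ?thesis
      using E by (simp add: abs_mult flip: right_diff_distrib)
  qed
  \<comment> \<open>The Gaussian factors from \<open>m\<close> on merge with \<open>E\<close>: their
    exponents complete \<open>s\<close> to 1 minus the squared mass of the first \<open>m\<close>
    coordinates.\<close>
  have "(\<lambda>n. E * (\<Prod>i<n + m. w i)) \<longlonglongrightarrow> char_trunc m \<alpha> t"
  proof -
    have eq: "E * (\<Prod>i<n + m. w i)
        = exp (- (s + (\<Sum>i<n. (\<alpha> (i + m))\<^sup>2)) * t\<^sup>2 / 6) * (\<Prod>k<m. sinc (t * \<alpha> k))" for n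
    proof (induction n)
      case 0
      show ?case
        by (simp add: E_def w_def)
    next
      case (Suc n)
      have "E * (\<Prod>i<Suc n + m. w i) = E * (\<Prod>i<n + m. w i) * exp (- (t * \<alpha> (n + m))\<^sup>2 / 6)"
        by (simp add: w_def)
      also have "\<dots> = exp (- (s + (\<Sum>i<Suc n. (\<alpha> (i + m))\<^sup>2)) * t\<^sup>2 / 6) * (\<Prod>k<m. sinc (t * \<alpha> k))"
      proof -
        have "exp (- (s + (\<Sum>i<Suc n. (\<alpha> (i + m))\<^sup>2)) * t\<^sup>2 / 6)
            = exp (- (s + (\<Sum>i<n. (\<alpha> (i + m))\<^sup>2)) * t\<^sup>2 / 6) * exp (- (t * \<alpha> (n + m))\<^sup>2 / 6)"
          by (subst exp_add[symmetric], rule arg_cong[where f=exp])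
             (simp add: field_simps power_mult_distrib)
        then show ?thesis
          unfolding Suc.IH by (simp only: mult.commute mult.left_commute)
      qed
      finally show ?case .
    qed
    have "(\<lambda>n. s + (\<Sum>i<n. (\<alpha> (i + m))\<^sup>2)) \<longlonglongrightarrow> s + (\<Sum>i. (\<alpha> (i + m))\<^sup>2)"
      using K(4) by (intro tendsto_intros summable_LIMSEQ) (simp add: summable_iff_shift[of "\<lambda>i. (\<alpha> i)\<^sup>2"])
    also have "s + (\<Sum>i. (\<alpha> (i + m))\<^sup>2) = 1 - (\<Sum>k<m. (\<alpha> k)\<^sup>2)"
      using suminf_split_initial_segment[OF K(4), of m] by (simp add: s_def)
    finally show ?thesis
      unfolding eq char_trunc_def by (intro tendsto_intros) auto
  qed
  then have "(\<lambda>n. complex_of_real (E * (\<Prod>i<n + m. w i))) \<longlonglongrightarrow> complex_of_real (char_trunc m \<alpha> t)"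
    by (rule tendsto_of_real)
  with LIMSEQ_ignore_initial_segment[OF lim, of m]
  have "(\<lambda>n. norm (complex_of_real (E * (\<Prod>i<n + m. sinc (t * \<alpha> i))) - complex_of_real (E * (\<Prod>i<n + m. w i))))
      \<longlonglongrightarrow> norm (char (limit_law \<alpha>) t - complex_of_real (char_trunc m \<alpha> t))"
    by (intro tendsto_norm tendsto_diff)
  then show ?thesis
  proof (rule LIMSEQ_le_const2)
    show "\<exists>N. \<forall>n\<ge>N. norm (complex_of_real (E * (\<Prod>i<n + m. sinc (t * \<alpha> i))) - complex_of_real (E * (\<Prod>i<n + m. w i)))
        \<le> t ^ 4 / real (Suc m)"
      using diff unfolding of_real_diff[symmetric] norm_of_real by blast
  qed
qed

text \<open>A uniform limit of the continuous truncations. The coefficient of Z alone is not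
  continuous in \<alpha>; only its combination with the tail of the series is.\<close>

lemma continuous_on_char_limit_law: "continuous_on ordered_ball (\<lambda>\<alpha>. char (limit_law \<alpha>) t)"
proof (rule uniform_limit_theorem)
  show "\<forall>\<^sub>F m in sequentially. continuous_on ordered_ball (\<lambda>\<alpha>. complex_of_real (char_trunc m \<alpha> t))"
  proof (intro always_eventually allI)
    fix m
    have c: "continuous_on ordered_ball (\<lambda>\<alpha>. \<alpha> k)" for k
      by (rule continuous_on_subset[OF continuous_on_product_coordinates]) simp
    show "continuous_on ordered_ball (\<lambda>\<alpha>. complex_of_real (char_trunc m \<alpha> t))"
      unfolding char_trunc_def
      by (intro continuous_on_of_real continuous_on_mult continuous_on_exp continuous_on_prod
          continuous_on_sinc continuous_intros c) auto
  qed
  show "uniform_limit ordered_ball (\<lambda>m \<alpha>. complex_of_real (char_trunc m \<alpha> t)) (\<lambda>\<alpha>. char (limit_law \<alpha>) t) sequentially"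
  proof (rule uniform_limitI)
    fix e :: real assume "0 < e"
    have "(\<lambda>m. t ^ 4 / real (Suc m)) \<longlonglongrightarrow> 0"
      by (intro LIMSEQ_Suc lim_const_over_n)
    then have "\<forall>\<^sub>F m in sequentially. t ^ 4 / real (Suc m) < e"
      using \<open>0 < e\<close> by (rule order_tendstoD)
    then show "\<forall>\<^sub>F m in sequentially. \<forall>\<alpha>\<in>ordered_ball. dist (complex_of_real (char_trunc m \<alpha> t)) (char (limit_law \<alpha>) t) < e"
    proof eventually_elim
      case (elim m)
      then show ?case
        using char_limit_law_approx[of _ t m] by (fastforce simp: dist_norm norm_minus_commute)
    qed
  qed
qed simp

section \<open>Continuity into the weak topology by characteristic functions, and separation\<close>

lemma continuous_map_weak_topology:
  fixes f :: "'a::{first_countable_topology, t2_space} \<Rightarrow> real measure"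
  assumes rd: "\<And>x. x \<in> T \<Longrightarrow> real_distribution (f x)"
    and char: "\<And>t. continuous_on T (\<lambda>x. char (f x) t)"
  shows "continuous_map (top_of_set T) weak_topology f"
proof -
  \<comment> \<open>Levy's continuity theorem speaks about sequences, so the integral of each test
    function is treated sequentially; here first countability of the domain enters. Afterwards only
    the generating open sets have to be checked.\<close>
  have cont: "continuous_on T (\<lambda>x. \<integral>y. g y \<partial>f x)"
    if g: "continuous_on UNIV g" "bounded (range g)" for g :: "real \<Rightarrow> real"
  proof (rule continuous_on_sequentiallyI)
    fix u a assume u: "\<forall>n. u n \<in> T" "a \<in> T" "u \<longlonglongrightarrow> a"
    obtain B where B: "\<And>x. norm (g x) \<le> B"
      using g(2) by (auto simp: bounded_iff)
    have "weak_conv_m (\<lambda>n. f (u n)) (f a)"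
      using u rd char by (intro levy_continuity) (auto simp: continuous_on_sequentially o_def)
    then show "(\<lambda>n. \<integral>y. g y \<partial>f (u n)) \<longlonglongrightarrow> (\<integral>y. g y \<partial>f a)"
      using g B rd u by (intro weak_conv_imp_integral_bdd_continuous_conv[where B=B])
        (auto simp: continuous_on_eq_continuous_at)
  qed
  show ?thesis
    unfolding weak_topology_def continuous_on_generated_topo_iff
  proof (intro conjI allI impI)
    fix U assume "U \<in> {{\<mu>. real_distribution \<mu> \<and> integral\<^sup>L \<mu> g \<in> U} | (g :: real \<Rightarrow> real) (U :: real set).
        continuous_on UNIV g \<and> bounded (range g) \<and> open U}"
    then obtain g :: "real \<Rightarrow> real" and V :: "real set" where U: "U = {\<mu>. real_distribution \<mu> \<and> integral\<^sup>L \<mu> g \<in> V}"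
      and g: "continuous_on UNIV g" "bounded (range g)" and V: "open V"
      by blast
    have "openin (top_of_set T) (T \<inter> (\<lambda>x. \<integral>y. g y \<partial>f x) -` V)"
      by (rule continuous_openin_preimage_gen[OF cont[OF g] V])
    also have "T \<inter> (\<lambda>x. \<integral>y. g y \<partial>f x) -` V = f -` U \<inter> topspace (top_of_set T)"
      using rd by (auto simp: U)
    finally show "openin (top_of_set T) (f -` U \<inter> topspace (top_of_set T))" .
  next
    show "f ` topspace (top_of_set T) \<subseteq> \<Union> {{\<mu>. real_distribution \<mu> \<and> integral\<^sup>L \<mu> g \<in> U} | (g :: real \<Rightarrow> real) (U :: real set).
        continuous_on UNIV g \<and> bounded (range g) \<and> open U}"
      using topspace_weak_topology rd
      unfolding weak_topology_def topology_generated_by_topspace by auto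
  qed
qed

lemma continuous_map_limit_law: "continuous_map (top_of_set ordered_ball) weak_topology limit_law"
  by (intro continuous_map_weak_topology real_distribution_limit_law continuous_on_char_limit_law)

text \<open>Distinct laws differ in the integral of some cos (t x) or sin (t x), which are bounded
  continuous test functions, and disjoint open sets of values pull back to separating
  neighbourhoods. The property will make compact sublevel sets closed.\<close>

lemma Hausdorff_weak_topology: "Hausdorff_space weak_topology"
  unfolding Hausdorff_space_def
proof (intro allI impI)
  fix \<mu> \<nu> assume "\<mu> \<in> topspace weak_topology \<and> \<nu> \<in> topspace weak_topology \<and> \<mu> \<noteq> \<nu>"
  then have rd: "real_distribution \<mu>" "real_distribution \<nu>" and "\<mu> \<noteq> \<nu>"
    by (auto simp: topspace_weak_topology)
  then obtain t where "char \<mu> t \<noteq> char \<nu> t"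
    using Levy_uniqueness by blast
  moreover have "char \<mu> t = complex_of_real (\<integral>x. cos (t * x) \<partial>\<mu>) + \<i> * complex_of_real (\<integral>x. sin (t * x) \<partial>\<mu>)"
    if "real_distribution \<mu>" for \<mu>
  proof -
    interpret real_distribution \<mu> by fact
    have int: "integrable \<mu> (\<lambda>x. iexp (t * x))"
      by (rule integrable_iexp) auto
    show ?thesis
      using integral_Re[OF int] integral_Im[OF int]
      by (simp add: complex_eq_iff char_def Re_exp Im_exp)
  qed
  ultimately have "(\<integral>x. cos (t * x) \<partial>\<mu>) \<noteq> (\<integral>x. cos (t * x) \<partial>\<nu>) \<or> (\<integral>x. sin (t * x) \<partial>\<mu>) \<noteq> (\<integral>x. sin (t * x) \<partial>\<nu>)"
    using rd by auto
  then obtain g :: "real \<Rightarrow> real" where g: "continuous_on UNIV g" "bounded (range g)" "integral\<^sup>L \<mu> g \<noteq> integral\<^sup>L \<nu> g"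
  proof (elim disjE)
    assume *: "(\<integral>x. cos (t * x) \<partial>\<mu>) \<noteq> (\<integral>x. cos (t * x) \<partial>\<nu>)"
    show thesis
      by (rule that[OF _ _ *]) (auto intro!: continuous_intros simp: bounded_iff intro: exI[of _ 1])
  next
    assume *: "(\<integral>x. sin (t * x) \<partial>\<mu>) \<noteq> (\<integral>x. sin (t * x) \<partial>\<nu>)"
    show thesis
      by (rule that[OF _ _ *]) (auto intro!: continuous_intros simp: bounded_iff intro: exI[of _ 1])
  qed
  obtain U V :: "real set" where UV: "open U" "open V" "integral\<^sup>L \<mu> g \<in> U" "integral\<^sup>L \<nu> g \<in> V" "U \<inter> V = {}"
    using separation_t2[of "integral\<^sup>L \<mu> g" "integral\<^sup>L \<nu> g"] g(3) by blast
  have op: "openin weak_topology {\<mu>. real_distribution \<mu> \<and> integral\<^sup>L \<mu> g \<in> W}" if "open W" for W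
    unfolding weak_topology_def using that g by (intro topology_generated_by_Basis) blast
  show "\<exists>U V. openin weak_topology U \<and> openin weak_topology V \<and> \<mu> \<in> U \<and> \<nu> \<in> V \<and> disjnt U V"
    by (rule exI[of _ "{\<mu>. real_distribution \<mu> \<and> integral\<^sup>L \<mu> g \<in> U}"],
        rule exI[of _ "{\<mu>. real_distribution \<mu> \<and> integral\<^sup>L \<mu> g \<in> V}"])
       (use UV rd op in \<open>auto simp: disjnt_def\<close>)
qed

subsection \<open>Injectivity of the parametrisation\<close>

lemma sinc_neq_0: "\<bar>x\<bar> < pi \<Longrightarrow> sinc x \<noteq> 0" for x :: real
  using sin_gt_zero[of x] sin_gt_zero[of "- x"] by (cases "0 < x") auto

text \<open>Nonzero factors alone do not keep an infinite product from vanishing; the bound |sinc (t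
  b_k) - 1| <= t^2 b_k^2 makes it converge absolutely, and then its value is nonzero.\<close>

lemma char_gauss_series_law_neq_0:
  assumes b: "summable (\<lambda>k. (b k)\<^sup>2)" and less: "\<And>k. \<bar>t * b k\<bar> < pi"
  shows "char (gauss_series_law \<tau> b) t \<noteq> 0"
proof -
  have "summable (\<lambda>k. norm (sinc (t * b k) - 1))"
  proof (rule summable_comparison_test')
    show "summable (\<lambda>k. t\<^sup>2 * (b k)\<^sup>2)"
      using b by (rule summable_mult)
    show "norm (norm (sinc (t * b k) - 1)) \<le> t\<^sup>2 * (b k)\<^sup>2" for k
      using abs_sinc_minus_one_le[of "t * b k"]
      by (simp only: real_norm_def abs_idempotent power_mult_distrib)
  qed
  then have conv: "convergent_prod (\<lambda>k. sinc (t * b k))"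
    by (intro abs_convergent_prod_imp_convergent_prod summable_imp_abs_convergent_prod)
  have nz: "prodinf (\<lambda>k. sinc (t * b k)) \<noteq> 0"
    using sinc_neq_0[OF less] by (intro prodinf_nonzero conv) blast
  have "(\<lambda>n. \<Prod>k\<le>n. sinc (t * b k)) \<longlonglongrightarrow> prodinf (\<lambda>k. sinc (t * b k))"
    using conv by (rule convergent_prod_LIMSEQ)
  then have "(\<lambda>n. complex_of_real (exp (- (\<tau> * t)\<^sup>2 / 6) * (\<Prod>k<Suc n. sinc (t * b k))))
      \<longlonglongrightarrow> complex_of_real (exp (- (\<tau> * t)\<^sup>2 / 6) * prodinf (\<lambda>k. sinc (t * b k)))"
    unfolding lessThan_Suc_atMost by (intro tendsto_of_real tendsto_mult_left)
  moreover have "(\<lambda>n. complex_of_real (exp (- (\<tau> * t)\<^sup>2 / 6) * (\<Prod>k<Suc n. sinc (t * b k))))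
      \<longlonglongrightarrow> char (gauss_series_law \<tau> b) t"
    using LIMSEQ_Suc[OF char_gauss_series_law[OF b]] .
  ultimately have "char (gauss_series_law \<tau> b) t
      = complex_of_real (exp (- (\<tau> * t)\<^sup>2 / 6) * prodinf (\<lambda>k. sinc (t * b k)))"
    by (rule LIMSEQ_unique[symmetric])
  then show ?thesis
    using nz by simp
qed

text \<open>The first positive zero of the characteristic function is \<open>\<pi> / a 0\<close>.\<close>

lemma gauss_series_law_first_le:
  assumes a: "summable (\<lambda>k. (a k)\<^sup>2)"
    and b: "summable (\<lambda>k. (b k)\<^sup>2)" "decseq b" "\<And>k. 0 \<le> b k"
    and eq: "\<And>t. char (gauss_series_law \<sigma> a) t = char (gauss_series_law \<tau> b) t"
  shows "a 0 \<le> b 0"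
proof (rule ccontr)
  assume "\<not> a 0 \<le> b 0"
  then have less: "b 0 < a 0" and pos: "0 < a 0"
    using b(3)[of 0] by auto
  \<comment> \<open>Every coefficient of \<open>b\<close> is below \<open>a 0\<close>, so none of
    its factors has reached its first zero at this point, whereas the leading factor of
    \<open>a\<close> has.\<close>
  have "\<bar>pi / a 0 * b k\<bar> < pi" for k
  proof -
    have "b k < a 0"
      using decseqD[OF b(2), of 0 k] less by simp
    then show ?thesis
      using pos b(3)[of k] by (simp add: divide_simps)
  qed
  then have "char (gauss_series_law \<tau> b) (pi / a 0) \<noteq> 0"
    by (rule char_gauss_series_law_neq_0[OF b(1)])
  moreover have "char (gauss_series_law \<sigma> a) (pi / a 0) = 0"
    using pos by (simp add: char_gauss_series_law_Suc[OF a])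
  ultimately show False
    using eq by simp
qed

text \<open>Division by \<open>sinc (t * a 0)\<close> is possible only off its zeros. These are
  countable (and absent if \<open>a 0 = 0\<close>, as sinc 0 = 1), while continuous functions that
  differ somewhere differ on a nonempty open set, which has points off the zeros.\<close>

lemma char_gauss_series_law_cancel:
  assumes a: "summable (\<lambda>k. (a k)\<^sup>2)" and b: "summable (\<lambda>k. (b k)\<^sup>2)" and "a 0 = b 0"
    and eq: "\<And>t. char (gauss_series_law \<sigma> a) t = char (gauss_series_law \<tau> b) t"
  shows "char (gauss_series_law \<sigma> (\<lambda>k. a (Suc k))) t = char (gauss_series_law \<tau> (\<lambda>k. b (Suc k))) t"
proof (rule ccontr)
  let ?f = "char (gauss_series_law \<sigma> (\<lambda>k. a (Suc k)))" and ?g = "char (gauss_series_law \<tau> (\<lambda>k. b (Suc k)))"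
  let ?Z = "{t. sinc (t * a 0) = 0}"
  assume "?f t \<noteq> ?g t"
  moreover have "open {t. ?f t \<noteq> ?g t}"
    by (intro open_Collect_neq continuous_at_imp_continuous_on ballI
        real_distribution.isCont_char real_distribution_gauss_series_law)
  moreover have "countable ?Z"
  proof (rule countable_subset)
    show "?Z \<subseteq> range (\<lambda>i. of_int i * pi / a 0)"
    proof
      fix t assume "t \<in> ?Z"
      then have "t * a 0 \<noteq> 0" "sin (t * a 0) = 0"
        by (auto split: if_splits)
      then obtain i where "t * a 0 = of_int i * pi" "a 0 \<noteq> 0"
        by (auto simp: sin_zero_iff_int2)
      then show "t \<in> range (\<lambda>i. of_int i * pi / a 0)"
        by (auto intro!: image_eqI[of _ _ i] simp: eq_divide_eq)
    qed
  qed simp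
  ultimately obtain s where "?f s \<noteq> ?g s" "s \<notin> ?Z"
    using open_minus_countable[of ?Z "{t. ?f t \<noteq> ?g t}"] by blast
  then show False
    using eq[of s]
    unfolding char_gauss_series_law_Suc[OF a] char_gauss_series_law_Suc[OF b] \<open>a 0 = b 0\<close>[symmetric]
    by (simp only: mult_cancel_left of_real_eq_0_iff mem_Collect_eq simp_thms)
qed

text \<open>Comparing first zeros identifies the leading coefficients, and cancelling their common
  factor shifts both sequences by one while \<sigma> and \<tau> stay the same.\<close>

lemma gauss_series_law_unique:
  assumes "summable (\<lambda>k. (a k)\<^sup>2)" "decseq a" "\<And>k. 0 \<le> a k"
    and "summable (\<lambda>k. (b k)\<^sup>2)" "decseq b" "\<And>k. 0 \<le> b k"
    and "\<And>t. char (gauss_series_law \<sigma> a) t = char (gauss_series_law \<tau> b) t"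
  shows "a k = b k"
  using assms
proof (induction k arbitrary: a b)
  case 0
  then show ?case
    by (intro antisym gauss_series_law_first_le[of a b \<sigma> \<tau>] gauss_series_law_first_le[of b a \<tau> \<sigma>]) auto
next
  case (Suc k)
  have "a 0 = b 0"
    using Suc.prems
    by (intro antisym gauss_series_law_first_le[of a b \<sigma> \<tau>] gauss_series_law_first_le[of b a \<tau> \<sigma>]) auto
  then have "char (gauss_series_law \<sigma> (\<lambda>k. a (Suc k))) t = char (gauss_series_law \<tau> (\<lambda>k. b (Suc k))) t" for t
    using Suc.prems by (intro char_gauss_series_law_cancel) auto
  then show ?case
    using Suc.prems summable_Suc_iff[of "\<lambda>k. (a k)\<^sup>2"] summable_Suc_iff[of "\<lambda>k. (b k)\<^sup>2"]
    by (intro Suc.IH[of "\<lambda>k. a (Suc k)" "\<lambda>k. b (Suc k)"]) (auto simp: decseq_Suc_iff)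
qed

lemma inj_on_limit_law: "inj_on limit_law admissible"
proof (rule inj_onI)
  fix \<alpha> \<beta> assume "\<alpha> \<in> admissible" "\<beta> \<in> admissible" and "limit_law \<alpha> = limit_law \<beta>"
  then have "\<alpha> k = \<beta> k" for k
    by (intro gauss_series_law_unique[where \<sigma>="sqrt (1 - (\<Sum>k. (\<alpha> k)\<^sup>2))" and \<tau>="sqrt (1 - (\<Sum>k. (\<beta> k)\<^sup>2))"])
       (auto simp: admissible_def limit_law_eq)
  then show "\<alpha> = \<beta>"
    by auto
qed

subsection \<open>Projections of the cube as limit laws\<close>

lemma char_cube_projection:
  "char (cube_projection n \<theta>) t = complex_of_real (\<Prod>i<n. sinc (t * \<theta> i))"
proof -
  interpret product_sigma_finite "\<lambda>_. lborel :: real measure" ..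
  let ?box = "{..<n} \<rightarrow>\<^sub>E {-1..1::real}"
  have box[measurable]: "?box \<in> sets (euclidean_lborel n)"
    by (intro sets_PiM_I_finite) auto
  let ?f = "\<lambda>i x. (indicator {-1..1} x / 2) *\<^sub>R iexp (t * \<theta> i * x)"
  have cube: "cube_uniform n = density (euclidean_lborel n) (\<lambda>u. ennreal (indicator ?box u / 2 ^ n))"
    unfolding cube_uniform_def uniform_measure_def
  proof (intro density_cong AE_I2)
    fix u
    show "indicator ?box u / emeasure (euclidean_lborel n) ?box = ennreal (indicator ?box u / 2 ^ n)"
      using emeasure_box[of 1 n] by (subst divide_ennreal[symmetric]) (auto simp: indicator_def)
  qed measurable
  have int: "(\<integral>x. ?f i x \<partial>lborel) = complex_of_real (sinc (t * \<theta> i))" for i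
    unfolding char_unif[symmetric] char_def unif_eq_density by (subst integral_density) auto
  have integrable: "integrable lborel (?f i)" for i
  proof (rule Bochner_Integration.integrable_bound)
    show "integrable lborel (\<lambda>x. indicator {-1..1::real} x / 2 :: real)"
      by (intro integrable_divide integrable_real_indicator) auto
  qed auto
  have "char (cube_projection n \<theta>) t = (\<integral>u. iexp (t * (\<Sum>i<n. u i * \<theta> i)) \<partial>cube_uniform n)"
    unfolding char_def cube_projection_def
    by (subst integral_distr) (auto simp: cube_uniform_def)
  also have "\<dots> = (\<integral>u. (indicator ?box u / 2 ^ n) *\<^sub>R iexp (t * (\<Sum>i<n. u i * \<theta> i)) \<partial>euclidean_lborel n)"
    unfolding cube by (subst integral_density) auto
  also have "\<dots> = (\<integral>u. (\<Prod>i<n. ?f i (u i)) \<partial>euclidean_lborel n)"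
  proof (intro Bochner_Integration.integral_cong refl)
    fix u :: "nat \<Rightarrow> real" assume u: "u \<in> space (euclidean_lborel n)"
    have "indicator ?box u / (2::real) ^ n = (\<Prod>i<n. indicator {-1..1} (u i) / 2)"
    proof (cases "u \<in> ?box")
      case True
      then have "(\<Prod>i<n. indicator {-1..1} (u i) / 2) = (\<Prod>i<n. 1 / 2 :: real)"
        by (intro prod.cong) (auto simp: PiE_iff)
      then show ?thesis
        using True by (simp add: power_one_over)
    next
      case False
      then obtain i where "i < n" "u i \<notin> {-1..1}"
        using u by (auto simp: space_PiM PiE_iff)
      then have "(\<Prod>i<n. indicator {-1..1} (u i) / (2::real)) = 0"
        by (intro prod_zero bexI[of _ i]) auto
      then show ?thesis
        using False by simp
    qed
    moreover have "iexp (t * (\<Sum>i<n. u i * \<theta> i)) = (\<Prod>i<n. iexp (t * \<theta> i * u i))"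
      by (simp add: exp_sum[symmetric] sum_distrib_left ac_simps)
    ultimately show "(indicator ?box u / 2 ^ n) *\<^sub>R iexp (t * (\<Sum>i<n. u i * \<theta> i)) = (\<Prod>i<n. ?f i (u i))"
      by (simp only: scaleR_conv_of_real prod.distrib of_real_prod)
  qed
  also have "\<dots> = (\<Prod>i<n. complex_of_real (sinc (t * \<theta> i)))"
    by (subst product_integral_prod) (auto simp only: int finite_lessThan intro!: integrable)
  finally show ?thesis
    by simp
qed

section \<open>Decreasing rearrangement of the coordinates\<close>

lemma exists_decreasing_rearrangement:
  fixes f :: "nat \<Rightarrow> real"
  obtains p where "bij_betw p {..<n} {..<n}" "\<And>i j. i \<le> j \<Longrightarrow> j < n \<Longrightarrow> f (p j) \<le> f (p i)"
proof -
  define xs where "xs = sort_key (\<lambda>i. - f i) [0..<n]"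
  have len: "length xs = n" and "distinct xs" "set xs = {..<n}"
    by (auto simp: xs_def)
  then have "bij_betw ((!) xs) {..<n} {..<n}"
    by (intro bij_betw_nth) auto
  moreover have "f (xs ! j) \<le> f (xs ! i)" if "i \<le> j" "j < n" for i j
    using sorted_nth_mono[of "map (\<lambda>i. - f i) xs" i j] that len by (simp add: xs_def)
  ultimately show thesis
    by (rule that)
qed

text \<open>Norm one makes the Gaussian coefficient 0, and padding with zeros contributes factors
  sinc 0 = 1, so both characteristic functions are finite products; as sinc is even and products are
  symmetric, signs and order are immaterial.\<close>

lemma cube_projection_eq_limit_law:
  assumes p: "bij_betw p {..<n} {..<n}" "\<And>i j. i \<le> j \<Longrightarrow> j < n \<Longrightarrow> \<bar>\<theta> (p j)\<bar> \<le> \<bar>\<theta> (p i)\<bar>"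
    and \<theta>: "\<theta> \<in> unit_sphere n"
  defines "\<alpha> \<equiv> \<lambda>i. if i < n then \<bar>\<theta> (p i)\<bar> else 0"
  shows "\<alpha> \<in> ordered_ball" "limit_law \<alpha> = cube_projection n \<theta>"
proof -
  have "(\<Sum>i<n. (\<theta> i)\<^sup>2) = 1"
    using \<theta> by (simp add: unit_sphere_def L2_set_def)
  moreover have "(\<Sum>i<n. (\<theta> i)\<^sup>2) = (\<Sum>i<n. (\<alpha> i)\<^sup>2)"
    by (subst sum.reindex_bij_betw[OF p(1), symmetric]) (simp add: \<alpha>_def)
  ultimately have sum: "(\<Sum>i<n. (\<alpha> i)\<^sup>2) = 1"
    by simp
  have "(\<Sum>i<m. (\<alpha> i)\<^sup>2) \<le> 1" for m
  proof -
    have "(\<Sum>i<m. (\<alpha> i)\<^sup>2) = (\<Sum>i\<in>{..<m} \<inter> {..<n}. (\<alpha> i)\<^sup>2)"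
      by (intro sum.mono_neutral_right) (auto simp: \<alpha>_def)
    also have "\<dots> \<le> (\<Sum>i<n. (\<alpha> i)\<^sup>2)"
      by (intro sum_mono2) auto
    finally show ?thesis
      using sum by simp
  qed
  then show \<alpha>: "\<alpha> \<in> ordered_ball"
    using p(2) by (auto simp: ordered_ball_def decseq_def \<alpha>_def)
  have norm: "(\<Sum>k. (\<alpha> k)\<^sup>2) = 1"
    using sum by (subst suminf_finite[of "{..<n}"]) (auto simp: \<alpha>_def)
  show "limit_law \<alpha> = cube_projection n \<theta>"
  proof (rule Levy_uniqueness[OF real_distribution_limit_law real_distribution_cube_projection], rule ext)
    fix t
    have "(\<lambda>m. complex_of_real (exp (- (0 * t)\<^sup>2 / 6) * (\<Prod>i<m. sinc (t * \<alpha> i)))) \<longlonglongrightarrow> char (limit_law \<alpha>) t"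
      unfolding limit_law_eq norm
      using char_gauss_series_law[OF ordered_ballD(4)[OF \<alpha>], of 0 t] by simp
    moreover have "(\<lambda>m. complex_of_real (exp (- (0 * t)\<^sup>2 / 6) * (\<Prod>i<m. sinc (t * \<alpha> i))))
        \<longlonglongrightarrow> complex_of_real (\<Prod>i<n. sinc (t * \<alpha> i))"
    proof (rule tendsto_eventually, rule eventually_mono[OF eventually_ge_at_top[of n]])
      fix m assume "n \<le> m"
      then have "(\<Prod>i<m. sinc (t * \<alpha> i)) = (\<Prod>i<n. sinc (t * \<alpha> i))"
        by (intro prod.mono_neutral_right) (auto simp: \<alpha>_def)
      then show "complex_of_real (exp (- (0 * t)\<^sup>2 / 6) * (\<Prod>i<m. sinc (t * \<alpha> i))) = complex_of_real (\<Prod>i<n. sinc (t * \<alpha> i))"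
        by simp
    qed
    ultimately have "char (limit_law \<alpha>) t = complex_of_real (\<Prod>i<n. sinc (t * \<alpha> i))"
      by (rule LIMSEQ_unique)
    also have "(\<Prod>i<n. sinc (t * \<alpha> i)) = (\<Prod>i<n. sinc (t * \<theta> (p i)))"
      by (intro prod.cong refl) (auto simp: \<alpha>_def abs_if)
    also have "\<dots> = (\<Prod>i<n. sinc (t * \<theta> i))"
      by (rule prod.reindex_bij_betw[OF p(1)])
    finally show "char (limit_law \<alpha>) t = char (cube_projection n \<theta>) t"
      by (simp only: char_cube_projection)
  qed
qed

text \<open>Sorting is 1-Lipschitz for the supremum distance, here with respect to a sequence \<open>\<beta>\<close> that is
  already sorted.\<close>

lemma rearrangement_close:
  fixes \<theta> \<beta> :: "nat \<Rightarrow> real"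
  assumes p: "bij_betw p {..<n} {..<n}" "\<And>i j. i \<le> j \<Longrightarrow> j < n \<Longrightarrow> \<bar>\<theta> (p j)\<bar> \<le> \<bar>\<theta> (p i)\<bar>"
    and \<beta>: "decseq \<beta>" "\<And>k. 0 \<le> \<beta> k"
    and close: "\<And>j. j < n \<Longrightarrow> \<bar>\<theta> j - \<beta> j\<bar> < \<epsilon>" and j: "j < n"
  shows "\<bar>\<bar>\<theta> (p j)\<bar> - \<beta> j\<bar> < \<epsilon>"
proof -
  have inj: "inj_on p {..<n}" and range: "\<And>i. i < n \<Longrightarrow> p i < n"
    using p(1) by (auto simp: bij_betw_def)
  have close': "\<beta> k - \<epsilon> < \<bar>\<theta> k\<bar> \<and> \<bar>\<theta> k\<bar> < \<beta> k + \<epsilon>" if "k < n" for k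
    using close[OF that] \<beta>(2)[of k] by linarith
  have "\<bar>\<theta> (p j)\<bar> < \<beta> j + \<epsilon>"
  proof -
    \<comment> \<open>Pigeonhole: by injectivity the j + 1 indices up to \<open>j\<close> cannot all
      be sent below \<open>j\<close>.\<close>
    have "\<exists>i\<le>j. j \<le> p i"
    proof (rule ccontr)
      assume "\<not> (\<exists>i\<le>j. j \<le> p i)"
      then have "p ` {..j} \<subseteq> {..<j}"
        by (metis atMost_iff image_subsetI lessThan_iff linorder_not_le)
      then have "card (p ` {..j}) \<le> card {..<j}"
        by (intro card_mono) auto
      moreover have "inj_on p {..j}"
        using j by (intro inj_on_subset[OF inj]) auto
      ultimately show False
        by (simp add: card_image)
    qed
    then obtain i where i: "i \<le> j" "j \<le> p i"
      by blast
    have "\<bar>\<theta> (p j)\<bar> \<le> \<bar>\<theta> (p i)\<bar>"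
      using i j by (intro p(2))
    also have "\<dots> < \<beta> (p i) + \<epsilon>"
      using i j close' range by auto
    also have "\<dots> \<le> \<beta> j + \<epsilon>"
      using decseqD[OF \<beta>(1) i(2)] by simp
    finally show ?thesis .
  qed
  moreover have "\<beta> j - \<epsilon> < \<bar>\<theta> (p j)\<bar>"
  proof -
    \<comment> \<open>Dually, the n - j indices from \<open>j\<close> on cannot all be sent into the
      n - j - 1 positions above \<open>j\<close>.\<close>
    have "\<exists>i\<in>{j..<n}. p i \<le> j"
    proof (rule ccontr)
      assume "\<not> (\<exists>i\<in>{j..<n}. p i \<le> j)"
      then have "p ` {j..<n} \<subseteq> {Suc j..<n}"
        using range by (auto simp: not_le)
      then have "card (p ` {j..<n}) \<le> card {Suc j..<n}"
        by (intro card_mono) auto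
      moreover have "inj_on p {j..<n}"
        by (intro inj_on_subset[OF inj]) auto
      ultimately show False
        using j by (simp add: card_image)
    qed
    then obtain i where i: "j \<le> i" "i < n" "p i \<le> j"
      by auto
    have "\<beta> j - \<epsilon> \<le> \<beta> (p i) - \<epsilon>"
      using decseqD[OF \<beta>(1) i(3)] by simp
    also have "\<dots> < \<bar>\<theta> (p i)\<bar>"
      using i close' range by auto
    also have "\<dots> \<le> \<bar>\<theta> (p j)\<bar>"
      using i by (intro p(2))
    finally show ?thesis .
  qed
  ultimately show ?thesis
    by linarith
qed

lemma measurable_cube_projection:
  "cube_projection n \<in> euclidean_borel n \<rightarrow>\<^sub>M borel_algebra weak_topology"
  unfolding borel_algebra_def
proof (rule measurable_measure_of)
  show "{U. openin weak_topology U} \<subseteq> Pow (topspace weak_topology)"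
    by (auto dest: openin_subset)
  show "cube_projection n \<in> space (euclidean_borel n) \<rightarrow> topspace weak_topology"
    by (simp add: topspace_weak_topology real_distribution_cube_projection)
  fix U assume "U \<in> {U. openin weak_topology U}"
  moreover have "continuous_map (top_of_set UNIV) weak_topology (cube_projection n)"
  proof (intro continuous_map_weak_topology real_distribution_cube_projection)
    fix t
    show "continuous_on UNIV (\<lambda>\<theta>. char (cube_projection n \<theta>) t)"
      unfolding char_cube_projection
      by (intro continuous_on_of_real continuous_on_prod continuous_on_sinc continuous_on_mult
          continuous_on_const continuous_on_product_coordinates)
  qed
  ultimately have "open (cube_projection n -` U)"
    by (auto simp: continuous_map_def vimage_def)
  then have [measurable]: "cube_projection n -` U \<in> sets (\<Pi>\<^sub>M i\<in>UNIV. borel)"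
    by (simp add: sets_PiM_equal_borel)
  \<comment> \<open>Continuity was shown on the full sequence space, where the product sigma-algebra
    is the Borel one. Extension by zero carries measurability over to n-dimensional vectors, because
    the projection reads only the first n coordinates.\<close>
  let ?e = "\<lambda>\<theta> i. if i < n then \<theta> i else (0::real)"
  have "?e \<in> euclidean_borel n \<rightarrow>\<^sub>M (\<Pi>\<^sub>M i\<in>UNIV. borel)"
  proof (rule measurable_PiM_single')
    show "(\<lambda>\<theta>. ?e \<theta> i) \<in> borel_measurable (euclidean_borel n)" for i
      by (cases "i < n") auto
  qed auto
  then have "?e -` (cube_projection n -` U) \<inter> space (euclidean_borel n) \<in> sets (euclidean_borel n)"
    by (rule measurable_sets) fact
  also have "?e -` (cube_projection n -` U) = cube_projection n -` U"
  proof -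
    have "cube_projection n (?e \<theta>) = cube_projection n \<theta>" for \<theta>
      by (simp add: cube_projection_def cong: sum.cong_simp)
    then show ?thesis
      by auto
  qed
  finally show "cube_projection n -` U \<inter> space (euclidean_borel n) \<in> sets (euclidean_borel n)" .
qed

subsection \<open>Volumes of cones and probabilities on the sphere\<close>

definition euclidean_ball :: "'i set \<Rightarrow> real \<Rightarrow> ('i \<Rightarrow> real) set" where
  "euclidean_ball I R = {x \<in> space (\<Pi>\<^sub>M i\<in>I. lborel). (\<Sum>i\<in>I. (x i)\<^sup>2) \<le> R\<^sup>2}"

lemma borel_measurable_sum_squares:
  assumes "J \<subseteq> I"
  shows "(\<lambda>x. \<Sum>i\<in>J. (x i)\<^sup>2 :: real) \<in> borel_measurable (\<Pi>\<^sub>M i\<in>I. borel)"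
  using assms by (intro borel_measurable_sum borel_measurable_power measurable_component_singleton) auto

lemma cone_sets:
  assumes "J \<subseteq> I"
  shows "{x \<in> space (\<Pi>\<^sub>M i\<in>I. lborel). (\<Sum>i\<in>I. (x i)\<^sup>2) \<le> c \<and> r * (\<Sum>i\<in>I. (x i)\<^sup>2) \<le> (\<Sum>i\<in>J. (x i)\<^sup>2 :: real)}
    \<in> sets (\<Pi>\<^sub>M i\<in>I. lborel)"
proof -
  have "(\<lambda>x. \<Sum>i\<in>J. (x i)\<^sup>2 :: real) \<in> borel_measurable (\<Pi>\<^sub>M i\<in>I. lborel)" if "J \<subseteq> I" for J
    using borel_measurable_sum_squares[OF that] measurable_cong_sets[OF sets_PiM_cong[OF refl sets_lborel] refl]
    by blast
  from this[OF assms] this[OF subset_refl] show ?thesis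
    by (intro sets.sets_Collect_conj borel_measurable_le borel_measurable_times borel_measurable_const)
qed

lemma euclidean_ball_sets[measurable]: "euclidean_ball I R \<in> sets (\<Pi>\<^sub>M i\<in>I. lborel)"
  unfolding euclidean_ball_def by measurable

lemma emeasure_euclidean_ball:
  assumes "finite I" "0 < R"
  shows "emeasure (\<Pi>\<^sub>M i\<in>I. lborel) (euclidean_ball I R) = ennreal (unit_ball_vol (card I) * R ^ card I)"
proof -
  have "sqrt s \<le> R \<longleftrightarrow> s \<le> R\<^sup>2" for s
    using assms by (metis real_sqrt_le_iff real_sqrt_unique less_imp_le)
  then have "euclidean_ball I R
      = {x. sqrt (\<Sum>i\<in>I. (x i)\<^sup>2) \<le> R} \<inter> space (\<Pi>\<^sub>M i\<in>I. lborel)"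
    by (auto simp: euclidean_ball_def)
  then show ?thesis
    using emeasure_cball_aux[OF assms] by simp
qed

lemma fmeasurable_euclidean_ball:
  "finite I \<Longrightarrow> 0 < R \<Longrightarrow> euclidean_ball I R \<in> fmeasurable (\<Pi>\<^sub>M i\<in>I. lborel)"
  by (simp add: fmeasurable_def emeasure_euclidean_ball)

lemma measure_euclidean_ball:
  "finite I \<Longrightarrow> 0 < R \<Longrightarrow>
    measure (\<Pi>\<^sub>M i\<in>I. lborel) (euclidean_ball I R) = unit_ball_vol (card I) * R ^ card I"
  by (simp add: measure_def emeasure_euclidean_ball)

text \<open>Fubini for a splitting of the coordinates into two blocks: under \<open>merge\<close>
  the preimage of \<open>C\<close> is the rectangle \<open>A \<times> B\<close>. It combines a box
  in some coordinates with a ball or a shell in the others.\<close>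

lemma emeasure_lborel_restrict:
  fixes A B :: "('i \<Rightarrow> real) set"
  assumes JL: "finite J" "finite L" "J \<inter> L = {}"
    and A[measurable]: "A \<in> sets (\<Pi>\<^sub>M i\<in>J. lborel)" and B[measurable]: "B \<in> sets (\<Pi>\<^sub>M i\<in>L. lborel)"
  defines "C \<equiv> {x \<in> space (\<Pi>\<^sub>M i\<in>J \<union> L. lborel). restrict x J \<in> A \<and> restrict x L \<in> B}"
  shows "C \<in> sets (\<Pi>\<^sub>M i\<in>J \<union> L. lborel)"
    and "emeasure (\<Pi>\<^sub>M i\<in>J \<union> L. lborel) C
      = emeasure (\<Pi>\<^sub>M i\<in>J. lborel) A * emeasure (\<Pi>\<^sub>M i\<in>L. lborel) B"
proof -
  interpret product_sigma_finite "\<lambda>_::'i. lborel :: real measure" ..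
  interpret L: finite_product_sigma_finite "\<lambda>_::'i. lborel :: real measure" L
    by standard fact
  have [measurable]: "(\<lambda>x. restrict x J) \<in> (\<Pi>\<^sub>M i\<in>J \<union> L. lborel) \<rightarrow>\<^sub>M (\<Pi>\<^sub>M i\<in>J. (lborel :: real measure))"
    "(\<lambda>x. restrict x L) \<in> (\<Pi>\<^sub>M i\<in>J \<union> L. lborel) \<rightarrow>\<^sub>M (\<Pi>\<^sub>M i\<in>L. (lborel :: real measure))"
    by (auto intro: measurable_restrict_subset)
  show C: "C \<in> sets (\<Pi>\<^sub>M i\<in>J \<union> L. lborel)"
    unfolding C_def by measurable
  have A': "A \<subseteq> extensional J" and B': "B \<subseteq> extensional L"
    using sets.sets_into_space[OF A] sets.sets_into_space[OF B] by (auto simp: space_PiM PiE_def)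
  have A_restrict: "restrict a J = a" if "a \<in> A" for a
    using A' that by (auto intro: extensional_restrict)
  have restrict_eq: "restrict a K = a" if "\<forall>i. i \<notin> K \<longrightarrow> a i = undefined" for a :: "'i \<Rightarrow> real" and K
    using that by (auto simp: fun_eq_iff)
  have A_undefined: "a i = undefined" if "a \<in> A" "i \<notin> J" for a i
    using A' that by (auto simp: extensional_def)
  have B_undefined: "b i = undefined" if "b \<in> B" "i \<notin> L" for b i
    using B' that by (auto simp: extensional_def)
  have B_restrict: "restrict b L = b" if "b \<in> B" for b
    using B' that by (auto intro: extensional_restrict)
  have "merge J L -` C \<inter> space ((\<Pi>\<^sub>M i\<in>J. lborel) \<Otimes>\<^sub>M (\<Pi>\<^sub>M i\<in>L. lborel)) = A \<times> B"
    using A' B' JL(3) by (auto simp: C_def space_pair_measure space_PiM A_restrict B_restrict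
        PiE_iff extensional_def A_undefined B_undefined restrict_eq)
  then show "emeasure (\<Pi>\<^sub>M i\<in>J \<union> L. lborel) C
      = emeasure (\<Pi>\<^sub>M i\<in>J. lborel) A * emeasure (\<Pi>\<^sub>M i\<in>L. lborel) B"
    using C by (subst distr_merge[OF JL(3,1,2), symmetric])
      (simp add: emeasure_distr L.emeasure_pair_measure_Times)
qed

lemma emeasure_lborel_box:
  assumes "finite J" "\<And>i. i \<in> J \<Longrightarrow> a i \<le> (b i :: real)"
  shows "emeasure (\<Pi>\<^sub>M i\<in>J. lborel) (\<Pi>\<^sub>E i\<in>J. {a i..b i}) = ennreal (\<Prod>i\<in>J. b i - a i)"
proof -
  interpret product_sigma_finite "\<lambda>_. lborel :: real measure" ..
  show ?thesis
    using assms by (subst emeasure_PiM) (auto simp: prod_ennreal)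
qed

text \<open>A point of the cone has its coordinates outside \<open>J\<close> in a ball of radius \<open>\<surd>(1 - r) R\<close>.\<close>

lemma measure_cone_le_aux:
  assumes I: "finite I" "J \<subseteq> I" and r: "0 \<le> r" "r < 1" and R: "0 < R"
  shows "measure (\<Pi>\<^sub>M i\<in>I. lborel)
      {x \<in> space (\<Pi>\<^sub>M i\<in>I. lborel). (\<Sum>i\<in>I. (x i)\<^sup>2) \<le> R\<^sup>2 \<and> r * (\<Sum>i\<in>I. (x i)\<^sup>2) \<le> (\<Sum>i\<in>J. (x i)\<^sup>2)}
    \<le> 2 ^ card J * (unit_ball_vol (card (I - J)) * sqrt (1 - r) ^ card (I - J)) * R ^ card I"
    (is "measure ?M ?S \<le> ?c")
proof -
  have J: "finite J" "finite (I - J)" "J \<inter> (I - J) = {}" "J \<union> (I - J) = I"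
    using I finite_subset by auto
  \<comment> \<open>The cone is covered by a box times a ball. About the coordinates in
    \<open>J\<close> only the bound R is used; the resulting factor depends on \<open>card J\<close>
    but not on the dimension.\<close>
  let ?A = "\<Pi>\<^sub>E i\<in>J. {-R..R}" and ?B = "euclidean_ball (I - J) (sqrt (1 - r) * R)"
  let ?C = "{x \<in> space ?M. restrict x J \<in> ?A \<and> restrict x (I - J) \<in> ?B}"
  have A: "?A \<in> sets (\<Pi>\<^sub>M i\<in>J. lborel)"
    using J by (intro sets_PiM_I_finite) auto
  have card: "card I = card J + card (I - J)"
    using card_Un_disjoint[OF J(1-3)] J(4) by simp
  have "emeasure ?M ?C = ennreal ((2 * R) ^ card J) * ennreal (unit_ball_vol (card (I - J)) * (sqrt (1 - r) * R) ^ card (I - J))"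
    using emeasure_lborel_restrict(2)[OF J(1-3) A euclidean_ball_sets[of "I - J" "sqrt (1 - r) * R"]] J r R
    by (simp add: emeasure_lborel_box emeasure_euclidean_ball)
  also have "\<dots> = ennreal ?c"
    using r R card by (simp add: ennreal_mult[symmetric] power_mult_distrib power_add ac_simps)
  finally have C: "emeasure ?M ?C = ennreal ?c" .
  have "?C \<in> sets ?M"
    using emeasure_lborel_restrict(1)[OF J(1-3) A euclidean_ball_sets[of "I - J" "sqrt (1 - r) * R"]] J by simp
  then have "?C \<in> fmeasurable ?M"
    using C by (simp add: fmeasurable_def)
  moreover have "?S \<subseteq> ?C"
  proof
    fix x assume x: "x \<in> ?S"
    have split: "(\<Sum>i\<in>I. (x i)\<^sup>2) = (\<Sum>i\<in>J. (x i)\<^sup>2) + (\<Sum>i\<in>I - J. (x i)\<^sup>2)"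
      using I by (subst sum.subset_diff[of J]) auto
    have "\<bar>x i\<bar> \<le> R" if "i \<in> J" for i
    proof (rule power2_le_imp_le)
      have "(x i)\<^sup>2 \<le> (\<Sum>i\<in>I. (x i)\<^sup>2)"
        using that I by (intro member_le_sum) auto
      then show "\<bar>x i\<bar>\<^sup>2 \<le> R\<^sup>2"
        using x by simp
    qed (use R in simp)
    then have "restrict x J \<in> ?A"
      by (auto simp: abs_le_iff minus_le_iff)
    moreover have "(\<Sum>i\<in>I - J. (x i)\<^sup>2) \<le> (1 - r) * (\<Sum>i\<in>I. (x i)\<^sup>2)"
      using x split by (simp add: algebra_simps)
    then have "(\<Sum>i\<in>I - J. (x i)\<^sup>2) \<le> (1 - r) * R\<^sup>2"
      using x r by (elim order_trans) (auto intro: mult_left_mono)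
    then have "restrict x (I - J) \<in> ?B"
      using r by (auto simp: euclidean_ball_def space_PiM power_mult_distrib)
    ultimately show "x \<in> ?C"
      using x by simp
  qed
  moreover have "?S \<in> sets ?M"
    using I by (intro cone_sets)
  ultimately have "measure ?M ?S \<le> measure ?M ?C"
    by (intro measure_mono_fmeasurable)
  also have "\<dots> = ?c"
    using C r R by (simp add: measure_def)
  finally show ?thesis .
qed

section \<open>Comparison of ball volumes across dimensions\<close>

lemma unit_ball_vol_le:
  assumes "m \<le> n"
  shows "unit_ball_vol n \<le> 2 ^ m * unit_ball_vol (real (n - m))"
proof -
  have "unit_ball_vol n = measure (euclidean_lborel n) (euclidean_ball {..<n} 1)"
    by (simp add: measure_euclidean_ball)
  \<comment> \<open>With r = 0 the cone is the entire ball, so its covering by a box times a ball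
    compares the two volumes.\<close>
  also have "\<dots> \<le> 2 ^ m * unit_ball_vol (real (n - m))"
  proof -
    have "{..<n} - {..<m} = {m..<n}"
      by auto
    then show ?thesis
      using measure_cone_le_aux[of "{..<n}" "{..<m}" 0 1] assms
      by (auto simp: euclidean_ball_def sum_nonneg)
  qed
  finally show ?thesis .
qed

text \<open>A box of half-width 1 / n in m coordinates and a ball of radius sqrt (1 - 1 / n) in the
  others fit into the unit ball, as m / n^2 <= 1 / n. Shrinking the ball costs no more than the
  factor exp (- 1), so the loss is a power of n and not exponential.\<close>

lemma unit_ball_vol_ge:
  assumes "m \<le> n" "2 \<le> n"
  shows "2 ^ m * unit_ball_vol (real (n - m)) \<le> exp 1 * real n ^ m * unit_ball_vol n"
proof -
  let ?q = "sqrt (1 - 1 / real n)"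
  have q: "0 < ?q" "?q \<le> 1"
    using assms by auto
  let ?J = "{..<m}" and ?L = "{m..<n}"
  have JL: "finite ?J" "finite ?L" "?J \<inter> ?L = {}" "?J \<union> ?L = {..<n}"
    using assms by auto
  let ?A = "\<Pi>\<^sub>E i\<in>?J. {-(1 / real n)..1 / real n}" and ?B = "euclidean_ball ?L ?q"
  let ?C = "{x \<in> space (euclidean_lborel n). restrict x ?J \<in> ?A \<and> restrict x ?L \<in> ?B}"
  have A: "?A \<in> sets (\<Pi>\<^sub>M i\<in>?J. lborel)"
    by (intro sets_PiM_I_finite) auto
  have "?C \<subseteq> euclidean_ball {..<n} 1"
  proof
    fix x assume x: "x \<in> ?C"
    have "(\<Sum>i\<in>?J. (x i)\<^sup>2) \<le> (\<Sum>i\<in>?J. (1 / real n)\<^sup>2)"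
    proof (rule sum_mono)
      fix i assume "i \<in> ?J"
      then have "\<bar>x i\<bar> \<le> \<bar>1 / real n\<bar>"
        using x by (auto simp: PiE_iff abs_le_iff minus_le_iff)
      then show "(x i)\<^sup>2 \<le> (1 / real n)\<^sup>2"
        by (simp only: abs_le_square_iff)
    qed
    also have "\<dots> \<le> 1 / real n"
      using assms by (simp add: power2_eq_square field_simps)
    moreover have "(\<Sum>i\<in>?L. (x i)\<^sup>2) \<le> 1 - 1 / real n"
      using x assms by (auto simp: euclidean_ball_def)
    ultimately have "(\<Sum>i\<in>?J. (x i)\<^sup>2) + (\<Sum>i\<in>?L. (x i)\<^sup>2) \<le> 1"
      by simp
    then have "(\<Sum>i<n. (x i)\<^sup>2) \<le> 1"
      using sum.union_disjoint[OF JL(1-3), of "\<lambda>i. (x i)\<^sup>2"] JL(4) by simp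
    then show "x \<in> euclidean_ball {..<n} 1"
      using x by (simp add: euclidean_ball_def)
  qed
  then have "emeasure (euclidean_lborel n) ?C \<le> emeasure (euclidean_lborel n) (euclidean_ball {..<n} 1)"
    by (intro emeasure_mono) auto
  also have "\<dots> = ennreal (unit_ball_vol n)"
    by (simp add: emeasure_euclidean_ball)
  also have "emeasure (euclidean_lborel n) ?C
      = ennreal ((2 / real n) ^ m) * ennreal (unit_ball_vol (real (n - m)) * ?q ^ (n - m))"
    using emeasure_lborel_restrict(2)[OF JL(1-3) A euclidean_ball_sets[of ?L ?q]] q
    unfolding JL(4) by (simp add: emeasure_lborel_box emeasure_euclidean_ball)
  also have "\<dots> = ennreal ((2 / real n) ^ m * (unit_ball_vol (real (n - m)) * ?q ^ (n - m)))"
    using q by (simp add: ennreal_mult)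
  finally have le: "(2 / real n) ^ m * (unit_ball_vol (real (n - m)) * ?q ^ (n - m)) \<le> unit_ball_vol n"
    by (subst (asm) ennreal_le_iff) auto
  have "exp (-1) \<le> ?q ^ (n - m)"
  proof -
    have "exp (- (1 / real n)) \<le> ?q"
    proof (rule real_le_rsqrt)
      \<comment> \<open>For n >= 2 this leads to 1 - 1 / n >= exp (- 2 / n), so the n-th power of
        the square root is at least exp (- 1).\<close>
      have "- (2 / real n) \<le> - (1 / real n) - 2 * (1 / real n)\<^sup>2"
        using assms by (simp add: power2_eq_square field_simps)
      also have "\<dots> \<le> ln (1 - 1 / real n)"
        using assms by (intro ln_one_minus_pos_lower_bound) (auto simp: field_simps)
      finally have "exp (- (2 / real n)) \<le> exp (ln (1 - 1 / real n))"
        by simp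
      also have "\<dots> = 1 - 1 / real n"
        using assms by (intro exp_ln) simp
      finally show "(exp (- (1 / real n)))\<^sup>2 \<le> 1 - 1 / real n"
        by (simp add: exp_double[symmetric])
    qed
    then have "exp (- (1 / real n)) ^ n \<le> ?q ^ n"
      by (intro power_mono) auto
    also have "\<dots> \<le> ?q ^ (n - m)"
      using q by (intro power_decreasing) auto
    finally show ?thesis
      using assms by (simp add: exp_of_nat_mult[symmetric])
  qed
  then have "(2 / real n) ^ m * (unit_ball_vol (real (n - m)) * exp (-1))
      \<le> (2 / real n) ^ m * (unit_ball_vol (real (n - m)) * ?q ^ (n - m))"
    by (intro mult_left_mono) auto
  with le have "(2 / real n) ^ m * (unit_ball_vol (real (n - m)) * exp (-1)) \<le> unit_ball_vol n"
    by (rule order_trans[rotated])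
  then show ?thesis
    using assms by (simp add: exp_minus power_divide field_simps)
qed

lemma measure_cone_le:
  assumes I: "finite I" "J \<subseteq> I" "2 \<le> card I" and r: "0 \<le> r" "r < 1" and R: "0 < R"
  shows "measure (\<Pi>\<^sub>M i\<in>I. lborel)
      {x \<in> space (\<Pi>\<^sub>M i\<in>I. lborel). (\<Sum>i\<in>I. (x i)\<^sup>2) \<le> R\<^sup>2 \<and> r * (\<Sum>i\<in>I. (x i)\<^sup>2) \<le> (\<Sum>i\<in>J. (x i)\<^sup>2)}
    \<le> exp 1 * real (card I) ^ card J * sqrt (1 - r) ^ (card I - card J) * (unit_ball_vol (card I) * R ^ card I)"
    (is "?m \<le> _")
proof -
  have card: "card (I - J) = card I - card J" "card J \<le> card I"
    using I finite_subset[OF I(2,1)] by (auto simp: card_Diff_subset card_mono)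
  have "?m \<le> (2 ^ card J * unit_ball_vol (real (card I - card J))) * (sqrt (1 - r) ^ (card I - card J) * R ^ card I)"
    using measure_cone_le_aux[OF I(1,2) r R] by (simp add: card ac_simps)
  also have "\<dots> \<le> (exp 1 * real (card I) ^ card J * unit_ball_vol (card I)) * (sqrt (1 - r) ^ (card I - card J) * R ^ card I)"
    using unit_ball_vol_ge[OF card(2) I(3)] r R by (intro mult_right_mono) auto
  finally show ?thesis
    by (simp add: ac_simps)
qed

section \<open>From volumes of cones to probabilities on the sphere\<close>

lemma measure_sphere_uniform:
  assumes "1 \<le> n" and B: "B \<in> sets (euclidean_borel n)"
  shows "measure (sphere_uniform n) B
    = measure (euclidean_lborel n) {x \<in> unit_ball n. (\<lambda>i\<in>{..<n}. x i / L2_set x {..<n}) \<in> B} / unit_ball_vol n"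
proof -
  have ball: "unit_ball n = euclidean_ball {..<n} 1"
    by (auto simp: unit_ball_def euclidean_ball_def L2_set_def space_PiM)
  have em: "emeasure (euclidean_lborel n) (unit_ball n) = ennreal (unit_ball_vol n)"
    by (simp add: ball emeasure_euclidean_ball)
  have meas[measurable]: "(\<lambda>x. \<lambda>i\<in>{..<n}. x i / L2_set x {..<n}) \<in> euclidean_lborel n \<rightarrow>\<^sub>M euclidean_borel n"
    unfolding L2_set_def by measurable
  let ?P = "(\<lambda>x. \<lambda>i\<in>{..<n}. x i / L2_set x {..<n}) -` B \<inter> space (euclidean_lborel n)"
  have "measure (sphere_uniform n) B = measure (uniform_measure (euclidean_lborel n) (unit_ball n)) ?P"
    unfolding sphere_uniform_def using B by (subst measure_distr) auto
  also have "\<dots> = measure (euclidean_lborel n) (unit_ball n \<inter> ?P) / measure (euclidean_lborel n) (unit_ball n)"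
  proof (rule measure_uniform_measure)
    have "0 < unit_ball_vol (real n)"
      by simp
    then show "emeasure (euclidean_lborel n) (unit_ball n) \<noteq> 0"
      by (simp only: em ennreal_eq_0_iff not_le)
  qed (use B em meas in \<open>auto intro: measurable_sets\<close>)
  also have "unit_ball n \<inter> ?P = {x \<in> unit_ball n. (\<lambda>i\<in>{..<n}. x i / L2_set x {..<n}) \<in> B}"
    by (auto simp: ball euclidean_ball_def)
  also have "measure (euclidean_lborel n) (unit_ball n) = unit_ball_vol n"
    using em by (simp add: measure_def)
  finally show ?thesis .
qed

text \<open>The condition on the normalised point is homogeneous, so its preimage in the ball lies
  in a cone of the kind already measured.\<close>

lemma measure_sphere_sum_ge_le:
  assumes "J \<subseteq> {..<n}" "2 \<le> n" and r: "0 \<le> r" "r < 1"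
  shows "measure (sphere_uniform n) {\<theta> \<in> space (euclidean_borel n). r < (\<Sum>i\<in>J. (\<theta> i)\<^sup>2)}
    \<le> exp 1 * real n ^ card J * sqrt (1 - r) ^ (n - card J)"
proof -
  let ?B = "{\<theta> \<in> space (euclidean_borel n). r < (\<Sum>i\<in>J. (\<theta> i)\<^sup>2)}"
  have J: "finite J"
    using assms finite_subset by auto
  have [measurable]: "(\<lambda>x. \<Sum>i\<in>J. (x i)\<^sup>2 :: real) \<in> borel_measurable (euclidean_borel n)"
    by (rule borel_measurable_sum_squares) fact
  have B: "?B \<in> sets (euclidean_borel n)"
    by measurable
  let ?S = "{x \<in> space (euclidean_lborel n). (\<Sum>i<n. (x i)\<^sup>2) \<le> 1\<^sup>2 \<and> r * (\<Sum>i<n. (x i)\<^sup>2) \<le> (\<Sum>i\<in>J. (x i)\<^sup>2)}"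
  have S: "?S \<in> sets (euclidean_lborel n)"
    using assms by (intro cone_sets)
  have "measure (euclidean_lborel n) {x \<in> unit_ball n. (\<lambda>i\<in>{..<n}. x i / L2_set x {..<n}) \<in> ?B} \<le> measure (euclidean_lborel n) ?S"
  proof (rule measure_mono_fmeasurable)
    show "{x \<in> unit_ball n. (\<lambda>i\<in>{..<n}. x i / L2_set x {..<n}) \<in> ?B} \<subseteq> ?S"
    proof
      fix x assume x: "x \<in> {x \<in> unit_ball n. (\<lambda>i\<in>{..<n}. x i / L2_set x {..<n}) \<in> ?B}"
      have "(\<Sum>i\<in>J. ((\<lambda>i\<in>{..<n}. x i / L2_set x {..<n}) i)\<^sup>2) = (\<Sum>i\<in>J. (x i)\<^sup>2) / (L2_set x {..<n})\<^sup>2"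
        unfolding sum_divide_distrib using assms by (intro sum.cong) (auto simp: power_divide)
      then have less: "r < (\<Sum>i\<in>J. (x i)\<^sup>2) / (\<Sum>i<n. (x i)\<^sup>2)"
        using x by (simp add: L2_set_def sum_nonneg)
      \<comment> \<open>The origin is excluded: division by 0 gives 0, and the strict inequality
        would contradict r >= 0.\<close>
      then have "(\<Sum>i<n. (x i)\<^sup>2) \<noteq> 0"
        using r by auto
      then have "0 < (\<Sum>i<n. (x i)\<^sup>2)"
        using sum_nonneg[of "{..<n}" "\<lambda>i. (x i)\<^sup>2"] by fastforce
      then show "x \<in> ?S"
        using x less by (auto simp: unit_ball_def L2_set_def space_PiM pos_less_divide_eq)
    qed
    show "?S \<in> fmeasurable (euclidean_lborel n)"
      by (rule fmeasurableI2[OF fmeasurable_euclidean_ball[of "{..<n}" 1]])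
         (use S in \<open>auto simp: euclidean_ball_def\<close>)
    have "{x \<in> space (euclidean_lborel n). x \<in> unit_ball n \<and> (\<lambda>i\<in>{..<n}. x i / L2_set x {..<n}) \<in> ?B} \<in> sets (euclidean_lborel n)"
      using unit_ball_sets[of n] B unfolding L2_set_def by measurable
    also have "{x \<in> space (euclidean_lborel n). x \<in> unit_ball n \<and> (\<lambda>i\<in>{..<n}. x i / L2_set x {..<n}) \<in> ?B}
        = {x \<in> unit_ball n. (\<lambda>i\<in>{..<n}. x i / L2_set x {..<n}) \<in> ?B}"
      by (auto simp: unit_ball_def space_PiM)
    finally show "{x \<in> unit_ball n. (\<lambda>i\<in>{..<n}. x i / L2_set x {..<n}) \<in> ?B} \<in> sets (euclidean_lborel n)" .
  qed
  also have "\<dots> \<le> exp 1 * real n ^ card J * sqrt (1 - r) ^ (n - card J) * unit_ball_vol n"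
    using measure_cone_le[of "{..<n}" J r 1] assms by simp
  finally show ?thesis
    using assms B by (subst measure_sphere_uniform) (auto simp: pos_divide_le_eq)
qed

text \<open>Union bound over at most n^m index sets; with the n^m of the cone bound this gives the
  exponent 2 m and leaves the exponential rate unchanged.\<close>

lemma measure_sphere_partial_sum_le:
  assumes "m \<le> n" "2 \<le> n" and r: "0 \<le> r" "r < 1"
  shows "measure (sphere_uniform n)
      {\<theta> \<in> space (euclidean_borel n). \<exists>J\<subseteq>{..<n}. card J = m \<and> r < (\<Sum>i\<in>J. (\<theta> i)\<^sup>2)}
    \<le> exp 1 * real n ^ (2 * m) * sqrt (1 - r) ^ (n - m)" (is "measure _ ?E \<le> _")
    and "{\<theta> \<in> space (euclidean_borel n). \<exists>J\<subseteq>{..<n}. card J = m \<and> r < (\<Sum>i\<in>J. (\<theta> i)\<^sup>2)} \<in> sets (euclidean_borel n)"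
proof -
  let ?Js = "{J. J \<subseteq> {..<n} \<and> card J = m}"
  let ?F = "\<lambda>J. {\<theta> \<in> space (euclidean_borel n). r < (\<Sum>i\<in>J. (\<theta> i)\<^sup>2)}"
  have sets: "?F J \<in> sets (euclidean_borel n)" if "J \<in> ?Js" for J
  proof -
    have [measurable]: "i \<in> J \<Longrightarrow> i \<in> {..<n}" for i
      using that by auto
    show ?thesis
      by measurable
  qed
  have fin: "finite ?Js"
    by (rule finite_subset[of _ "Pow {..<n}"]) auto
  have E: "?E = (\<Union>J\<in>?Js. ?F J)"
    by auto
  then show "?E \<in> sets (euclidean_borel n)"
    using sets fin by (auto intro!: sets.finite_UN)
  have "measure (sphere_uniform n) ?E \<le> (\<Sum>J\<in>?Js. measure (sphere_uniform n) (?F J))"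
    unfolding E using sets fin by (intro measure_UNION_le) (auto simp: sphere_uniform_def)
  also have "\<dots> \<le> (\<Sum>J\<in>?Js. exp 1 * real n ^ m * sqrt (1 - r) ^ (n - m))"
    using measure_sphere_sum_ge_le[of _ n r] assms by (intro sum_mono) auto
  also have "\<dots> = real (n choose m) * (exp 1 * real n ^ m * sqrt (1 - r) ^ (n - m))"
    using n_subsets[of "{..<n}" m] by simp
  also have "\<dots> \<le> real n ^ m * (exp 1 * real n ^ m * sqrt (1 - r) ^ (n - m))"
    using binomial_le_pow[OF assms(1)] r
    by (intro mult_right_mono) (auto simp flip: of_nat_power)
  finally show "measure (sphere_uniform n) ?E \<le> exp 1 * real n ^ (2 * m) * sqrt (1 - r) ^ (n - m)"
    by (simp only: mult_2 power_add mult.assoc mult.left_commute)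
qed

section \<open>Lower bounds: thin shells with small coordinates\<close>

lemma measure_shell_ge:
  fixes L :: "nat set"
  assumes L: "finite L" "2 \<le> card L" and \<rho>: "0 < \<rho>" "\<rho> \<le> 1" and \<delta>: "0 < \<delta>" "\<delta> < 1"
  defines "B \<equiv> {y \<in> space (\<Pi>\<^sub>M i\<in>L. lborel). (\<Sum>i\<in>L. (y i)\<^sup>2) \<le> \<rho>\<^sup>2 \<and> ((1 - \<delta>) * \<rho>)\<^sup>2 < (\<Sum>i\<in>L. (y i)\<^sup>2)
    \<and> (\<forall>j\<in>L. \<bar>y j\<bar> \<le> \<delta>)}"
  shows "B \<in> sets (\<Pi>\<^sub>M i\<in>L. lborel)"
    and "unit_ball_vol (card L) * \<rho> ^ card L *
        (1 - (1 - \<delta>) ^ card L - exp 1 * (real (card L))\<^sup>2 * sqrt (1 - \<delta>\<^sup>2) ^ (card L - 1))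
      \<le> measure (\<Pi>\<^sub>M i\<in>L. lborel) B"
proof -
  let ?M = "\<Pi>\<^sub>M i\<in>L. lborel :: real measure" and ?N = "card L"
  let ?v = "unit_ball_vol ?N * \<rho> ^ ?N"
  let ?cone = "\<lambda>j. {y \<in> space ?M. (\<Sum>i\<in>L. (y i)\<^sup>2) \<le> \<rho>\<^sup>2 \<and> \<delta>\<^sup>2 * (\<Sum>i\<in>L. (y i)\<^sup>2) \<le> (\<Sum>i\<in>{j}. (y i)\<^sup>2)}"
  have "{y \<in> space ?M. (\<Sum>i\<in>L. (y i)\<^sup>2) \<le> \<rho>\<^sup>2} \<in> sets ?M" "{y \<in> space ?M. ((1 - \<delta>) * \<rho>)\<^sup>2 < (\<Sum>i\<in>L. (y i)\<^sup>2)} \<in> sets ?M"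
    by measurable
  moreover have "{y \<in> space ?M. \<forall>j\<in>L. \<bar>y j\<bar> \<le> \<delta>} \<in> sets ?M"
    using L(1) by (intro sets.sets_Collect_finite_All) measurable
  ultimately show B: "B \<in> sets ?M"
    unfolding B_def by (intro sets.sets_Collect_conj)
  have cone: "?cone j \<in> sets ?M" "measure ?M (?cone j) \<le> exp 1 * real ?N * sqrt (1 - \<delta>\<^sup>2) ^ (?N - 1) * ?v"
    if "j \<in> L" for j
  proof -
    have "\<delta>\<^sup>2 < 1"
      using \<delta> by (simp add: power_less_one_iff)
    then show "measure ?M (?cone j) \<le> exp 1 * real ?N * sqrt (1 - \<delta>\<^sup>2) ^ (?N - 1) * ?v"
      using measure_cone_le[of L "{j}" "\<delta>\<^sup>2" \<rho>] that L \<rho> by simp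
    show "?cone j \<in> sets ?M"
      using that by (intro cone_sets) auto
  qed
  \<comment> \<open>In high dimension nearly all of the ball is close to its boundary and has no
    large coordinate: the rest is covered by a smaller ball and one cone per coordinate, whose
    proportions decay geometrically up to powers of the dimension.\<close>
  have "euclidean_ball L \<rho> \<subseteq> B \<union> (euclidean_ball L ((1 - \<delta>) * \<rho>) \<union> (\<Union>j\<in>L. ?cone j))"
  proof
    fix y assume y: "y \<in> euclidean_ball L \<rho>"
    show "y \<in> B \<union> (euclidean_ball L ((1 - \<delta>) * \<rho>) \<union> (\<Union>j\<in>L. ?cone j))"
    proof (cases "\<exists>j\<in>L. \<delta> < \<bar>y j\<bar>")
      case True
      then obtain j where j: "j \<in> L" "\<delta> < \<bar>y j\<bar>"
        by blast
      \<comment> \<open>As \<rho> <= 1, a coordinate larger than \<delta> carries at least the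
        proportion \<delta>^2 of the squared norm.\<close>
      have "(\<Sum>i\<in>L. (y i)\<^sup>2) \<le> 1"
        using y \<rho> by (auto simp: euclidean_ball_def power_le_one elim: order_trans)
      then have "\<delta>\<^sup>2 * (\<Sum>i\<in>L. (y i)\<^sup>2) \<le> \<delta>\<^sup>2 * 1"
        by (intro mult_left_mono) auto
      also have "\<dots> \<le> (y j)\<^sup>2"
        using j(2) \<delta> abs_le_square_iff[of \<delta> "y j"] by simp
      finally have "y \<in> ?cone j"
        using y by (simp add: euclidean_ball_def)
      then show ?thesis
        using j(1) by blast
    next
      case False
      then show ?thesis
        using y by (auto simp: B_def euclidean_ball_def not_less)
    qed
  qed
  then have "measure ?M (euclidean_ball L \<rho>) \<le> measure ?M (B \<union> (euclidean_ball L ((1 - \<delta>) * \<rho>) \<union> (\<Union>j\<in>L. ?cone j)))"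
  proof (rule measure_mono_fmeasurable)
    have sub: "B \<union> (euclidean_ball L ((1 - \<delta>) * \<rho>) \<union> (\<Union>j\<in>L. ?cone j)) \<subseteq> euclidean_ball L \<rho>"
    proof -
      have "((1 - \<delta>) * \<rho>)\<^sup>2 \<le> \<rho>\<^sup>2"
        using \<delta> \<rho> by (intro power_mono) (auto simp: mult_le_cancel_right1)
      then show ?thesis
        by (auto simp: B_def euclidean_ball_def)
    qed
    show "B \<union> (euclidean_ball L ((1 - \<delta>) * \<rho>) \<union> (\<Union>j\<in>L. ?cone j)) \<in> fmeasurable ?M"
      by (rule fmeasurableI2[OF fmeasurable_euclidean_ball sub]) (use L \<rho> B cone in auto)
  qed auto
  also have "\<dots> \<le> measure ?M B + measure ?M (euclidean_ball L ((1 - \<delta>) * \<rho>) \<union> (\<Union>j\<in>L. ?cone j))"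
    using B cone L by (intro measure_Un_le sets.Un sets.finite_UN) auto
  also have "\<dots> \<le> measure ?M B + (measure ?M (euclidean_ball L ((1 - \<delta>) * \<rho>)) + measure ?M (\<Union>j\<in>L. ?cone j))"
    using cone L by (intro add_left_mono measure_Un_le sets.finite_UN) auto
  also have "\<dots> \<le> measure ?M B + (?v * (1 - \<delta>) ^ ?N + (\<Sum>j\<in>L. exp 1 * real ?N * sqrt (1 - \<delta>\<^sup>2) ^ (?N - 1) * ?v))"
  proof (intro add_left_mono add_mono)
    show "measure ?M (euclidean_ball L ((1 - \<delta>) * \<rho>)) \<le> ?v * (1 - \<delta>) ^ ?N"
      using L \<delta> \<rho> by (simp add: measure_euclidean_ball power_mult_distrib)
    have "measure ?M (\<Union>j\<in>L. ?cone j) \<le> (\<Sum>j\<in>L. measure ?M (?cone j))"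
      using cone L by (intro measure_UNION_le) auto
    also have "\<dots> \<le> (\<Sum>j\<in>L. exp 1 * real ?N * sqrt (1 - \<delta>\<^sup>2) ^ (?N - 1) * ?v)"
      by (intro sum_mono cone)
    finally show "measure ?M (\<Union>j\<in>L. ?cone j) \<le> (\<Sum>j\<in>L. exp 1 * real ?N * sqrt (1 - \<delta>\<^sup>2) ^ (?N - 1) * ?v)" .
  qed
  finally show "?v * (1 - (1 - \<delta>) ^ ?N - exp 1 * (real ?N)\<^sup>2 * sqrt (1 - \<delta>\<^sup>2) ^ (?N - 1)) \<le> measure ?M B"
    using L \<rho> by (simp add: measure_euclidean_ball algebra_simps power2_eq_square)
qed

lemma shell_factor_tendsto:
  assumes \<delta>: "0 < \<delta>" "\<delta> < 1"
  shows "(\<lambda>N. 1 - (1 - \<delta>) ^ N - exp 1 * (real N)\<^sup>2 * sqrt (1 - \<delta>\<^sup>2) ^ (N - 1)) \<longlonglongrightarrow> 1"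
proof -
  \<comment> \<open>One more root splits the geometric factor, so that N^2 s^N is the square of N
    q^N; the exponent N - 1 costs a factor 1 / s.\<close>
  define s q where "s = sqrt (1 - \<delta>\<^sup>2)" and "q = sqrt s"
  have \<delta>2: "0 < \<delta>\<^sup>2" "\<delta>\<^sup>2 < 1"
    using \<delta> by (auto simp: power_less_one_iff)
  have s: "0 < s" "s < 1"
    using \<delta>2 by (auto simp: s_def real_sqrt_lt_1_iff)
  then have q: "0 < q" "q < 1" "q\<^sup>2 = s"
    by (auto simp: q_def real_sqrt_lt_1_iff)
  have "(\<lambda>N. (real N * q ^ N)\<^sup>2 * (exp 1 / s)) \<longlonglongrightarrow> 0\<^sup>2 * (exp 1 / s)"
    using q by (intro tendsto_intros powser_times_n_limit_0) auto
  moreover have "\<forall>\<^sub>F N in sequentially. (real N * q ^ N)\<^sup>2 * (exp 1 / s) = exp 1 * (real N)\<^sup>2 * s ^ (N - 1)"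
  proof (rule eventually_mono[OF eventually_ge_at_top[of 1]])
    fix N :: nat assume "1 \<le> N"
    then have "(q ^ N)\<^sup>2 = s * s ^ (N - 1)"
      using q(3) by (cases N) (auto simp flip: power_mult power_Suc simp: mult.commute power_mult)
    then show "(real N * q ^ N)\<^sup>2 * (exp 1 / s) = exp 1 * (real N)\<^sup>2 * s ^ (N - 1)"
      using s by (simp add: power_mult_distrib)
  qed
  ultimately have "(\<lambda>N. exp 1 * (real N)\<^sup>2 * s ^ (N - 1)) \<longlonglongrightarrow> 0"
    by (simp add: tendsto_cong)
  moreover have "(\<lambda>N. (1 - \<delta>) ^ N) \<longlonglongrightarrow> 0"
    using \<delta> by (intro LIMSEQ_power_zero) auto
  ultimately have "(\<lambda>N. 1 - (1 - \<delta>) ^ N - exp 1 * (real N)\<^sup>2 * s ^ (N - 1)) \<longlonglongrightarrow> 1 - 0 - 0"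
    by (intro tendsto_diff tendsto_const)
  then show ?thesis
    by (simp add: s_def)
qed

text \<open>The head of \<open>x\<close> lies slightly below that of \<alpha>, and its tail carries
  almost the complementary squared mass in small pieces. Hence its norm lies between 1 - \<delta>
  and 1, and normalising hardly moves it.\<close>

lemma normalised_close:
  fixes x \<alpha> :: "nat \<Rightarrow> real"
  assumes \<alpha>: "\<alpha> \<in> ordered_ball" and \<delta>: "0 < \<delta>" "\<delta> \<le> 1 / 4" and m: "\<alpha> m < \<delta>" "m \<le> n"
    and head: "\<And>i. i < m \<Longrightarrow> (1 - \<delta>) * \<alpha> i \<le> x i \<and> x i \<le> \<alpha> i"
    and tail: "\<And>i. m \<le> i \<Longrightarrow> i < n \<Longrightarrow> \<bar>x i\<bar> \<le> \<delta>"
    and shell: "(\<Sum>i=m..<n. (x i)\<^sup>2) \<le> 1 - (\<Sum>i<m. (\<alpha> i)\<^sup>2)"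
      "(1 - \<delta>)\<^sup>2 * (1 - (\<Sum>i<m. (\<alpha> i)\<^sup>2)) \<le> (\<Sum>i=m..<n. (x i)\<^sup>2)"
  shows "(\<Sum>i<n. (x i)\<^sup>2) \<le> 1" "j < n \<Longrightarrow> \<bar>x j / L2_set x {..<n} - \<alpha> j\<bar> < 4 * \<delta>"
proof -
  note K = ordered_ballD[OF \<alpha>]
  have split: "(\<Sum>i<n. (x i)\<^sup>2) = (\<Sum>i<m. (x i)\<^sup>2) + (\<Sum>i=m..<n. (x i)\<^sup>2)"
    using m(2) sum.atLeastLessThan_concat[of 0 m n "\<lambda>i. (x i)\<^sup>2"] by (simp add: atLeast0LessThan)
  have x_nonneg: "0 \<le> x i" if "i < m" for i
  proof -
    have "0 \<le> (1 - \<delta>) * \<alpha> i"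
      using K(2) \<delta> by simp
    then show ?thesis
      using head[OF that] by linarith
  qed
  have "(\<Sum>i<m. (x i)\<^sup>2) \<le> (\<Sum>i<m. (\<alpha> i)\<^sup>2)"
    using head x_nonneg by (intro sum_mono power_mono) auto
  then show le1: "(\<Sum>i<n. (x i)\<^sup>2) \<le> 1"
    using split shell(1) by simp
  have "(\<Sum>i<m. ((1 - \<delta>) * \<alpha> i)\<^sup>2) \<le> (\<Sum>i<m. (x i)\<^sup>2)"
    using head K(2) \<delta> by (intro sum_mono power_mono) auto
  then have "(1 - \<delta>)\<^sup>2 * (\<Sum>i<m. (\<alpha> i)\<^sup>2) \<le> (\<Sum>i<m. (x i)\<^sup>2)"
    by (simp add: power_mult_distrib sum_distrib_left)
  with shell(2) have "(1 - \<delta>)\<^sup>2 \<le> (\<Sum>i<n. (x i)\<^sup>2)"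
    unfolding split by (simp add: algebra_simps)
  then have l: "1 - \<delta> \<le> L2_set x {..<n}" "L2_set x {..<n} \<le> 1"
    unfolding L2_set_def using le1 by (auto intro: real_le_rsqrt)
  let ?l = "L2_set x {..<n}"
  have pos: "0 < ?l"
    using l \<delta> by linarith
  have inv: "a / ?l \<le> (1 + 2 * \<delta>) * a" if "0 \<le> a" for a
  proof -
    \<comment> \<open>Dividing by a norm of at least 1 - \<delta> stretches by at most 1 + 2
      \<delta>, which is valid for \<delta> <= 1/2.\<close>
    have "1 \<le> (1 + 2 * \<delta>) * (1 - \<delta>)"
    proof -
      have "0 \<le> \<delta> * (1 - 2 * \<delta>)"
        using \<delta> by simp
      then show ?thesis
        by (simp add: algebra_simps)
    qed
    also have "\<dots> \<le> (1 + 2 * \<delta>) * ?l"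
      using l \<delta> by (intro mult_left_mono) auto
    finally have "a * 1 \<le> a * ((1 + 2 * \<delta>) * ?l)"
      using that by (intro mult_left_mono) auto
    then show ?thesis
      using pos by (simp add: pos_divide_le_eq ac_simps)
  qed
  show "\<bar>x j / ?l - \<alpha> j\<bar> < 4 * \<delta>" if j: "j < n"
  proof (cases "j < m")
    case True
    have "(\<alpha> j)\<^sup>2 \<le> 1 / real (Suc j)"
      using \<alpha> by (rule ordered_ball_square_le)
    also have "\<dots> \<le> 1"
      by simp
    finally have \<alpha>1: "\<alpha> j \<le> 1"
      using K(2)[of j] by (simp add: power_le_one_iff abs_square_le_1)
    then have \<delta>\<alpha>: "\<delta> * \<alpha> j \<le> \<delta>"
      using \<delta> by (simp add: mult_left_le)
    have "x j / ?l \<le> (1 + 2 * \<delta>) * x j"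
      using x_nonneg[OF True] by (rule inv)
    also have "\<dots> \<le> (1 + 2 * \<delta>) * \<alpha> j"
      using head[OF True] \<delta> by (intro mult_left_mono) auto
    finally have "x j / ?l - \<alpha> j \<le> 2 * (\<delta> * \<alpha> j)"
      by (simp add: algebra_simps)
    moreover have "x j \<le> x j / ?l"
      using pos l x_nonneg[OF True] by (simp add: pos_le_divide_eq mult_left_le)
    then have "\<alpha> j - x j / ?l \<le> \<delta> * \<alpha> j"
      using head[OF True] by (simp add: algebra_simps)
    ultimately show ?thesis
      using \<delta>\<alpha> \<delta> by linarith
  next
    case False
    \<comment> \<open>Beyond \<open>m\<close> the normalised coordinate and
      \<open>\<alpha> j\<close> are small separately, with total below 3 \<delta>.\<close>
    have "\<bar>x j / ?l\<bar> = \<bar>x j\<bar> / ?l"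
      using pos by simp
    also have "\<dots> \<le> (1 + 2 * \<delta>) * \<bar>x j\<bar>"
      by (rule inv) simp
    also have "\<dots> \<le> (1 + 2 * (1 / 4)) * \<delta>"
      using tail[of j] False j \<delta> by (intro mult_mono) auto
    also have "\<dots> \<le> 2 * \<delta>"
      using \<delta> by simp
    finally have "\<bar>x j / ?l\<bar> \<le> 2 * \<delta>" .
    moreover have "\<alpha> j < \<delta>" "0 \<le> \<alpha> j"
      using decseqD[OF K(1), of m j] False m K(2)[of j] by auto
    ultimately show ?thesis
      using \<delta> by linarith
  qed
qed

text \<open>The cone over the neighbourhood contains a box just below the first m coefficients times
  a shell of radius \<rho> with small coordinates. The box has fixed volume; for large n the shell
  has at least half the volume of its ball, and \<rho> is at least the base of the power on the
  left.\<close>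

lemma measure_sphere_near_ge:
  assumes \<alpha>: "\<alpha> \<in> admissible" and \<epsilon>: "0 < \<epsilon>" "\<epsilon> \<le> 1"
  shows "\<exists>c>0. \<forall>\<^sub>F n in sequentially. c * sqrt (1 - (\<Sum>k. (\<alpha> k)\<^sup>2)) ^ n
    \<le> measure (sphere_uniform n) {\<theta> \<in> space (euclidean_borel n). \<forall>j\<in>{..<n}. \<bar>\<theta> j - \<alpha> j\<bar> < \<epsilon>}"
proof -
  have \<alpha>': "\<alpha> \<in> ordered_ball" and less: "(\<Sum>k. (\<alpha> k)\<^sup>2) < 1"
    using \<alpha> by (auto simp: admissible_iff)
  note K = ordered_ballD[OF \<alpha>']
  define \<delta> where "\<delta> = \<epsilon> / 4"
  have \<delta>: "0 < \<delta>" "\<delta> \<le> 1 / 4" and \<delta>1: "\<delta> < 1"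
    using \<epsilon> by (auto simp: \<delta>_def)
  have "(\<lambda>k. (\<alpha> k)\<^sup>2) \<longlonglongrightarrow> 0"
    using K(4) by (rule summable_LIMSEQ_zero)
  then have "\<forall>\<^sub>F k in sequentially. (\<alpha> k)\<^sup>2 < \<delta>\<^sup>2"
    by (rule order_tendstoD(2)) (use \<delta> in auto)
  then obtain k where "(\<alpha> k)\<^sup>2 < \<delta>\<^sup>2"
    by (auto simp: eventually_sequentially)
  then have "\<exists>k. \<alpha> k < \<delta>"
    using \<delta> by (meson power2_less_imp_less less_imp_le)
  \<comment> \<open>Minimality makes all earlier coefficients at least \<delta>, so the box has
    positive volume even if \<alpha> has zeros.\<close>
  define m where "m = (LEAST k. \<alpha> k < \<delta>)"
  have m: "\<alpha> m < \<delta>"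
    unfolding m_def by (rule LeastI_ex) fact
  have \<alpha>_pos: "0 < \<alpha> i" if "i < m" for i
    using not_less_Least[of i "\<lambda>k. \<alpha> k < \<delta>"] that \<delta> by (auto simp: m_def)
  define \<rho> where "\<rho> = sqrt (1 - (\<Sum>i<m. (\<alpha> i)\<^sup>2))"
  have sum_le: "(\<Sum>i<m. (\<alpha> i)\<^sup>2) \<le> (\<Sum>k. (\<alpha> k)\<^sup>2)"
    using K(4) by (intro sum_le_suminf) auto
  have \<rho>: "0 < \<rho>" "\<rho> \<le> 1" "sqrt (1 - (\<Sum>k. (\<alpha> k)\<^sup>2)) \<le> \<rho>" "\<rho>\<^sup>2 = 1 - (\<Sum>i<m. (\<alpha> i)\<^sup>2)"
    using sum_le less by (auto simp: \<rho>_def sum_nonneg)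
  \<comment> \<open>The product is the volume of the box; 2^m comes from comparing ball volumes in
    dimensions n and n - m, and one more factor 2 from the shell factor exceeding 1/2.\<close>
  define c where "c = (\<Prod>i<m. \<delta> * \<alpha> i) / 2 ^ Suc m"
  have c: "0 < c"
    using \<alpha>_pos \<delta> by (auto simp: c_def intro!: divide_pos_pos prod_pos)
  have "\<forall>\<^sub>F N in sequentially. 1 / 2 < 1 - (1 - \<delta>) ^ N - exp 1 * (real N)\<^sup>2 * sqrt (1 - \<delta>\<^sup>2) ^ (N - 1)"
    using shell_factor_tendsto[of \<delta>] \<delta> by (intro order_tendstoD) auto
  then have "\<forall>\<^sub>F n in sequentially. 1 / 2 < 1 - (1 - \<delta>) ^ (n - m) - exp 1 * (real (n - m))\<^sup>2 * sqrt (1 - \<delta>\<^sup>2) ^ ((n - m) - 1)"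
    by (rule eventually_compose_filterlim[OF _ filterlim_minus_const_nat_at_top])
  then have "\<forall>\<^sub>F n in sequentially. c * sqrt (1 - (\<Sum>k. (\<alpha> k)\<^sup>2)) ^ n
    \<le> measure (sphere_uniform n) {\<theta> \<in> space (euclidean_borel n). \<forall>j\<in>{..<n}. \<bar>\<theta> j - \<alpha> j\<bar> < \<epsilon>}"
    using eventually_ge_at_top[of "m + 2"]
  proof eventually_elim
    case (elim n)
    let ?E = "{\<theta> \<in> space (euclidean_borel n). \<forall>j\<in>{..<n}. \<bar>\<theta> j - \<alpha> j\<bar> < \<epsilon>}"
    let ?T = "{x \<in> unit_ball n. (\<lambda>i\<in>{..<n}. x i / L2_set x {..<n}) \<in> ?E}"
    let ?J = "{..<m}" and ?L = "{m..<n}"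
    have JL: "finite ?J" "finite ?L" "?J \<inter> ?L = {}" "?J \<union> ?L = {..<n}"
      using elim(2) by auto
    let ?A = "\<Pi>\<^sub>E i\<in>?J. {(1 - \<delta>) * \<alpha> i..\<alpha> i}"
    let ?B = "{y \<in> space (\<Pi>\<^sub>M i\<in>?L. lborel). (\<Sum>i\<in>?L. (y i)\<^sup>2) \<le> \<rho>\<^sup>2
      \<and> ((1 - \<delta>) * \<rho>)\<^sup>2 < (\<Sum>i\<in>?L. (y i)\<^sup>2) \<and> (\<forall>j\<in>?L. \<bar>y j\<bar> \<le> \<delta>)}"
    let ?C = "{x \<in> space (euclidean_lborel n). restrict x ?J \<in> ?A \<and> restrict x ?L \<in> ?B}"
    have A: "?A \<in> sets (\<Pi>\<^sub>M i\<in>?J. lborel)"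
      by (intro sets_PiM_I_finite) auto
    have L2: "2 \<le> card ?L"
      using elim(2) by simp
    have B: "?B \<in> sets (\<Pi>\<^sub>M i\<in>?L. lborel)"
      using L2 \<rho> \<delta> \<delta>1 by (intro measure_shell_ge(1)) auto
    have "unit_ball_vol (real (n - m)) * \<rho> ^ (n - m) *
        (1 - (1 - \<delta>) ^ (n - m) - exp 1 * (real (n - m))\<^sup>2 * sqrt (1 - \<delta>\<^sup>2) ^ ((n - m) - 1))
      \<le> measure (\<Pi>\<^sub>M i\<in>?L. lborel) ?B"
      using measure_shell_ge(2)[OF JL(2) L2 \<rho>(1,2) \<delta>(1) \<delta>1] by (simp only: card_atLeastLessThan)
    moreover have "unit_ball_vol (real (n - m)) * \<rho> ^ (n - m) * (1 / 2) \<le> unit_ball_vol (real (n - m)) * \<rho> ^ (n - m) *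
        (1 - (1 - \<delta>) ^ (n - m) - exp 1 * (real (n - m))\<^sup>2 * sqrt (1 - \<delta>\<^sup>2) ^ ((n - m) - 1))"
      using \<rho> by (intro mult_left_mono less_imp_le[OF elim(1)]) auto
    ultimately have B_ge: "unit_ball_vol (real (n - m)) * \<rho> ^ (n - m) * (1 / 2) \<le> measure (\<Pi>\<^sub>M i\<in>?L. lborel) ?B"
      by (rule order_trans[rotated])
    have "sqrt (1 - (\<Sum>k. (\<alpha> k)\<^sup>2)) ^ n \<le> \<rho> ^ n"
      using \<rho> less by (intro power_mono) auto
    also have "\<dots> \<le> \<rho> ^ (n - m)"
      using \<rho> by (intro power_decreasing) auto
    finally have "unit_ball_vol n * sqrt (1 - (\<Sum>k. (\<alpha> k)\<^sup>2)) ^ n \<le> (2 ^ m * unit_ball_vol (real (n - m))) * \<rho> ^ (n - m)"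
      using unit_ball_vol_le[of m n] elim(2) less by (intro mult_mono) auto
    then have "c * (unit_ball_vol n * sqrt (1 - (\<Sum>k. (\<alpha> k)\<^sup>2)) ^ n) \<le> c * ((2 ^ m * unit_ball_vol (real (n - m))) * \<rho> ^ (n - m))"
      using c by (intro mult_left_mono) auto
    also have "\<dots> = (\<Prod>i<m. \<delta> * \<alpha> i) * (unit_ball_vol (real (n - m)) * \<rho> ^ (n - m) * (1 / 2))"
      by (simp add: c_def)
    also have "\<dots> \<le> (\<Prod>i<m. \<delta> * \<alpha> i) * measure (\<Pi>\<^sub>M i\<in>?L. lborel) ?B"
      using B_ge \<alpha>_pos \<delta> by (intro mult_left_mono prod_nonneg) (auto intro!: mult_nonneg_nonneg less_imp_le)
    also have "\<dots> = measure (euclidean_lborel n) ?C"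
    proof -
      have "emeasure (\<Pi>\<^sub>M i\<in>?J. lborel) ?A = ennreal (\<Prod>i<m. \<alpha> i - (1 - \<delta>) * \<alpha> i)"
      proof (rule emeasure_lborel_box)
        fix i assume "i \<in> ?J"
        then show "(1 - \<delta>) * \<alpha> i \<le> \<alpha> i"
          using \<alpha>_pos[of i] \<delta> by (simp add: mult_le_cancel_right1)
      qed simp
      also have "(\<Prod>i<m. \<alpha> i - (1 - \<delta>) * \<alpha> i) = (\<Prod>i<m. \<delta> * \<alpha> i)"
        by (intro prod.cong) (auto simp: algebra_simps)
      finally have "measure (\<Pi>\<^sub>M i\<in>?J. lborel) ?A = (\<Prod>i<m. \<delta> * \<alpha> i)"
        using prod_nonneg[of "{..<m}" "\<lambda>i. \<delta> * \<alpha> i"] K(2) \<delta> by (simp add: measure_def)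
      then show ?thesis
        using emeasure_lborel_restrict(2)[OF JL(1-3) A B] unfolding JL(4)
        by (simp only: measure_def enn2real_mult)
    qed
    also have "\<dots> \<le> measure (euclidean_lborel n) ?T"
    proof (rule measure_mono_fmeasurable)
      show "?C \<subseteq> ?T"
      proof
        fix x assume x: "x \<in> ?C"
        have \<rho>2: "((1 - \<delta>) * \<rho>)\<^sup>2 = (1 - \<delta>)\<^sup>2 * (1 - (\<Sum>i<m. (\<alpha> i)\<^sup>2))"
          by (simp add: power_mult_distrib \<rho>)
        have head: "(1 - \<delta>) * \<alpha> i \<le> x i \<and> x i \<le> \<alpha> i" if "i < m" for i
          using x that by (auto simp: PiE_iff)
        have tail: "\<bar>x i\<bar> \<le> \<delta>" if "m \<le> i" "i < n" for i
          using x that by auto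
        have shell: "(\<Sum>i\<in>?L. (x i)\<^sup>2) \<le> 1 - (\<Sum>i<m. (\<alpha> i)\<^sup>2)"
          "(1 - \<delta>)\<^sup>2 * (1 - (\<Sum>i<m. (\<alpha> i)\<^sup>2)) \<le> (\<Sum>i\<in>?L. (x i)\<^sup>2)"
          using x by (auto simp: \<rho>2 \<rho>(4))
        have "m \<le> n"
          using elim(2) by simp
        note close = normalised_close[OF \<alpha>' \<delta> m this head tail shell]
        have "x \<in> unit_ball n"
          using x close(1) by (simp add: unit_ball_def L2_set_def space_PiM)
        moreover have "(\<lambda>i\<in>{..<n}. x i / L2_set x {..<n}) \<in> ?E"
          using close(2) by (auto simp: \<delta>_def space_PiM)
        ultimately show "x \<in> ?T"
          by simp
      qed
      show "?C \<in> sets (euclidean_lborel n)"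
        using emeasure_lborel_restrict(1)[OF JL(1-3) A B] unfolding JL(4) .
      have E: "?E \<in> sets (euclidean_borel n)"
        by measurable
      have "{x \<in> space (euclidean_lborel n). x \<in> unit_ball n \<and> (\<lambda>i\<in>{..<n}. x i / L2_set x {..<n}) \<in> ?E} \<in> sets (euclidean_lborel n)"
        using unit_ball_sets[of n] E unfolding L2_set_def by measurable
      also have "{x \<in> space (euclidean_lborel n). x \<in> unit_ball n \<and> (\<lambda>i\<in>{..<n}. x i / L2_set x {..<n}) \<in> ?E} = ?T"
        by (auto simp: unit_ball_def space_PiM)
      finally have T: "?T \<in> sets (euclidean_lborel n)" .
      have "unit_ball n = euclidean_ball {..<n} 1"
        by (auto simp: unit_ball_def euclidean_ball_def L2_set_def space_PiM)
      then have "unit_ball n \<in> fmeasurable (euclidean_lborel n)"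
        by (simp add: fmeasurable_euclidean_ball)
      then show "?T \<in> fmeasurable (euclidean_lborel n)"
        by (rule fmeasurableI2) (use T in auto)
    qed
    finally have "c * sqrt (1 - (\<Sum>k. (\<alpha> k)\<^sup>2)) ^ n * unit_ball_vol n \<le> measure (euclidean_lborel n) ?T"
      by (simp only: mult.assoc mult.commute[of "unit_ball_vol n"])
    moreover have "measure (sphere_uniform n) ?E = measure (euclidean_lborel n) ?T / unit_ball_vol n"
      using elim(2) by (intro measure_sphere_uniform) auto
    ultimately show ?case
      by (simp add: pos_le_divide_eq)
  qed
  with c show ?thesis
    by blast
qed

subsection \<open>The large deviation principle\<close>

text \<open>Injectivity of the parametrisation makes the value independent of the choice hidden in
  \<open>inv_into\<close>.\<close>

definition ldp_rate :: "real measure \<Rightarrow> ereal" where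
  "ldp_rate \<nu> = (if \<nu> \<in> limit_law ` admissible
    then ereal (- (1 / 2) * ln (1 - (\<Sum>k. (inv_into admissible limit_law \<nu> k)\<^sup>2))) else \<infinity>)"

lemma ldp_rate_limit_law:
  "\<alpha> \<in> admissible \<Longrightarrow> ldp_rate (limit_law \<alpha>) = ereal (- (1 / 2) * ln (1 - (\<Sum>k. (\<alpha> k)\<^sup>2)))"
  by (simp add: ldp_rate_def inv_into_f_f[OF inj_on_limit_law])

lemma ldp_rate_le_iff:
  assumes \<alpha>: "\<alpha> \<in> admissible"
  shows "ldp_rate (limit_law \<alpha>) \<le> ereal c \<longleftrightarrow> (\<Sum>k. (\<alpha> k)\<^sup>2) \<le> 1 - exp (- 2 * c)"
proof -
  have "0 < 1 - (\<Sum>k. (\<alpha> k)\<^sup>2)"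
    using \<alpha> by (simp add: admissible_def)
  then have "- 2 * c \<le> ln (1 - (\<Sum>k. (\<alpha> k)\<^sup>2)) \<longleftrightarrow> exp (- 2 * c) \<le> 1 - (\<Sum>k. (\<alpha> k)\<^sup>2)"
    by (metis exp_le_cancel_iff exp_ln)
  then show ?thesis
    unfolding ldp_rate_limit_law[OF \<alpha>] ereal_less_eq by linarith
qed

lemma ldp_rate_nonneg: "0 \<le> ldp_rate \<nu>"
proof (cases "\<nu> \<in> limit_law ` admissible")
  case True
  then obtain \<alpha> where \<alpha>: "\<alpha> \<in> admissible" "\<nu> = limit_law \<alpha>"
    by blast
  then have "0 \<le> (\<Sum>k. (\<alpha> k)\<^sup>2)" "(\<Sum>k. (\<alpha> k)\<^sup>2) < 1"
    by (auto simp: admissible_def intro: suminf_nonneg)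
  then have "ln (1 - (\<Sum>k. (\<alpha> k)\<^sup>2)) \<le> 0"
    by simp
  then show ?thesis
    unfolding \<alpha>(2) ldp_rate_limit_law[OF \<alpha>(1)] by simp
qed (simp add: ldp_rate_def)

text \<open>In terms of parameters a level bounds the squared norm, hence all partial sums, which is
  a closed condition on a compact space. As exp (- 2 c) > 0, the norm stays below one. For negative
  \<open>c\<close> the condition already fails at \<open>m = 0\<close>.\<close>

lemma compactin_ldp_rate_sublevel:
  "compactin weak_topology {\<nu> \<in> topspace weak_topology. ldp_rate \<nu> \<le> ereal c}"
proof -
  let ?K = "ordered_ball \<inter> (\<Inter>m. {\<alpha>. (\<Sum>k<m. (\<alpha> k)\<^sup>2) \<le> 1 - exp (- 2 * c)})"
  have "{\<nu> \<in> topspace weak_topology. ldp_rate \<nu> \<le> ereal c} = limit_law ` ?K"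
  proof (intro set_eqI iffI)
    fix \<nu> assume "\<nu> \<in> {\<nu> \<in> topspace weak_topology. ldp_rate \<nu> \<le> ereal c}"
    then obtain \<alpha> where \<alpha>: "\<alpha> \<in> admissible" "\<nu> = limit_law \<alpha>" and "ldp_rate \<nu> \<le> ereal c"
      by (auto simp: ldp_rate_def split: if_splits)
    then have "(\<Sum>k. (\<alpha> k)\<^sup>2) \<le> 1 - exp (- 2 * c)"
      by (simp add: ldp_rate_le_iff)
    moreover have "(\<Sum>k<m. (\<alpha> k)\<^sup>2) \<le> (\<Sum>k. (\<alpha> k)\<^sup>2)" for m
      using \<alpha> by (intro sum_le_suminf) (auto simp: admissible_def)
    ultimately have "\<alpha> \<in> ?K"
      using \<alpha> by (auto simp: admissible_iff intro: order_trans)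
    then show "\<nu> \<in> limit_law ` ?K"
      using \<alpha> by blast
  next
    fix \<nu> assume "\<nu> \<in> limit_law ` ?K"
    then obtain \<alpha> where \<alpha>: "\<nu> = limit_law \<alpha>" "\<alpha> \<in> ordered_ball" "\<And>m. (\<Sum>k<m. (\<alpha> k)\<^sup>2) \<le> 1 - exp (- 2 * c)"
      by blast
    then have le: "(\<Sum>k. (\<alpha> k)\<^sup>2) \<le> 1 - exp (- 2 * c)"
      by (intro suminf_le_const ordered_ballD)
    also have "\<dots> < 1"
      by simp
    finally have "\<alpha> \<in> admissible"
      using \<alpha> by (simp add: admissible_iff)
    then show "\<nu> \<in> {\<nu> \<in> topspace weak_topology. ldp_rate \<nu> \<le> ereal c}"
      using le \<alpha> by (simp add: ldp_rate_le_iff topspace_weak_topology real_distribution_limit_law)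
  qed
  moreover have "compactin weak_topology (limit_law ` ?K)"
  proof (rule image_compactin[OF _ continuous_map_limit_law])
    have "compact ?K"
      by (intro compact_Int_closed compact_ordered_ball closed_INT ballI closed_Collect_le
          continuous_intros continuous_on_product_coordinates)
    then show "compactin (top_of_set ordered_ball) ?K"
      by (simp add: compactin_subtopology)
  qed
  ultimately show ?thesis
    by simp
qed

lemma good_rate_function_ldp_rate: "good_rate_function weak_topology ldp_rate"
  unfolding good_rate_function_def rate_function_def
  by (intro conjI ballI allI impI ldp_rate_nonneg compactin_ldp_rate_sublevel
      compactin_imp_closedin[OF Hausdorff_weak_topology])

section \<open>Exponential bounds for the probabilities of weakly measurable sets\<close>

abbreviation projection_prob :: "nat \<Rightarrow> real measure set \<Rightarrow> real" where
  "projection_prob n A \<equiv> measure (sphere_uniform n) {\<theta> \<in> space (euclidean_borel n). cube_projection n \<theta> \<in> A}"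

lemma projection_event_sets:
  "A \<in> sets (borel_algebra weak_topology) \<Longrightarrow>
    {\<theta> \<in> space (euclidean_borel n). cube_projection n \<theta> \<in> A} \<in> sets (euclidean_borel n)"
  using measurable_sets[OF measurable_cube_projection, of A n] by (simp add: vimage_def Int_def conj_commute)

text \<open>By compactness, a single partial sum of the ordered squares exceeds the level on all of the
  closure of \<open>A\<close>.\<close>

lemma projection_prob_le:
  assumes A: "A \<in> sets (borel_algebra weak_topology)" and a: "0 \<le> a"
    and level: "\<And>\<alpha>. \<alpha> \<in> ordered_ball \<Longrightarrow> limit_law \<alpha> \<in> weak_topology closure_of A \<Longrightarrow>
      1 - exp (- 2 * a) < (\<Sum>k. (\<alpha> k)\<^sup>2)"
  shows "\<exists>m. \<forall>n\<ge>m + 2. projection_prob n A \<le> exp 1 * real n ^ (2 * m) * exp (- a) ^ (n - m)"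
proof -
  define r where "r = 1 - exp (- 2 * a)"
  have r: "0 \<le> r" "r < 1" "sqrt (1 - r) = exp (- a)"
    using a by (auto simp: r_def exp_double[symmetric] intro!: real_sqrt_unique)
  define F where "F = {\<alpha> \<in> ordered_ball. limit_law \<alpha> \<in> weak_topology closure_of A}"
  have "closedin (top_of_set ordered_ball) F"
    using closedin_continuous_map_preimage[OF continuous_map_limit_law closedin_closure_of[of weak_topology A]]
    by (simp add: F_def)
  then have "compact F"
    by (rule closedin_compact[OF compact_ordered_ball])
  let ?O = "\<lambda>m. {\<alpha>. r < (\<Sum>k<m. (\<alpha> k)\<^sup>2)}"
  have cover: "F \<subseteq> (\<Union>m. ?O m)"
  proof
    fix \<alpha> assume \<alpha>: "\<alpha> \<in> F"
    then have "r < (\<Sum>k. (\<alpha> k)\<^sup>2)"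
      using level by (auto simp: F_def r_def)
    moreover have "(\<lambda>m. \<Sum>k<m. (\<alpha> k)\<^sup>2) \<longlonglongrightarrow> (\<Sum>k. (\<alpha> k)\<^sup>2)"
      using \<alpha> by (intro summable_LIMSEQ ordered_ballD) (simp add: F_def)
    ultimately have "\<forall>\<^sub>F m in sequentially. r < (\<Sum>k<m. (\<alpha> k)\<^sup>2)"
      by (intro order_tendstoD)
    then show "\<alpha> \<in> (\<Union>m. ?O m)"
      by (auto simp: eventually_sequentially)
  qed
  have op: "open (?O m)" for m
    by (intro open_Collect_less continuous_intros continuous_on_product_coordinates)
  obtain D where D: "finite D" "F \<subseteq> (\<Union>m\<in>D. ?O m)"
    by (rule compactE_image[OF \<open>compact F\<close> op cover])
  then obtain m where m: "\<forall>k\<in>D. k \<le> m"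
    by (meson finite_nat_set_iff_bounded_le)
  \<comment> \<open>Partial sums grow with the index, so a bound for the indices of the finite
    subcover serves on all of \<open>F\<close>.\<close>
  have F: "r < (\<Sum>k<m. (\<alpha> k)\<^sup>2)" if \<alpha>: "\<alpha> \<in> F" for \<alpha>
  proof -
    obtain k where "k \<in> D" "r < (\<Sum>i<k. (\<alpha> i)\<^sup>2)"
      using \<alpha> D by blast
    moreover have "(\<Sum>i<k. (\<alpha> i)\<^sup>2) \<le> (\<Sum>i<m. (\<alpha> i)\<^sup>2)"
      using m \<open>k \<in> D\<close> by (intro sum_mono2) auto
    ultimately show ?thesis
      by simp
  qed
  have A_closure: "A \<subseteq> weak_topology closure_of A"
    using sets.sets_into_space[OF A] by (intro closure_of_subset) (simp add: borel_algebra_def space_measure_of_conv)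
  have "projection_prob n A \<le> exp 1 * real n ^ (2 * m) * exp (- a) ^ (n - m)" if n: "m + 2 \<le> n" for n
  proof -
    interpret prob_space "sphere_uniform n"
      using n by (intro prob_space_sphere_uniform) simp
    let ?E = "{\<theta> \<in> space (euclidean_borel n). \<exists>J\<subseteq>{..<n}. card J = m \<and> r < (\<Sum>i\<in>J. (\<theta> i)\<^sup>2)}"
    have "projection_prob n A \<le> measure (sphere_uniform n) ?E"
    proof (rule finite_measure_mono_AE)
      have "AE \<theta> in sphere_uniform n. \<theta> \<in> unit_sphere n"
        using n by (intro AE_sphere_uniform) simp
      then show "AE \<theta> in sphere_uniform n. \<theta> \<in> {\<theta> \<in> space (euclidean_borel n). cube_projection n \<theta> \<in> A} \<longrightarrow> \<theta> \<in> ?E"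
      proof eventually_elim
        case (elim \<theta>)
        show ?case
        proof
          assume \<theta>: "\<theta> \<in> {\<theta> \<in> space (euclidean_borel n). cube_projection n \<theta> \<in> A}"
          obtain p where p: "bij_betw p {..<n} {..<n}" "\<And>i j. i \<le> j \<Longrightarrow> j < n \<Longrightarrow> \<bar>\<theta> (p j)\<bar> \<le> \<bar>\<theta> (p i)\<bar>"
            using exists_decreasing_rearrangement[of n "\<lambda>i. \<bar>\<theta> i\<bar>"] by blast
          \<comment> \<open>The sorted sphere point parametrises a law in \<open>A\<close>, so the m
            largest squares of \<theta> exceed \<open>r\<close>; their positions, the image of
            \<open>p\<close>, form the index set of the event.\<close>
          have "(\<lambda>i. if i < n then \<bar>\<theta> (p i)\<bar> else 0) \<in> F"
            using cube_projection_eq_limit_law[of p n \<theta>, OF p elim] \<theta> A_closure by (auto simp: F_def)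
          from F[OF this] have "r < (\<Sum>k<m. (\<theta> (p k))\<^sup>2)"
            using n by (simp cong: sum.cong_simp)
          moreover have inj: "inj_on p {..<m}"
            using p(1) n by (auto simp: bij_betw_def intro: inj_on_subset)
          ultimately have "r < (\<Sum>i\<in>p ` {..<m}. (\<theta> i)\<^sup>2)"
            by (simp add: sum.reindex)
          moreover have "p ` {..<m} \<subseteq> {..<n}"
            using p(1) n by (auto simp: bij_betw_def)
          moreover have "card (p ` {..<m}) = m"
            using inj by (simp add: card_image)
          ultimately show "\<theta> \<in> ?E"
            using \<theta> by blast
        qed
      qed
      show "?E \<in> sets (sphere_uniform n)"
        using measure_sphere_partial_sum_le(2)[of m n r] n r by (simp add: sphere_uniform_def)
    qed
    also have "\<dots> \<le> exp 1 * real n ^ (2 * m) * sqrt (1 - r) ^ (n - m)"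
      using n r by (intro measure_sphere_partial_sum_le) auto
    finally show ?thesis
      by (simp add: r(3))
  qed
  then show ?thesis
    by blast
qed

text \<open>The preimage of the interior contains a basic neighbourhood of \<alpha>. Sorting does
  not increase the supremum distance to the sorted \<alpha>, so closeness of the unsorted \<theta>
  suffices, and the probability of that is already bounded below.\<close>

lemma projection_prob_ge:
  assumes A: "A \<in> sets (borel_algebra weak_topology)" and \<alpha>: "\<alpha> \<in> admissible"
    and int: "limit_law \<alpha> \<in> weak_topology interior_of A"
  shows "\<exists>c>0. \<forall>\<^sub>F n in sequentially. c * sqrt (1 - (\<Sum>k. (\<alpha> k)\<^sup>2)) ^ n \<le> projection_prob n A"
proof -
  have \<alpha>': "\<alpha> \<in> ordered_ball"
    using \<alpha> by (simp add: admissible_iff)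
  have "openin (top_of_set ordered_ball) {\<beta> \<in> ordered_ball. limit_law \<beta> \<in> weak_topology interior_of A}"
    using openin_continuous_map_preimage[OF continuous_map_limit_law openin_interior_of[of weak_topology A]] by simp
  then obtain T where T: "open T" "{\<beta> \<in> ordered_ball. limit_law \<beta> \<in> weak_topology interior_of A} = ordered_ball \<inter> T"
    by (auto simp: openin_open)
  then have "\<alpha> \<in> T"
    using \<alpha>' int by blast
  \<comment> \<open>One number serves as count of restricted coordinates and as reciprocal
    tolerance, since each requirement holds for all large \<open>m\<close>.\<close>
  obtain m :: nat where near: "\<And>\<beta>. (\<And>i. i < m \<Longrightarrow> \<bar>\<beta> i - \<alpha> i\<bar> < 1 / real (Suc m)) \<Longrightarrow> \<beta> \<in> T"
  proof -
    have "openin (product_topology (\<lambda>_. euclidean) UNIV) T"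
      using T(1) by (simp add: euclidean_product_topology)
    from product_topology_open_contains_basis[OF this \<open>\<alpha> \<in> T\<close>]
    obtain X where X: "\<alpha> \<in> PiE UNIV X" "\<And>i. open (X i)" "finite {i. X i \<noteq> UNIV}" "PiE UNIV X \<subseteq> T"
      by auto
    let ?D = "{i. X i \<noteq> UNIV}"
    have "\<forall>\<^sub>F m in sequentially. \<forall>i\<in>?D. \<forall>x. \<bar>x - \<alpha> i\<bar> < 1 / real (Suc m) \<longrightarrow> x \<in> X i"
    proof (intro eventually_ball_finite X ballI)
      fix i
      have "\<exists>e>0. \<forall>x. \<bar>x - \<alpha> i\<bar> < e \<longrightarrow> x \<in> X i"
        using X(1) X(2)[of i] by (auto simp: open_dist dist_real_def PiE_iff)
      then obtain e where e: "0 < e" "\<And>x. \<bar>x - \<alpha> i\<bar> < e \<Longrightarrow> x \<in> X i"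
        by blast
      have "(\<lambda>m. 1 / real (Suc m)) \<longlonglongrightarrow> 0"
        by (intro LIMSEQ_Suc lim_const_over_n)
      then have "\<forall>\<^sub>F m in sequentially. 1 / real (Suc m) < e"
        using e by (intro order_tendstoD)
      then show "\<forall>\<^sub>F m in sequentially. \<forall>x. \<bar>x - \<alpha> i\<bar> < 1 / real (Suc m) \<longrightarrow> x \<in> X i"
        by eventually_elim (use e in auto)
    qed
    moreover have "\<forall>\<^sub>F m in sequentially. \<forall>i\<in>?D. i < m"
      using X(3) by (intro eventually_ball_finite ballI eventually_gt_at_top)
    ultimately have "\<forall>\<^sub>F m in sequentially. \<forall>i\<in>?D. i < m \<and> (\<forall>x. \<bar>x - \<alpha> i\<bar> < 1 / real (Suc m) \<longrightarrow> x \<in> X i)"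
      by eventually_elim auto
    then obtain m where m: "\<forall>i\<in>?D. i < m \<and> (\<forall>x. \<bar>x - \<alpha> i\<bar> < 1 / real (Suc m) \<longrightarrow> x \<in> X i)"
      by (auto simp: eventually_sequentially)
    show thesis
    proof (rule that[of m])
      fix \<beta> assume \<beta>: "\<And>i. i < m \<Longrightarrow> \<bar>\<beta> i - \<alpha> i\<bar> < 1 / real (Suc m)"
      have "\<beta> i \<in> X i" for i
        using m \<beta> by (cases "X i = UNIV") auto
      then show "\<beta> \<in> T"
        using X(4) by auto
    qed
  qed
  define \<epsilon> where "\<epsilon> = 1 / real (Suc m)"
  have \<epsilon>: "0 < \<epsilon>" "\<epsilon> \<le> 1"
    by (auto simp: \<epsilon>_def)
  obtain c where c: "0 < c" "\<forall>\<^sub>F n in sequentially. c * sqrt (1 - (\<Sum>k. (\<alpha> k)\<^sup>2)) ^ n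
      \<le> measure (sphere_uniform n) {\<theta> \<in> space (euclidean_borel n). \<forall>j\<in>{..<n}. \<bar>\<theta> j - \<alpha> j\<bar> < \<epsilon>}"
    using measure_sphere_near_ge[OF \<alpha> \<epsilon>] by blast
  have "\<forall>\<^sub>F n in sequentially. c * sqrt (1 - (\<Sum>k. (\<alpha> k)\<^sup>2)) ^ n \<le> projection_prob n A"
    using c(2) eventually_ge_at_top[of "Suc m"]
  proof eventually_elim
    case (elim n)
    interpret prob_space "sphere_uniform n"
      using elim(2) by (intro prob_space_sphere_uniform) simp
    let ?E = "{\<theta> \<in> space (euclidean_borel n). \<forall>j\<in>{..<n}. \<bar>\<theta> j - \<alpha> j\<bar> < \<epsilon>}"
    have "measure (sphere_uniform n) ?E \<le> projection_prob n A"
    proof (rule finite_measure_mono_AE)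
      have "AE \<theta> in sphere_uniform n. \<theta> \<in> unit_sphere n"
        using elim(2) by (intro AE_sphere_uniform) simp
      then show "AE \<theta> in sphere_uniform n. \<theta> \<in> ?E \<longrightarrow> \<theta> \<in> {\<theta> \<in> space (euclidean_borel n). cube_projection n \<theta> \<in> A}"
      proof eventually_elim
        case sphere: (elim \<theta>)
        show ?case
        proof
          assume \<theta>: "\<theta> \<in> ?E"
          obtain p where p: "bij_betw p {..<n} {..<n}" "\<And>i j. i \<le> j \<Longrightarrow> j < n \<Longrightarrow> \<bar>\<theta> (p j)\<bar> \<le> \<bar>\<theta> (p i)\<bar>"
            using exists_decreasing_rearrangement[of n "\<lambda>i. \<bar>\<theta> i\<bar>"] by blast
          let ?\<beta> = "\<lambda>i. if i < n then \<bar>\<theta> (p i)\<bar> else 0"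
          have "\<bar>?\<beta> i - \<alpha> i\<bar> < \<epsilon>" if "i < m" for i
            using rearrangement_close[of p n \<theta> \<alpha> \<epsilon> i, OF p ordered_ballD(1,2)[OF \<alpha>']] \<theta> that elim(2) by simp
          then have "?\<beta> \<in> T"
            unfolding \<epsilon>_def by (rule near)
          then have "limit_law ?\<beta> \<in> weak_topology interior_of A"
            using T(2) cube_projection_eq_limit_law(1)[of p n \<theta>, OF p sphere] by blast
          then have "cube_projection n \<theta> \<in> A"
            using cube_projection_eq_limit_law(2)[of p n \<theta>, OF p sphere] interior_of_subset[of weak_topology A] by auto
          then show "\<theta> \<in> {\<theta> \<in> space (euclidean_borel n). cube_projection n \<theta> \<in> A}"
            using \<theta> by simp
        qed
      qed
      show "{\<theta> \<in> space (euclidean_borel n). cube_projection n \<theta> \<in> A} \<in> sets (sphere_uniform n)"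
        using projection_event_sets[OF A] by (simp add: sphere_uniform_def)
    qed
    with elim(1) show ?case
      by simp
  qed
  with c(1) show ?thesis
    by blast
qed

section \<open>From probability bounds to exponential rates\<close>

lemma log_prob_divide: "0 < p \<Longrightarrow> 0 < x \<Longrightarrow> log_prob p / ereal x = ereal (ln p / x)"
  by (simp add: log_prob_def)

text \<open>After division by n, the logarithm of the power of n contributes 2 m ln n / n and the m
  missing factors contribute a m / n; both tend to 0.\<close>

lemma limsup_log_prob_le:
  assumes nonneg: "\<And>n. 0 \<le> p n"
    and le: "\<forall>n\<ge>m + 2. p n \<le> exp 1 * real n ^ (2 * m) * exp (- a) ^ (n - m)"
  shows "limsup (\<lambda>n. log_prob (p n) / ereal (real n)) \<le> ereal (- a)"
proof -
  let ?b = "\<lambda>n. 1 / real n + real (2 * m) * (ln (real n) / real n) - a + a * real m / real n"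
  have "limsup (\<lambda>n. log_prob (p n) / ereal (real n)) \<le> limsup (\<lambda>n. ereal (?b n))"
  proof (rule Limsup_mono, rule eventually_mono[OF eventually_ge_at_top[of "m + 2"]])
    fix n assume n: "m + 2 \<le> n"
    show "log_prob (p n) / ereal (real n) \<le> ereal (?b n)"
    proof (cases "p n = 0")
      case False
      then have pos: "0 < p n"
        using nonneg[of n] by simp
      have "ln (p n) \<le> ln (exp 1 * real n ^ (2 * m) * exp (- a) ^ (n - m))"
        using le n pos by (intro ln_mono) auto
      also have "\<dots> = 1 + real (2 * m) * ln (real n) - real (n - m) * a"
        using n by (simp add: ln_mult ln_realpow)
      finally have "ln (p n) / real n \<le> (1 + real (2 * m) * ln (real n) - real (n - m) * a) / real n"
        by (rule divide_right_mono) simp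
      also have "\<dots> = ?b n"
        using n by (simp add: of_nat_diff field_simps)
      finally show ?thesis
        using pos n by (simp add: log_prob_divide)
    qed (use n in \<open>simp add: log_prob_def\<close>)
  qed
  also have "limsup (\<lambda>n. ereal (?b n)) = ereal (- a)"
  proof (rule lim_imp_Limsup)
    have "?b \<longlonglongrightarrow> 0 + real (2 * m) * 0 - a + 0"
      by (intro tendsto_intros lim_ln_over_n lim_const_over_n)
    then show "(\<lambda>n. ereal (?b n)) \<longlonglongrightarrow> ereal (- a)"
      by simp
  qed simp
  finally show ?thesis .
qed

lemma limsup_log_prob_le_0:
  assumes "\<And>n. 1 \<le> n \<Longrightarrow> 0 \<le> p n \<and> p n \<le> 1"
  shows "limsup (\<lambda>n. log_prob (p n) / ereal (real n)) \<le> 0"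
proof (rule Limsup_bounded, rule eventually_mono[OF eventually_ge_at_top[of 1]])
  fix n :: nat assume n: "1 \<le> n"
  show "log_prob (p n) / ereal (real n) \<le> 0"
  proof (cases "p n = 0")
    case False
    then have "0 < p n" "p n \<le> 1"
      using assms[OF n] by auto
    then show ?thesis
      using n by (simp add: log_prob_divide divide_nonpos_nonneg)
  qed (use n in \<open>simp add: log_prob_def\<close>)
qed

lemma liminf_log_prob_ge:
  assumes c: "0 < c" and s: "0 < s" and le: "\<forall>\<^sub>F n in sequentially. c * s ^ n \<le> p n"
  shows "ereal (ln s) \<le> liminf (\<lambda>n. log_prob (p n) / ereal (real n))"
proof -
  let ?b = "\<lambda>n. ln c / real n + ln s"
  have "ereal (ln s) = liminf (\<lambda>n. ereal (?b n))"
  proof (rule lim_imp_Liminf[symmetric])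
    have "?b \<longlonglongrightarrow> 0 + ln s"
      by (intro tendsto_intros lim_const_over_n)
    then show "(\<lambda>n. ereal (?b n)) \<longlonglongrightarrow> ereal (ln s)"
      by simp
  qed simp
  also have "\<dots> \<le> liminf (\<lambda>n. log_prob (p n) / ereal (real n))"
  proof (rule Liminf_mono)
    show "\<forall>\<^sub>F n in sequentially. ereal (?b n) \<le> log_prob (p n) / ereal (real n)"
      using le eventually_ge_at_top[of 1]
    proof eventually_elim
      case (elim n)
      have pos: "0 < c * s ^ n"
        using c s by simp
      have "ln c + real n * ln s = ln (c * s ^ n)"
        using c s by (simp add: ln_mult ln_realpow)
      also have "\<dots> \<le> ln (p n)"
        using elim(1) pos by (intro ln_mono) auto
      finally have "(ln c + real n * ln s) / real n \<le> ln (p n) / real n"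
        by (rule divide_right_mono) simp
      then have "?b n \<le> ln (p n) / real n"
        using elim(2) by (simp add: add_divide_distrib)
      then show ?case
        using pos elim by (simp add: log_prob_divide)
    qed
  qed
  finally show ?thesis .
qed

theorem theorem1:
  fixes M :: "nat \<Rightarrow> 'a measure"
    and \<Theta> :: "nat \<Rightarrow> 'a \<Rightarrow> (nat \<Rightarrow> real)"
  assumes "\<And>n. 1 \<le> n \<Longrightarrow> prob_space (M n)"
    and "\<And>n. 1 \<le> n \<Longrightarrow> \<Theta> n \<in> M n \<rightarrow>\<^sub>M euclidean_borel n"
    and "\<And>n. 1 \<le> n \<Longrightarrow> distr (M n) (euclidean_borel n) (\<Theta> n) = sphere_uniform n"
  shows "\<exists>I :: real measure \<Rightarrow> ereal.
    satisfies_LDP weak_topology M (\<lambda>n \<omega>. cube_projection n (\<Theta> n \<omega>)) (\<lambda>n. real n) I \<and>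
    good_rate_function weak_topology I \<and>
    (\<forall>\<alpha>\<in>admissible. I (limit_law \<alpha>) = ereal (- (1 / 2) * ln (1 - (\<Sum>k. (\<alpha> k)\<^sup>2)))) \<and>
    (\<forall>\<nu>\<in>topspace weak_topology. \<nu> \<notin> limit_law ` admissible \<longrightarrow> I \<nu> = \<infinity>)"
proof (intro exI[of _ ldp_rate] conjI)
  show "good_rate_function weak_topology ldp_rate"
    by (rule good_rate_function_ldp_rate)
  show "\<forall>\<alpha>\<in>admissible. ldp_rate (limit_law \<alpha>) = ereal (- (1 / 2) * ln (1 - (\<Sum>k. (\<alpha> k)\<^sup>2)))"
    by (intro ballI ldp_rate_limit_law)
  show "\<forall>\<nu>\<in>topspace weak_topology. \<nu> \<notin> limit_law ` admissible \<longrightarrow> ldp_rate \<nu> = \<infinity>"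
    by (simp add: ldp_rate_def)
  show "satisfies_LDP weak_topology M (\<lambda>n \<omega>. cube_projection n (\<Theta> n \<omega>)) (\<lambda>n. real n) ldp_rate"
    unfolding satisfies_LDP_def
  proof (intro conjI allI impI ballI)
    fix n :: nat assume n: "1 \<le> n"
    show "prob_space (M n)"
      using n by (rule assms)
    show "(\<lambda>\<omega>. cube_projection n (\<Theta> n \<omega>)) \<in> M n \<rightarrow>\<^sub>M borel_algebra weak_topology"
      by (rule measurable_compose[OF assms(2)[OF n] measurable_cube_projection])
  next
    show "rate_function weak_topology ldp_rate"
      using good_rate_function_ldp_rate by (simp add: good_rate_function_def)
    show "filterlim real at_top sequentially"
      by (rule filterlim_real_sequentially)
  next
    fix A assume A: "A \<in> sets (borel_algebra weak_topology)"
    let ?p = "\<lambda>n. measure (M n) {\<omega> \<in> space (M n). cube_projection n (\<Theta> n \<omega>) \<in> A}"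
    have p: "?p n = projection_prob n A" if n: "1 \<le> n" for n
    proof -
      have "projection_prob n A = measure (M n) (\<Theta> n -` {\<theta> \<in> space (euclidean_borel n). cube_projection n \<theta> \<in> A} \<inter> space (M n))"
        unfolding assms(3)[OF n, symmetric] using assms(2)[OF n] projection_event_sets[OF A]
        by (rule measure_distr)
      also have "\<Theta> n -` {\<theta> \<in> space (euclidean_borel n). cube_projection n \<theta> \<in> A} \<inter> space (M n)
          = {\<omega> \<in> space (M n). cube_projection n (\<Theta> n \<omega>) \<in> A}"
        using measurable_space[OF assms(2)[OF n]] by auto
      finally show ?thesis ..
    qed
    show "- (INF x\<in>weak_topology interior_of A. ldp_rate x) \<le> liminf (\<lambda>n. log_prob (?p n) / ereal (real n))"
    proof -
      \<comment> \<open>Negation turns the claim into a lower bound for an infimum, so one law of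
        the interior at a time suffices; laws of infinite rate impose nothing.\<close>
      have "- liminf (\<lambda>n. log_prob (?p n) / ereal (real n)) \<le> ldp_rate \<nu>"
        if \<nu>: "\<nu> \<in> weak_topology interior_of A" for \<nu>
      proof (cases "\<nu> \<in> limit_law ` admissible")
        case True
        then obtain \<alpha> where \<alpha>: "\<alpha> \<in> admissible" "\<nu> = limit_law \<alpha>"
          by blast
        let ?s = "sqrt (1 - (\<Sum>k. (\<alpha> k)\<^sup>2))"
        have less: "0 < 1 - (\<Sum>k. (\<alpha> k)\<^sup>2)"
          using \<alpha>(1) by (simp add: admissible_def)
        obtain c where c: "0 < c" "\<forall>\<^sub>F n in sequentially. c * ?s ^ n \<le> projection_prob n A"
          using projection_prob_ge[OF A \<alpha>(1)] \<nu> \<alpha>(2) by blast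
        have "\<forall>\<^sub>F n in sequentially. c * ?s ^ n \<le> ?p n"
          using c(2) eventually_ge_at_top[of 1] by eventually_elim (simp only: p)
        then have "ereal (ln ?s) \<le> liminf (\<lambda>n. log_prob (?p n) / ereal (real n))"
          using less by (intro liminf_log_prob_ge[OF c(1)]) auto
        moreover have "ldp_rate \<nu> = - ereal (ln ?s)"
          using less by (simp add: \<alpha>(2) ldp_rate_limit_law[OF \<alpha>(1)] ln_sqrt)
        ultimately show ?thesis
          by (simp only: ereal_minus_le_minus)
      qed (simp add: ldp_rate_def)
      then have "- liminf (\<lambda>n. log_prob (?p n) / ereal (real n)) \<le> (INF x\<in>weak_topology interior_of A. ldp_rate x)"
        by (rule INF_greatest)
      then show ?thesis
        by (simp add: ereal_uminus_le_reorder)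
    qed
    show "limsup (\<lambda>n. log_prob (?p n) / ereal (real n)) \<le> - (INF x\<in>weak_topology closure_of A. ldp_rate x)"
    proof -
      \<comment> \<open>Approaching the infimum by strictly smaller levels provides the strict
        inequality on the closure and covers an infinite infimum in the same way.\<close>
      have "(INF x\<in>weak_topology closure_of A. ldp_rate x) \<le> - limsup (\<lambda>n. log_prob (?p n) / ereal (real n))"
      proof (rule dense_le)
        fix y assume y: "y < (INF x\<in>weak_topology closure_of A. ldp_rate x)"
        show "y \<le> - limsup (\<lambda>n. log_prob (?p n) / ereal (real n))"
        proof (cases "0 \<le> y")
          case True
          moreover have "y < \<infinity>"
            using y by auto
          ultimately obtain a where a: "y = ereal a" "0 \<le> a"
            by (cases y) auto
          \<comment> \<open>Sequences of norm one satisfy this at once; a sequence violating it is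
            admissible with rate at most \<open>y\<close>, which lies below the infimum.\<close>
          have "1 - exp (- 2 * a) < (\<Sum>k. (\<alpha> k)\<^sup>2)"
            if \<alpha>: "\<alpha> \<in> ordered_ball" "limit_law \<alpha> \<in> weak_topology closure_of A" for \<alpha>
          proof (rule ccontr)
            assume "\<not> 1 - exp (- 2 * a) < (\<Sum>k. (\<alpha> k)\<^sup>2)"
            then have le: "(\<Sum>k. (\<alpha> k)\<^sup>2) \<le> 1 - exp (- 2 * a)"
              by simp
            also have "\<dots> < 1"
              by simp
            finally have "ldp_rate (limit_law \<alpha>) \<le> y"
              using \<alpha>(1) le unfolding a(1) by (subst ldp_rate_le_iff) (auto simp: admissible_iff)
            moreover have "y < ldp_rate (limit_law \<alpha>)"
              using y \<alpha>(2) by (rule order_less_le_trans[OF _ INF_lower])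
            ultimately show False
              by simp
          qed
          from projection_prob_le[OF A a(2) this] obtain m
            where m: "\<forall>n\<ge>m + 2. projection_prob n A \<le> exp 1 * real n ^ (2 * m) * exp (- a) ^ (n - m)"
            by blast
          have "limsup (\<lambda>n. log_prob (?p n) / ereal (real n)) \<le> ereal (- a)"
          proof (rule limsup_log_prob_le)
            show "\<forall>n\<ge>m + 2. ?p n \<le> exp 1 * real n ^ (2 * m) * exp (- a) ^ (n - m)"
              using m p by simp
          qed simp
          then have "- ereal (- a) \<le> - limsup (\<lambda>n. log_prob (?p n) / ereal (real n))"
            by (simp only: ereal_minus_le_minus)
          then show ?thesis
            by (simp add: a(1))
        next
          case False
          \<comment> \<open>A negative level would make \<open>r\<close> negative, outside the range
            of the cone bound; that probabilities do not exceed 1 is enough here.\<close>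
          have "limsup (\<lambda>n. log_prob (?p n) / ereal (real n)) \<le> 0"
            by (rule limsup_log_prob_le_0) (simp add: prob_space.prob_le_1[OF assms(1)])
          then have "0 \<le> - limsup (\<lambda>n. log_prob (?p n) / ereal (real n))"
            by (simp add: ereal_0_le_uminus_iff)
          then show ?thesis
            using False by (meson linear order_trans)
        qed
      qed
      then have "- (- limsup (\<lambda>n. log_prob (?p n) / ereal (real n))) \<le> - (INF x\<in>weak_topology closure_of A. ldp_rate x)"
        by (simp only: ereal_minus_le_minus)
      then show ?thesis
        by (simp only: ereal_uminus_uminus)
    qed
  qed auto
qed

end
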